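(* Consider the Ising model on a $K\times L$ grid $\Lambda$ with periodic boundary conditions and with zero external magnetic field. Then each of the following sets is a minimal gate for the transition $\mathbf{-1}\to\mathbf{+1}$: (a) $\overline{\mathcal P}(\mathbf{-1},\mathbf{+1})$ and $\widetilde{\mathcal P}(\mathbf{-1},\mathbf{+1})$; (b) $\overline{\mathcal Q}(\mathbf{-1},\mathbf{+1})$ and $\widetilde{\mathcal Q}(\mathbf{-1},\mathbf{+1})$; (c) $\overline{\mathcal H}_i(\mathbf{-1},\mathbf{+1})$ and $\widetilde{\mathcal H}_i(\mathbf{-1},\mathbf{+1})$, for any $i=1,\dots,K-3$; (d) $\mathcal W_j^{(h)}(\mathbf{-1},\mathbf{+1})$, for any $j=2,\dots,L-3$ and any $h=1,\dots,K-1$. Moreover, the union $\mathcal G(\mathbf{-1},\mathbf{+1})$ of all minimal gates for the transition $\mathbf{-1}\to\mathbf{+1}$ is $$\mathcal G(\mathbf{-1},\mathbf{+1})=\bigcup_{j=2}^{L-3}\mathcal W_j(\mathbf{-1},\mathbf{+1})\cup\overline{\mathcal H}(\mathbf{-1},\mathbf{+1})\cup\widetilde{\mathcal H}(\mathbf{-1},\mathbf{+1})\cup\overline{\mathcal Q}(\mathbf{-1},\mathbf{+1})\cup\widetilde{\mathcal Q}(\mathbf{-1},\mathbf{+1})\cup\overline{\mathcal P}(\mathbf{-1},\mathbf{+1})\cup\widetilde{\mathcal P}(\mathbf{-1},\mathbf{+1}).$$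
   Context: Model. Fix integers $K<L$, $L\ge 3$. $\Lambda=(V,E)$ is the two-dimensional torus with $V=\{0,\dots,K-1\}\times\{0,\dots,L-1\}$ (vertex $(i,j)$ lies in row $i$ and column $j$; there are $K$ rows and $L$ columns) and $E$ the set of nearest-neighbour pairs with periodic boundary conditions. The Ising model with zero external field is the 2-state Potts model with $S=\{-1,+1\}$: $\mathcal X=S^V$, $H(\sigma)=-\sum_{(v,w)\in E}1_{\{\sigma(v)=\sigma(w)\}}$. $Q(\sigma,\sigma')=1/(2|V|)$ if $\sigma,\sigma'$ differ at exactly one vertex, and $Q(\sigma,\sigma')=0$ if they differ at more than one vertex. $\mathbf{-1},\mathbf{+1}$ are the two constant configurations, which are the global minima of $H$. Paths, saddles, gates. A path $\omega:\sigma\to\sigma'$ is a finite sequence $\omega_0=\sigma,\dots,\omega_n=\sigma'$ in $\mathcal X$ with $Q(\omega_i,\omega_{i+1})>0$; $\Omega_{\sigma,\sigma'}$ is the set of such paths; $\Phi_\omega=\max_i H(\omega_i)$; $\Phi(\sigma,\sigma')=\min_{\omega:\sigma\to\sigma'}\Phi_\omega$; $\Omega^{opt}_{\sigma,\sigma'}=\{\omega\in\Omega_{\sigma,\sigma'}:\Phi_\omega=\Phi(\sigma,\sigma')\}$ (optimal paths). $\mathcal S(\sigma,\sigma')$ is the set of $\xi\in\mathcal X$ such that there is $\omega\in\Omega^{opt}_{\sigma,\sigma'}$ with $\xi\in\omega$ and $H(\xi)=\max_{\eta\in\omega}H(\eta)$ (minimal saddles). A gate for $\sigma\to\sigma'$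 is a subset $\mathcal W\subseteq\mathcal S(\sigma,\sigma')$ such that $\omega\cap\mathcal W\ne\varnothing$ for all $\omega\in\Omega^{opt}_{\sigma,\sigma'}$. A gate $\mathcal W$ is a minimal gate if for every proper subset $\mathcal W'\subset\mathcal W$ there is $\omega'\in\Omega^{opt}_{\sigma,\sigma'}$ with $\omega'\cap\mathcal W'=\varnothing$. Sets of configurations (with $r=-1$, $s=+1$). $\bar R_{a,b}(r,s)$ is the set of configurations in which all spins are $r$ except those, equal to $s$, in a rectangle $a\times b$ of $\Lambda$ ($a$ = horizontal length, i.e. number of columns; $b$ = vertical length, i.e. number of rows). $\bar B^h_{a,b}(r,s)$, $1\le h\le b-1$, is the set of configurations in which all spins are $r$ except those, equal to $s$, in a rectangle $a\times b$ together with a bar $1\times h$ (one column wide, $h$ consecutive rows) adjacent to one of the sides of length $b$. $\tilde R_{a,b}(r,s)$, $\tilde B^h_{a,b}(r,s)$ are the same with the roles of $r$ and $s$ interchanged. Put $\overline{\mathcal P}(\mathbf r,\mathbf s)=\bar B^{K-1}_{1,K}(r,s)$; $\overline{\mathcal Q}(\mathbf r,\mathbf s)=\bar R_{2,K-1}(r,s)\cup\bar B^{K-2}_{1,K}(r,s)$; $\overline{\mathcal H}_i(\mathbf r,\mathbf s)=\bar B^i_{1,K}(r,s)\cup\bigcup_{h=i+1}^{K-2}\bar B^h_{1,K-1}(r,s)$ for $i=1,\dots,K-3$; $\overline{\mathcal H}(\mathbf r,\mathbf s)=\bigcup_{i=1}^{K-3}\overline{\mathcal H}_i(\mathbf r,\mathbf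 s)$; and $\widetilde{\mathcal P},\widetilde{\mathcal Q},\widetilde{\mathcal H}_i,\widetilde{\mathcal H}$ by the same formulas with $\tilde R,\tilde B$ in place of $\bar R,\bar B$. Finally $\mathcal W_j^{(h)}(\mathbf r,\mathbf s)=\bar B^h_{j,K}(r,s)=\tilde B^{K-h}_{L-j-1,K}(r,s)$ for $j=2,\dots,L-3$, $h=1,\dots,K-1$, and $\mathcal W_j(\mathbf r,\mathbf s)=\bigcup_{h=1}^{K-1}\mathcal W_j^{(h)}(\mathbf r,\mathbf s)$.
   Formalization: K ≥ 3 is assumed (for K ≤ 2 the set B̄^{K-2}_{1,K} in Q̄ is undefined), and the formula for the union of all minimal gates is stated only for K ≥ 4: for K = 3 it is false, since B̄^1_{1,3} ∪ B̄^1_{1,2} is a minimal gate whose L-trominoes are not in the right-hand side. *)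

theory Defs
  imports Complex_Main "HOL-Library.FuncSet"
begin

section \<open>Energy landscapes: paths, communication height, minimal saddles, gates\<close>

text \<open>An energy landscape is given by a finite state space \<open>X\<close>, a connectivity function \<open>Q\<close>
  and an energy function \<open>H\<close>. Paths are the nonempty lists of consecutively visited states.\<close>

definition paths :: "'a set \<Rightarrow> ('a \<Rightarrow> 'a \<Rightarrow> real) \<Rightarrow> 'a \<Rightarrow> 'a \<Rightarrow> 'a list set" where
  "paths X Q \<sigma> \<sigma>' = {\<omega>. \<omega> \<noteq> [] \<and> set \<omega> \<subseteq> X \<and> hd \<omega> = \<sigma> \<and> last \<omega> = \<sigma>' \<and>
     (\<forall>i. Suc i < length \<omega> \<longrightarrow> Q (\<omega> ! i) (\<omega> ! Suc i) > 0)}"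

definition height :: "('a \<Rightarrow> real) \<Rightarrow> 'a list \<Rightarrow> real" where
  "height H \<omega> = Max (H ` set \<omega>)"

text \<open>There are infinitely many paths, but as \<open>X\<close> is finite their heights form a finite set,
  so the minimum below is attained as soon as there is a path.\<close>

definition comm_height ::
    "'a set \<Rightarrow> ('a \<Rightarrow> 'a \<Rightarrow> real) \<Rightarrow> ('a \<Rightarrow> real) \<Rightarrow> 'a \<Rightarrow> 'a \<Rightarrow> real" where
  "comm_height X Q H \<sigma> \<sigma>' = Min (height H ` paths X Q \<sigma> \<sigma>')"

definition optimal_paths ::
    "'a set \<Rightarrow> ('a \<Rightarrow> 'a \<Rightarrow> real) \<Rightarrow> ('a \<Rightarrow> real) \<Rightarrow> 'a \<Rightarrow> 'a \<Rightarrow> 'a list set" where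
  "optimal_paths X Q H \<sigma> \<sigma>' =
     {\<omega> \<in> paths X Q \<sigma> \<sigma>'. height H \<omega> = comm_height X Q H \<sigma> \<sigma>'}"

definition minimal_saddles ::
    "'a set \<Rightarrow> ('a \<Rightarrow> 'a \<Rightarrow> real) \<Rightarrow> ('a \<Rightarrow> real) \<Rightarrow> 'a \<Rightarrow> 'a \<Rightarrow> 'a set" where
  "minimal_saddles X Q H \<sigma> \<sigma>' =
     {\<xi> \<in> X. \<exists>\<omega> \<in> optimal_paths X Q H \<sigma> \<sigma>'. \<xi> \<in> set \<omega> \<and> H \<xi> = height H \<omega>}"

definition gate ::
    "'a set \<Rightarrow> ('a \<Rightarrow> 'a \<Rightarrow> real) \<Rightarrow> ('a \<Rightarrow> real) \<Rightarrow> 'a \<Rightarrow> 'a \<Rightarrow> 'a set \<Rightarrow> bool" where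
  "gate X Q H \<sigma> \<sigma>' W \<longleftrightarrow> W \<subseteq> minimal_saddles X Q H \<sigma> \<sigma>' \<and>
     (\<forall>\<omega> \<in> optimal_paths X Q H \<sigma> \<sigma>'. set \<omega> \<inter> W \<noteq> {})"

definition minimal_gate ::
    "'a set \<Rightarrow> ('a \<Rightarrow> 'a \<Rightarrow> real) \<Rightarrow> ('a \<Rightarrow> real) \<Rightarrow> 'a \<Rightarrow> 'a \<Rightarrow> 'a set \<Rightarrow> bool" where
  "minimal_gate X Q H \<sigma> \<sigma>' W \<longleftrightarrow> gate X Q H \<sigma> \<sigma>' W \<and>
     (\<forall>W'. W' \<subset> W \<longrightarrow> (\<exists>\<omega> \<in> optimal_paths X Q H \<sigma> \<sigma>'. set \<omega> \<inter> W' = {}))"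


section \<open>The Ising model with zero external field on the discrete torus\<close>

type_synonym vertex = "nat \<times> nat"
type_synonym config = "vertex \<Rightarrow> int"

text \<open>The vertex \<open>(i, j)\<close> lies in row \<open>i\<close> and column \<open>j\<close>; there are \<open>K\<close> rows and \<open>L\<close> columns.\<close>

definition torus :: "nat \<Rightarrow> nat \<Rightarrow> vertex set" where
  "torus K L = {0..<K} \<times> {0..<L}"

definition torus_edges :: "nat \<Rightarrow> nat \<Rightarrow> vertex set set" where
  "torus_edges K L =
     {{(i, j), ((i + 1) mod K, j)} | i j. (i, j) \<in> torus K L} \<union>
     {{(i, j), (i, (j + 1) mod L)} | i j. (i, j) \<in> torus K L}"

definition configs :: "nat \<Rightarrow> nat \<Rightarrow> config set" where
  "configs K L = torus K L \<rightarrow>\<^sub>E {-1, 1}"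

definition energy :: "nat \<Rightarrow> nat \<Rightarrow> config \<Rightarrow> real" where
  "energy K L \<sigma> =
     - (\<Sum>e\<in>torus_edges K L. if \<forall>v\<in>e. \<forall>w\<in>e. \<sigma> v = \<sigma> w then 1 else 0)"

definition disagree :: "nat \<Rightarrow> nat \<Rightarrow> config \<Rightarrow> config \<Rightarrow> vertex set" where
  "disagree K L \<sigma> \<sigma>' = {v \<in> torus K L. \<sigma> v \<noteq> \<sigma>' v}"

text \<open>The diagonal entries make \<open>conn K L\<close> a stochastic matrix: each configuration has
  \<open>|V|\<close> neighbours, so \<open>1 - |V| / (2 |V|) = 1/2\<close> is left for \<open>\<sigma>' = \<sigma>\<close>.\<close>

definition conn :: "nat \<Rightarrow> nat \<Rightarrow> config \<Rightarrow> config \<Rightarrow> real" where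
  "conn K L \<sigma> \<sigma>' =
     (if card (disagree K L \<sigma> \<sigma>') = 0 then 1 / 2
      else if card (disagree K L \<sigma> \<sigma>') = 1 then 1 / (2 * real (card (torus K L)))
      else 0)"

definition two_valued :: "nat \<Rightarrow> nat \<Rightarrow> vertex set \<Rightarrow> int \<Rightarrow> int \<Rightarrow> config" where
  "two_valued K L A r s = (\<lambda>v\<in>torus K L. if v \<in> A then s else r)"

definition const_config :: "nat \<Rightarrow> nat \<Rightarrow> int \<Rightarrow> config" where
  "const_config K L r = (\<lambda>v\<in>torus K L. r)"

abbreviation ising_minimal_gate :: "nat \<Rightarrow> nat \<Rightarrow> config set \<Rightarrow> bool" where
  "ising_minimal_gate K L W \<equiv>
     minimal_gate (configs K L) (conn K L) (energy K L)
       (const_config K L (-1)) (const_config K L 1) W"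


section \<open>Rectangles and rectangles with a bar\<close>

text \<open>\<open>rect K L i j a b\<close> has \<open>a\<close> columns and \<open>b\<close> rows, starts at the corner \<open>(i, j)\<close> and wraps
  around the torus; for \<open>b = K\<close> it is a vertical band.\<close>

definition rect :: "nat \<Rightarrow> nat \<Rightarrow> nat \<Rightarrow> nat \<Rightarrow> nat \<Rightarrow> nat \<Rightarrow> vertex set" where
  "rect K L i j a b = {((i + x) mod K, (j + y) mod L) | x y. x < b \<and> y < a}"

definition R_bar :: "nat \<Rightarrow> nat \<Rightarrow> nat \<Rightarrow> nat \<Rightarrow> int \<Rightarrow> int \<Rightarrow> config set" where
  "R_bar K L a b r s = {two_valued K L (rect K L i j a b) r s | i j. (i, j) \<in> torus K L}"

text \<open>In \<open>B_bar\<close> the bar lies in the column directly to the right or directly to the left of the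
  rectangle, and its rows are rows of the rectangle. For \<open>b = K\<close> the side is a closed cycle, so
  the bar may start in any row. The notion is meant for \<open>1 \<le> h \<le> b - 1\<close>, and it is
  only used for such \<open>h\<close>.\<close>

definition B_bar :: "nat \<Rightarrow> nat \<Rightarrow> nat \<Rightarrow> nat \<Rightarrow> nat \<Rightarrow> int \<Rightarrow> int \<Rightarrow> config set" where
  "B_bar K L h a b r s =
     {two_valued K L (rect K L i j a b \<union> rect K L i' j' 1 h) r s | i j i' j'.
        (i, j) \<in> torus K L \<and> (i', j') \<in> torus K L \<and>
        (j' = (j + a) mod L \<or> (j' + 1) mod L = j) \<and>
        fst ` rect K L i' j' 1 h \<subseteq> fst ` rect K L i j a b}"

definition R_tilde :: "nat \<Rightarrow> nat \<Rightarrow> nat \<Rightarrow> nat \<Rightarrow> int \<Rightarrow> int \<Rightarrow> config set" where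
  "R_tilde K L a b r s = R_bar K L a b s r"

definition B_tilde :: "nat \<Rightarrow> nat \<Rightarrow> nat \<Rightarrow> nat \<Rightarrow> nat \<Rightarrow> int \<Rightarrow> int \<Rightarrow> config set" where
  "B_tilde K L h a b r s = B_bar K L h a b s r"

definition P_bar :: "nat \<Rightarrow> nat \<Rightarrow> int \<Rightarrow> int \<Rightarrow> config set" where
  "P_bar K L r s = B_bar K L (K - 1) 1 K r s"

definition P_tilde :: "nat \<Rightarrow> nat \<Rightarrow> int \<Rightarrow> int \<Rightarrow> config set" where
  "P_tilde K L r s = B_tilde K L (K - 1) 1 K r s"

definition Q_bar :: "nat \<Rightarrow> nat \<Rightarrow> int \<Rightarrow> int \<Rightarrow> config set" where
  "Q_bar K L r s = R_bar K L 2 (K - 1) r s \<union> B_bar K L (K - 2) 1 K r s"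

definition Q_tilde :: "nat \<Rightarrow> nat \<Rightarrow> int \<Rightarrow> int \<Rightarrow> config set" where
  "Q_tilde K L r s = R_tilde K L 2 (K - 1) r s \<union> B_tilde K L (K - 2) 1 K r s"

definition Hi_bar :: "nat \<Rightarrow> nat \<Rightarrow> nat \<Rightarrow> int \<Rightarrow> int \<Rightarrow> config set" where
  "Hi_bar K L i r s = B_bar K L i 1 K r s \<union> (\<Union>h\<in>{i+1..K-2}. B_bar K L h 1 (K - 1) r s)"

definition Hi_tilde :: "nat \<Rightarrow> nat \<Rightarrow> nat \<Rightarrow> int \<Rightarrow> int \<Rightarrow> config set" where
  "Hi_tilde K L i r s = B_tilde K L i 1 K r s \<union> (\<Union>h\<in>{i+1..K-2}. B_tilde K L h 1 (K - 1) r s)"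

definition H_bar :: "nat \<Rightarrow> nat \<Rightarrow> int \<Rightarrow> int \<Rightarrow> config set" where
  "H_bar K L r s = (\<Union>i\<in>{1..K-3}. Hi_bar K L i r s)"

definition H_tilde :: "nat \<Rightarrow> nat \<Rightarrow> int \<Rightarrow> int \<Rightarrow> config set" where
  "H_tilde K L r s = (\<Union>i\<in>{1..K-3}. Hi_tilde K L i r s)"

definition Wh :: "nat \<Rightarrow> nat \<Rightarrow> nat \<Rightarrow> nat \<Rightarrow> int \<Rightarrow> int \<Rightarrow> config set" where
  "Wh K L j h r s = B_bar K L h j K r s"

definition Wj :: "nat \<Rightarrow> nat \<Rightarrow> nat \<Rightarrow> int \<Rightarrow> int \<Rightarrow> config set" where
  "Wj K L j r s = (\<Union>h\<in>{1..K-1}. Wh K L j h r s)"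

end

theory Submission
  imports Defs
begin

text \<open>A configuration is identified with the set of its plus spins. Its energy is, up to the constant
  \<open>- 2 K L\<close>, the number \<open>bd\<close> of edges joining the set to its complement. Going once around a
  row or a column one meets either no such edge or at least two, so \<open>bd\<close> is at least twice the
  number of mixed (not constant) rows and columns. Filling the torus column by column shows that
  \<open>bd = 2 K + 2\<close> suffices for a path from the empty to the full set, and everything rests on how
  rigid the sets with \<open>bd \<le> 2 K + 2\<close> are.

  The middle of a path. If there are a full and an empty column, all \<open>K\<close> rows are mixed, so at most
  one column is, and each mixed row and column is an arc: the set is a vertical band with a bar
  (\<open>full_and_empty_column_fill\<close>). Its size then determines its shape, so a path that crosses from
  sets without a full column to sets without an empty one passes through every family
  \<open>Bset h a K\<close> of middle size.

  The ends of a path. While there is an empty column, the only single moves that destroy the last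
  full column lead from a band of one column with a bar to the shapes \<open>Bset h 1 (K - 1)\<close> and
  \<open>Rset 2 (K - 1)\<close>, or start from one bare column (\<open>lose_full_column\<close>); the second of these shapes
  can be left in two ways only (\<open>Rset_near\<close>). Every blocking statement is now read backwards from the full set: the far side of
  the gate is a set of configurations that no admissible move leaves except through the gate
  (\<open>far_step\<close>). Minimality is shown by explicit paths, most of which are monotone fillings and hence
  meet a family of sets of one size only once.

  The union of the minimal gates, for \<open>4 \<le> K\<close>. Cutting an optimal path at its
  last visit to the near side and replacing what comes before (\<open>reroute_start\<close>), and doing the same at the other end after exchanging
  the two spins, yields an optimal path whose saddles are saddles of the old path belonging to the
  union asserted in the theorem. By \<open>minimal_gate_subset\<close> no minimal gate contains any other saddle.
  The case \<open>L = K + 1\<close> needs care throughout, because horizontal bands are then admissible; they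
  are dead ends attached to one of the two sides (\<open>plusside_exit\<close>).\<close>

section \<open>Arcs of a cycle\<close>

definition changes :: "nat \<Rightarrow> nat set \<Rightarrow> nat" where
  "changes n S = card {i. i < n \<and> (i \<in> S) \<noteq> (Suc i mod n \<in> S)}"

definition arc :: "nat \<Rightarrow> nat \<Rightarrow> nat \<Rightarrow> nat set" where
  "arc n a l = (\<lambda>x. (a + x) mod n) ` {..<l}"

lemma offset_exists:
  assumes "i < n"
  shows "\<exists>x<n. i = (a + x) mod (n::nat)"
proof -
  have "(a + (i + (n - a mod n)) mod n) mod n = (a + (i + (n - a mod n))) mod n"
    by (simp add: mod_simps)
  also have "\<dots> = (a mod n + (i + (n - a mod n))) mod n" by (simp only: mod_add_left_eq)
  also have "a mod n + (i + (n - a mod n)) = i + n"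
    using assms mod_less_divisor[of n a] by linarith
  also have "(i + n) mod n = i" using assms by simp
  finally show ?thesis using assms by (intro exI[of _ "(i + (n - a mod n)) mod n"]) auto
qed

lemma offset_inj:
  assumes "(a + x) mod n = (a + y) mod n" "x < n" "y < (n::nat)"
  shows "x = y"
proof -
  have le: "u = v" if "u \<le> v" "v < n" "(a + u) mod n = (a + v) mod n" for u v
  proof -
    have "n dvd (a + v) - (a + u)"
      using that mod_eq_dvd_iff_nat[of "a + u" "a + v" n] by simp
    then have "n dvd v - u" by simp
    then show ?thesis using that by (metis diff_is_0_eq dvd_imp_le le_antisym less_imp_diff_less
        not_less not_gr_zero)
  qed
  show ?thesis using le[of x y] le[of y x] assms by (cases "x \<le> y") auto
qed

lemma offset_eq_iff: "x < n \<Longrightarrow> y < n \<Longrightarrow> (a + x) mod n = (a + y) mod n \<longleftrightarrow> x = (y::nat)"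
  using offset_inj by blast

lemma mem_arc_iff: "x < n \<Longrightarrow> l \<le> n \<Longrightarrow> (a + x) mod n \<in> arc n a l \<longleftrightarrow> x < l"
  by (auto simp: arc_def dest: offset_inj)

lemma arc_subset: "0 < n \<Longrightarrow> arc n a l \<subseteq> {..<n}"
  by (auto simp: arc_def)

lemma arc_0 [simp]: "arc n a 0 = {}"
  by (simp add: arc_def)

lemma arc_1: "arc n a (Suc 0) = {a mod n}"
  by (auto simp: arc_def)

lemma arc_Suc: "arc n a (Suc l) = insert ((a + l) mod n) (arc n a l)"
  by (auto simp: arc_def lessThan_Suc)

lemma arc_Suc_front: "arc n a (Suc l) = insert (a mod n) (arc n (Suc a) l)"
  unfolding arc_def lessThan_Suc_eq_insert_0 by (auto simp: image_image)

lemma arc_mod: "arc n (a mod n) l = arc n a l"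
  by (auto simp: arc_def mod_simps)

lemma inj_on_offset: "l \<le> n \<Longrightarrow> inj_on (\<lambda>x. (a + x) mod n) {..<l::nat}"
  by (auto intro!: inj_onI dest: offset_inj)

lemma card_arc: "l \<le> n \<Longrightarrow> card (arc n a l) = l"
  unfolding arc_def by (simp add: card_image inj_on_offset)

lemma arc_full: "0 < n \<Longrightarrow> arc n a n = {..<n}"
  by (rule card_subset_eq) (use card_arc[of n n a] arc_subset[of n a n] in auto)

lemma arc_compl: "0 < n \<Longrightarrow> l \<le> n \<Longrightarrow> {..<n} - arc n a l = arc n (a + l) (n - l)"
proof -
  assume n: "0 < n" "l \<le> n"
  have "i \<in> {..<n} - arc n a l \<longleftrightarrow> i \<in> arc n (a + l) (n - l)" for i
  proof (cases "i < n")
    case True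
    then obtain x where x: "x < n" "i = (a + x) mod n" using offset_exists by blast
    have "i \<in> arc n (a + l) (n - l) \<longleftrightarrow> l \<le> x"
    proof
      assume "i \<in> arc n (a + l) (n - l)"
      then obtain y where "y < n - l" "i = (a + (l + y)) mod n"
        by (auto simp: arc_def add.assoc)
      then show "l \<le> x" using x n offset_inj[of a x n "l + y"] by simp
    next
      assume "l \<le> x"
      then show "i \<in> arc n (a + l) (n - l)" using x
        by (auto simp: arc_def intro!: image_eqI[of _ _ "x - l"])
    qed
    then show ?thesis using True x n mem_arc_iff[of x n l a] by auto
  next
    case False
    then show ?thesis using n by (auto simp: arc_def)
  qed
  then show ?thesis by blast
qed

lemma changes_cong: "S \<inter> {..<n} = T \<inter> {..<n} \<Longrightarrow> changes n S = changes n T"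
proof -
  assume eq: "S \<inter> {..<n} = T \<inter> {..<n}"
  have "i < n \<Longrightarrow> i \<in> S \<longleftrightarrow> i \<in> T" for i using eq by blast
  then show ?thesis unfolding changes_def
    by (intro arg_cong[where f = card] Collect_cong) (metis bot_nat_0.not_eq_extremum mod_less_divisor not_less_zero)
qed

lemma changes_Compl: "changes n (- S) = changes n S"
  unfolding changes_def by (intro arg_cong[where f = card] Collect_cong) auto

text \<open>A set closed under the successor map of the cycle is everything or nothing.\<close>

lemma exists_exit:
  assumes "a < n" "b < n" "a \<in> S" "b \<notin> S"
  shows "\<exists>i<n. i \<in> S \<and> Suc i mod n \<notin> S"
proof (rule ccontr)
  assume "\<not> ?thesis"
  then have step: "i < n \<Longrightarrow> i \<in> S \<Longrightarrow> Suc i mod n \<in> S" for i by blast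
  have "(a + x) mod n \<in> S" for x
  proof (induction x)
    case (Suc x)
    then show ?case using step[of "(a + x) mod n"] assms(1) by (simp add: mod_simps)
  qed (use assms in simp)
  then show False using offset_exists[OF assms(2), of a] assms(4) by auto
qed

lemma changes_ge_2:
  assumes "a < n" "b < n" "a \<in> S" "b \<notin> S"
  shows "2 \<le> changes n S"
proof -
  obtain i where i: "i < n" "i \<in> S" "Suc i mod n \<notin> S" using exists_exit[OF assms] by blast
  obtain k where k: "k < n" "k \<notin> S" "Suc k mod n \<in> S"
    using exists_exit[of b n a "- S"] assms by auto
  have "card {i, k} \<le> changes n S"
    unfolding changes_def using i k by (intro card_mono) auto
  moreover have "i \<noteq> k" using i k by auto
  ultimately show ?thesis by simp
qed

lemma changes_trivial: "S \<inter> {..<n} = {} \<or> {..<n} \<subseteq> S \<Longrightarrow> changes n S = 0"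
  unfolding changes_def by (auto simp: card_eq_0_iff)

lemma changes_arc_le:
  assumes "l \<le> n" "0 < n"
  shows "changes n (arc n a l) \<le> 2"
proof -
  have "{i. i < n \<and> (i \<in> arc n a l) \<noteq> (Suc i mod n \<in> arc n a l)} \<subseteq>
      {(a + (n - 1)) mod n, (a + (l - 1)) mod n}"
  proof (rule subsetI, rule ccontr)
    fix i assume "i \<in> {i. i < n \<and> (i \<in> arc n a l) \<noteq> (Suc i mod n \<in> arc n a l)}"
      and ni: "i \<notin> {(a + (n - 1)) mod n, (a + (l - 1)) mod n}"
    then have i: "i < n" "(i \<in> arc n a l) \<noteq> (Suc i mod n \<in> arc n a l)" by auto
    obtain x where x: "x < n" "i = (a + x) mod n" using offset_exists i by blast
    have x1: "x + 1 < n" using x(1) ni unfolding x(2) by (metis Suc_eq_plus1 Suc_lessI diff_Suc_1 insertI1)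
    have s: "Suc i mod n = (a + (x + 1)) mod n" using x by (simp add: mod_simps)
    have "(x < l) \<noteq> (x + 1 < l)"
      using i(2) mem_arc_iff[OF x(1) assms(1), of a] mem_arc_iff[OF x1 assms(1), of a] x(2)
      unfolding s by simp
    then have "x = l - 1" by linarith
    then show False using ni unfolding x(2) by blast
  qed
  then have "changes n (arc n a l) \<le> card {(a + (n - 1)) mod n, (a + (l - 1)) mod n}"
    unfolding changes_def by (intro card_mono) auto
  also have "\<dots> \<le> 2" by (simp add: card_insert_if)
  finally show ?thesis .
qed

text \<open>Start at an entry into \<open>S\<close> and let \<open>l\<close> be the first offset outside \<open>S\<close>: the entry and the exit
  already account for two changes, and re-entering would cost a third.\<close>

lemma arc_of_changes_le_2:
  assumes "changes n S \<le> 2" "u < n" "v < n" "u \<in> S" "v \<notin> S"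
  shows "\<exists>a l. a < n \<and> 1 \<le> l \<and> l < n \<and> S \<inter> {..<n} = arc n a l"
proof -
  obtain k where k: "k < n" "k \<notin> S" "Suc k mod n \<in> S"
    using exists_exit[of v n u "- S"] assms(2-5) by blast
  define a where "a = Suc k mod n"
  define h where "h x \<longleftrightarrow> (a + x) mod n \<in> S" for x
  have n: "0 < n" "a < n" using assms by (auto simp: a_def)
  have off: "(k + Suc x) mod n = (a + x) mod n" for x by (simp add: a_def mod_simps)
  have suc: "Suc ((k + x) mod n) mod n = (a + x) mod n" for x by (simp add: a_def mod_simps)
  have h0: "h 0" using k by (simp add: h_def a_def)
  have hn: "\<not> h (n - 1)"
    using k n off[of "n - 1"] by (simp add: h_def)
  define l where "l = (LEAST x. \<not> h x)"
  have l1: "\<not> h l" unfolding l_def by (rule LeastI[of "\<lambda>x. \<not> h x", OF hn])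
  have l2: "x < l \<Longrightarrow> h x" for x unfolding l_def using not_less_Least by blast
  have l3: "l \<le> n - 1" unfolding l_def by (rule Least_le[of "\<lambda>x. \<not> h x", OF hn])
  have l4: "1 \<le> l" using l1 h0 by (cases l) auto
  have beyond: "l \<le> x \<Longrightarrow> x < n \<Longrightarrow> \<not> h x" for x
  proof (induction x rule: dec_induct)
    case base then show ?case using l1 by simp
  next
    case (step x)
    show ?case
    proof
      assume hs: "h (Suc x)"
      have "{k, (k + l) mod n, (k + Suc x) mod n} \<subseteq> {i. i < n \<and> (i \<in> S) \<noteq> (Suc i mod n \<in> S)}"
      proof -
        have l': "Suc (l - 1) = l" using l4 by simp
        have "(k + l) mod n \<in> S" using l2[of "l - 1"] l4 off[of "l - 1"] unfolding l' h_def by simp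
        moreover have "Suc ((k + l) mod n) mod n \<notin> S" using l1 unfolding h_def suc .
        moreover have "(k + Suc x) mod n \<notin> S" using step(3,4) unfolding h_def off by simp
        moreover have "Suc ((k + Suc x) mod n) mod n \<in> S" using hs unfolding h_def suc .
        ultimately show ?thesis using k n by auto
      qed
      then have "card {k, (k + l) mod n, (k + Suc x) mod n} \<le> changes n S"
        unfolding changes_def by (intro card_mono) auto
      moreover have "k \<noteq> (k + l) mod n"
        using offset_eq_iff[of 0 n l k] k(1) l3 l4 by simp
      moreover have "k \<noteq> (k + Suc x) mod n"
        using offset_eq_iff[of 0 n "Suc x" k] k(1) step(4) by simp
      moreover have "(k + l) mod n \<noteq> (k + Suc x) mod n"
        using offset_eq_iff[of l n "Suc x" k] step(1,4) by simp
      ultimately show False using assms(1) by auto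
    qed
  qed
  have "i \<in> S \<longleftrightarrow> i \<in> arc n a l" if i: "i < n" for i
  proof -
    obtain x where x: "x < n" "i = (a + x) mod n" using offset_exists i by blast
    have "i \<in> S \<longleftrightarrow> h x" unfolding h_def x(2) ..
    also have "\<dots> \<longleftrightarrow> x < l" using l2[of x] beyond[of x] x(1) by linarith
    also have "\<dots> \<longleftrightarrow> i \<in> arc n a l"
      unfolding x(2) using mem_arc_iff[of x n l a] x(1) l3 by linarith
    finally show ?thesis .
  qed
  then have "S \<inter> {..<n} = arc n a l" using arc_subset[OF n(1), of a l] by blast
  moreover have "l < n" using l3 n(1) by linarith
  ultimately show ?thesis using n(2) l4 by blast
qed

section \<open>The boundary of a set of vertices\<close>

definition row :: "vertex set \<Rightarrow> nat \<Rightarrow> nat set" where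
  "row A i = {j. (i, j) \<in> A}"

definition col :: "vertex set \<Rightarrow> nat \<Rightarrow> nat set" where
  "col A j = {i. (i, j) \<in> A}"

lemma mem_row [simp]: "j \<in> row A i \<longleftrightarrow> (i, j) \<in> A" by (simp add: row_def)
lemma mem_col [simp]: "i \<in> col A j \<longleftrightarrow> (i, j) \<in> A" by (simp add: col_def)

text \<open>The number of edges of the torus with exactly one end in \<open>A\<close>.\<close>

definition bd :: "nat \<Rightarrow> nat \<Rightarrow> vertex set \<Rightarrow> nat" where
  "bd K L A = (\<Sum>i<K. changes L (row A i)) + (\<Sum>j<L. changes K (col A j))"

definition mixed :: "nat \<Rightarrow> nat set \<Rightarrow> bool" where
  "mixed n S \<longleftrightarrow> \<not> {..<n} \<subseteq> S \<and> S \<inter> {..<n} \<noteq> {}"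

lemma mixed_iff: "mixed n S \<longleftrightarrow> (\<exists>i<n. i \<in> S) \<and> (\<exists>i<n. i \<notin> S)"
  by (auto simp: mixed_def)

lemma mixed_changes: "mixed n S \<Longrightarrow> 2 \<le> changes n S"
  using changes_ge_2[of _ n _ S] by (auto simp: mixed_iff)

lemma mixed_arc:
  assumes "changes n S \<le> 2" "mixed n S"
  shows "\<exists>a l. a < n \<and> 1 \<le> l \<and> l < n \<and> S \<inter> {..<n} = arc n a l"
proof -
  obtain u v where "u < n" "u \<in> S" "v < n" "v \<notin> S" using assms(2) by (auto simp: mixed_iff)
  then show ?thesis using arc_of_changes_le_2[OF assms(1), of u v] by blast
qed

lemma sum_ge_twice_card:
  assumes "finite I" "M \<subseteq> I" "\<And>i. i \<in> M \<Longrightarrow> 2 \<le> (f i :: nat)"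
  shows "2 * card M \<le> sum f I"
proof -
  have "2 * card M = (\<Sum>i\<in>M. 2)" by simp
  also have "\<dots> \<le> sum f M" by (rule sum_mono) (rule assms(3))
  also have "\<dots> \<le> sum f I" by (rule sum_mono2) (use assms in auto)
  finally show ?thesis .
qed

text \<open>In the tight case this bounds the weight of each single member from above; that is how a set of
  minimal energy is seen to have arcs as rows and columns.\<close>

lemma sum_ge_twice_card_except:
  assumes "finite I" "M \<subseteq> I" "\<And>i. i \<in> M \<Longrightarrow> 2 \<le> (f i :: nat)" "k \<in> M"
  shows "2 * card M + f k \<le> sum f I + 2"
proof -
  have "2 * card (M - {k}) \<le> sum f (I - {k})"
    by (rule sum_ge_twice_card) (use assms in auto)
  moreover have "sum f I = f k + sum f (I - {k})"
    by (rule sum.remove) (use assms in auto)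
  moreover have "card M = Suc (card (M - {k}))"
    using assms finite_subset by (metis card_Suc_Diff1)
  ultimately show ?thesis by simp
qed

definition mixed_rows :: "nat \<Rightarrow> nat \<Rightarrow> vertex set \<Rightarrow> nat set" where
  "mixed_rows K L A = {i. i < K \<and> mixed L (row A i)}"

definition mixed_cols :: "nat \<Rightarrow> nat \<Rightarrow> vertex set \<Rightarrow> nat set" where
  "mixed_cols K L A = {j. j < L \<and> mixed K (col A j)}"

lemma finite_mixed_rows [simp]: "finite (mixed_rows K L A)" and finite_mixed_cols [simp]: "finite (mixed_cols K L A)"
  by (auto simp: mixed_rows_def mixed_cols_def)

lemma bd_ge: "2 * card (mixed_rows K L A) + 2 * card (mixed_cols K L A) \<le> bd K L A"
proof -
  have "2 * card (mixed_rows K L A) \<le> (\<Sum>i<K. changes L (row A i))"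
    by (rule sum_ge_twice_card) (auto simp: mixed_rows_def mixed_changes)
  moreover have "2 * card (mixed_cols K L A) \<le> (\<Sum>j<L. changes K (col A j))"
    by (rule sum_ge_twice_card) (auto simp: mixed_cols_def mixed_changes)
  ultimately show ?thesis by (simp add: bd_def)
qed

lemma bd_ge_card:
  assumes "finite R" "finite C"
    and "R \<subseteq> mixed_rows K L A" "C \<subseteq> mixed_cols K L A"
  shows "2 * card R + 2 * card C \<le> bd K L A"
proof -
  have "card R \<le> card (mixed_rows K L A)" "card C \<le> card (mixed_cols K L A)"
    using assms by (auto intro!: card_mono)
  then show ?thesis using bd_ge[of K L A] by linarith
qed

lemma row_changes_le:
  assumes "i \<in> mixed_rows K L A"
  shows "2 * card (mixed_rows K L A) + 2 * card (mixed_cols K L A) + changes L (row A i) \<le> bd K L A + 2"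
proof -
  have "2 * card (mixed_rows K L A) + changes L (row A i) \<le> (\<Sum>i<K. changes L (row A i)) + 2"
    using assms by (intro sum_ge_twice_card_except) (auto simp: mixed_rows_def mixed_changes)
  moreover have "2 * card (mixed_cols K L A) \<le> (\<Sum>j<L. changes K (col A j))"
    by (rule sum_ge_twice_card) (auto simp: mixed_cols_def mixed_changes)
  ultimately show ?thesis by (simp add: bd_def)
qed

lemma col_changes_le:
  assumes "j \<in> mixed_cols K L A"
  shows "2 * card (mixed_rows K L A) + 2 * card (mixed_cols K L A) + changes K (col A j) \<le> bd K L A + 2"
proof -
  have "2 * card (mixed_cols K L A) + changes K (col A j) \<le> (\<Sum>j<L. changes K (col A j)) + 2"
    using assms by (intro sum_ge_twice_card_except) (auto simp: mixed_cols_def mixed_changes)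
  moreover have "2 * card (mixed_rows K L A) \<le> (\<Sum>i<K. changes L (row A i))"
    by (rule sum_ge_twice_card) (auto simp: mixed_rows_def mixed_changes)
  ultimately show ?thesis by (simp add: bd_def)
qed

lemma bd_le:
  assumes "finite R" "finite C"
    and "\<And>i. i < K \<Longrightarrow> changes L (row A i) \<le> (if i \<in> R then 2 else 0)"
    and "\<And>j. j < L \<Longrightarrow> changes K (col A j) \<le> (if j \<in> C then 2 else 0)"
  shows "bd K L A \<le> 2 * card R + 2 * card C"
proof -
  have *: "(\<Sum>i<n. f i) \<le> 2 * card S"
    if "finite S" "\<And>i. i < n \<Longrightarrow> f i \<le> (if i \<in> S then 2 else (0::nat))" for n :: nat and f S
  proof -
    have "(\<Sum>i<n. f i) \<le> (\<Sum>i<n. if i \<in> S then 2 else 0)" by (rule sum_mono) (use that in auto)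
    also have "\<dots> = 2 * card ({..<n} \<inter> S)"
      by (subst sum.inter_restrict[symmetric]) simp_all
    also have "\<dots> \<le> 2 * card S" using that(1) by (simp add: card_mono)
    finally show ?thesis .
  qed
  show ?thesis unfolding bd_def using *[OF assms(1,3)] *[OF assms(2,4)] by (rule add_mono)
qed

lemma bd_compl: "bd K L (torus K L - A) = bd K L A"
proof -
  have "changes L (row (torus K L - A) i) = changes L (row A i)" if "i < K" for i
  proof -
    have "changes L (row (torus K L - A) i) = changes L (- row A i)"
      by (rule changes_cong) (use that in \<open>auto simp: torus_def\<close>)
    then show ?thesis by (simp add: changes_Compl)
  qed
  moreover have "changes K (col (torus K L - A) j) = changes K (col A j)" if "j < L" for j
  proof -
    have "changes K (col (torus K L - A) j) = changes K (- col A j)"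
      by (rule changes_cong) (use that in \<open>auto simp: torus_def\<close>)
    then show ?thesis by (simp add: changes_Compl)
  qed
  ultimately show ?thesis by (simp add: bd_def)
qed

section \<open>Ising configurations as sets of vertices\<close>

definition cfg :: "nat \<Rightarrow> nat \<Rightarrow> vertex set \<Rightarrow> config" where
  "cfg K L A = two_valued K L A (-1) 1"

lemma finite_torus [simp]: "finite (torus K L)" by (simp add: torus_def)

lemma card_torus: "card (torus K L) = K * L" by (simp add: torus_def)

lemma cfg_eq_1_iff: "v \<in> torus K L \<Longrightarrow> cfg K L A v = 1 \<longleftrightarrow> v \<in> A"
  by (simp add: cfg_def two_valued_def)

lemma cfg_eq_iff: "v \<in> torus K L \<Longrightarrow> w \<in> torus K L \<Longrightarrow>
    cfg K L A v = cfg K L B w \<longleftrightarrow> (v \<in> A \<longleftrightarrow> w \<in> B)"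
  by (simp add: cfg_def two_valued_def)

lemma configs_eq: "configs K L = cfg K L ` Pow (torus K L)"
proof (intro equalityI subsetI)
  fix \<sigma> assume s: "\<sigma> \<in> configs K L"
  have "\<sigma> = cfg K L {v \<in> torus K L. \<sigma> v = 1}"
  proof
    fix v show "\<sigma> v = cfg K L {v \<in> torus K L. \<sigma> v = 1} v"
      using PiE_mem[of \<sigma> _ _ v] PiE_arb[of \<sigma> _ _ v] s[unfolded configs_def]
      by (cases "v \<in> torus K L") (auto simp: cfg_def two_valued_def)
  qed
  then show "\<sigma> \<in> cfg K L ` Pow (torus K L)" by blast
qed (auto simp: configs_def cfg_def two_valued_def split: if_splits)

lemma inj_on_cfg: "inj_on (cfg K L) (Pow (torus K L))"
proof (rule inj_on_inverseI)
  fix A assume "A \<in> Pow (torus K L)"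
  then show "{v \<in> torus K L. cfg K L A v = 1} = A" by (auto simp: cfg_eq_1_iff)
qed

lemma finite_configs: "finite (configs K L)"
  unfolding configs_eq by simp

lemma cfg_empty: "cfg K L {} = const_config K L (-1)"
  and cfg_torus: "cfg K L (torus K L) = const_config K L 1"
  by (auto simp: cfg_def two_valued_def const_config_def)

lemma two_valued_compl: "two_valued K L A 1 (-1) = cfg K L (torus K L - A)"
  by (auto simp: cfg_def two_valued_def)

text \<open>One spin is flipped or, as the diagonal of \<open>conn\<close> is positive, none.\<close>

definition near :: "vertex set \<Rightarrow> vertex set \<Rightarrow> bool" where
  "near A B \<longleftrightarrow> (\<exists>v. B = insert v A \<or> B = A - {v})"

lemma near_refl: "near A A"
proof (cases "A = {}")
  case False
  then obtain v where "v \<in> A" by blast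
  then have "A = insert v A" by (simp add: insert_absorb)
  then show ?thesis unfolding near_def by (intro exI) (rule disjI1)
qed (simp add: near_def)

lemma near_sym: "near A B \<Longrightarrow> near B A"
proof -
  assume "near A B"
  then obtain v where "B = insert v A \<or> B = A - {v}" unfolding near_def by blast
  then consider "A = insert v B" | "A = B - {v}" | "A = B" by auto
  then show ?thesis
    by cases (use near_refl[of A] in \<open>auto simp only: near_def\<close>)
qed

lemma conn_cfg_iff:
  assumes "A \<subseteq> torus K L" "B \<subseteq> torus K L" "torus K L \<noteq> {}"
  shows "conn K L (cfg K L A) (cfg K L B) > 0 \<longleftrightarrow> near A B"
proof -
  have d: "disagree K L (cfg K L A) (cfg K L B) = (A - B) \<union> (B - A)"
    using assms by (auto simp: disagree_def cfg_eq_iff)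
  have fin: "finite ((A - B) \<union> (B - A))"
    using assms finite_subset[OF _ finite_torus] by auto
  have "card (torus K L) > 0" using assms(3) by (simp add: card_gt_0_iff)
  then have "conn K L (cfg K L A) (cfg K L B) > 0 \<longleftrightarrow> card ((A - B) \<union> (B - A)) \<le> Suc 0"
    by (auto simp: conn_def d)
  also have "\<dots> \<longleftrightarrow> near A B"
  proof
    assume "card ((A - B) \<union> (B - A)) \<le> Suc 0"
    then have *: "x = y" if "x \<in> (A - B) \<union> (B - A)" "y \<in> (A - B) \<union> (B - A)" for x y
      using card_le_Suc0_iff_eq[OF fin] that by blast
    consider "A = B" | v where "v \<in> A - B" | v where "v \<in> B - A" by blast
    then show "near A B"
    proof cases
      case 1
      then show ?thesis using near_refl by simp
    next
      case (2 v)
      then have "B = A - {v}" using *[of v] by blast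
      then show ?thesis unfolding near_def by blast
    next
      case (3 v)
      then have "B = insert v A" using *[of v] by blast
      then show ?thesis unfolding near_def by blast
    qed
  next
    assume "near A B"
    then show "card ((A - B) \<union> (B - A)) \<le> Suc 0"
      using card_le_Suc0_iff_eq[OF fin] unfolding near_def by auto
  qed
  finally show ?thesis .
qed

text \<open>From three rows and columns on, the edges out of a vertex to its right and to its lower
  neighbour enumerate all edges without repetition.\<close>

lemma energy_cfg:
  assumes "3 \<le> K" "3 \<le> L" "A \<subseteq> torus K L"
  shows "energy K L (cfg K L A) = real (bd K L A) - 2 * real (K * L)"
proof -
  define f where "f = (\<lambda>(i, j). {(i, j), ((i + 1) mod K, j::nat)})"
  define g where "g = (\<lambda>(i, j). {(i::nat, j), (i, (j + 1) mod L)})"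
  define w :: "vertex set \<Rightarrow> real" where
    "w e = (if \<forall>v\<in>e. \<forall>u\<in>e. cfg K L A v = cfg K L A u then 1 else 0)" for e
  have edges: "torus_edges K L = f ` torus K L \<union> g ` torus K L"
    unfolding torus_edges_def f_def g_def by (auto simp: image_iff)
  have succ: "Suc i mod n \<noteq> i" "Suc (Suc i mod n) mod n \<noteq> i" if "i < n" "3 \<le> n" for i n :: nat
    using that by (cases "Suc i = n"; cases "Suc (Suc i) = n"; simp)+
  have inj_f: "inj_on f (torus K L)"
    by (rule inj_onI) (use succ[OF _ assms(1)] in \<open>auto simp: f_def torus_def doubleton_eq_iff\<close>)
  have inj_g: "inj_on g (torus K L)"
    by (rule inj_onI) (use succ[OF _ assms(2)] in \<open>auto simp: g_def torus_def doubleton_eq_iff\<close>)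
  have disj: "f ` torus K L \<inter> g ` torus K L = {}"
  proof -
    have "f v \<noteq> g u" if v: "v \<in> torus K L" for u v
      using v succ(1)[OF _ assms(1), of "fst v"]
      by (cases u; cases v) (auto simp: f_def g_def torus_def doubleton_eq_iff)
    then show ?thesis by blast
  qed
  have count: "(\<Sum>i<n. if (i \<in> S) = (Suc i mod n \<in> S) then 1 else 0) = real n - real (changes n S)"
    for n and S :: "nat set"
  proof -
    have "(\<Sum>i<n. if (i \<in> S) = (Suc i mod n \<in> S) then 1 else (0::real))
        = (\<Sum>i<n. 1 - (if (i \<in> S) \<noteq> (Suc i mod n \<in> S) then 1 else 0))"
      by (intro sum.cong) auto
    also have "\<dots> = real n - (\<Sum>i<n. if (i \<in> S) \<noteq> (Suc i mod n \<in> S) then 1 else 0)"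
      by (simp add: sum_subtractf)
    also have "(\<Sum>i<n. if (i \<in> S) \<noteq> (Suc i mod n \<in> S) then 1 else (0::real)) = real (changes n S)"
      by (simp add: sum.If_cases changes_def Collect_conj_eq lessThan_def)
    finally show ?thesis .
  qed
  have "(\<Sum>e\<in>torus_edges K L. w e) = (\<Sum>v\<in>torus K L. w (f v)) + (\<Sum>v\<in>torus K L. w (g v))"
    unfolding edges by (simp add: sum.union_disjoint disj sum.reindex inj_f inj_g)
  also have "(\<Sum>v\<in>torus K L. w (f v)) = (\<Sum>j<L. \<Sum>i<K. w (f (i, j)))"
    by (simp add: torus_def sum.cartesian_product' lessThan_atLeast0 sum.swap[of _ "{0..<L}"])
  also have "\<dots> = (\<Sum>j<L. \<Sum>i<K. if (i \<in> col A j) = (Suc i mod K \<in> col A j) then 1 else 0)"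
    using assms(1) by (intro sum.cong refl) (auto simp: w_def f_def cfg_eq_iff torus_def)
  also have "\<dots> = (\<Sum>j<L. real K - real (changes K (col A j)))" by (simp only: count)
  also have "(\<Sum>v\<in>torus K L. w (g v)) = (\<Sum>i<K. \<Sum>j<L. w (g (i, j)))"
    by (simp add: torus_def sum.cartesian_product' lessThan_atLeast0)
  also have "\<dots> = (\<Sum>i<K. \<Sum>j<L. if (j \<in> row A i) = (Suc j mod L \<in> row A i) then 1 else 0)"
    using assms(2) by (intro sum.cong refl) (auto simp: w_def g_def cfg_eq_iff torus_def)
  also have "\<dots> = (\<Sum>i<K. real L - real (changes L (row A i)))" by (simp only: count)
  finally have "(\<Sum>e\<in>torus_edges K L. w e) = 2 * real (K * L) - real (bd K L A)"
    by (simp add: sum_subtractf bd_def algebra_simps)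
  then show ?thesis by (simp add: energy_def w_def)
qed

section \<open>Column-by-column fillings\<close>

locale ising_torus =
  fixes K L :: nat
  assumes KL: "K < L" and K3: "3 \<le> K"
begin

abbreviation "V \<equiv> torus K L"

text \<open>The sets of height at most, and strictly below, the barrier.\<close>

definition "Lev = {A. A \<subseteq> V \<and> bd K L A \<le> 2 * K + 2}"
definition "Non = {A. A \<subseteq> V \<and> bd K L A < 2 * K + 2}"

definition "full_col A j \<longleftrightarrow> (\<forall>i<K. (i, j) \<in> A)"
definition "empty_col A j \<longleftrightarrow> (\<forall>i<K. (i, j) \<notin> A)"
definition "has_full A \<longleftrightarrow> (\<exists>j<L. full_col A j)"
definition "has_empty A \<longleftrightarrow> (\<exists>j<L. empty_col A j)"

lemma Kpos: "0 < K" and Lpos: "0 < L" and L4: "4 \<le> L"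
  using KL K3 by auto

lemma mem_V: "(i, j) \<in> V \<longleftrightarrow> i < K \<and> j < L"
  by (simp add: torus_def)

lemma mem_mixed_cols: "j \<in> mixed_cols K L A \<longleftrightarrow> j < L \<and> \<not> full_col A j \<and> \<not> empty_col A j"
  by (auto simp: mixed_cols_def mixed_iff full_col_def empty_col_def)

lemma mem_mixed_rows: "i \<in> mixed_rows K L A \<longleftrightarrow> i < K \<and> (\<exists>j<L. (i, j) \<in> A) \<and> (\<exists>j<L. (i, j) \<notin> A)"
  by (auto simp: mixed_rows_def mixed_iff)

text \<open>A sweep passes the columns one after another to the right or to the left. Both directions occur,
  as a bar may lie on either side of its band. Adding \<open>L - q\<close> moves \<open>q\<close> columns to the left
  without a negative number.\<close>

definition sweep :: "(nat \<Rightarrow> nat) \<Rightarrow> bool" where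
  "sweep c \<longleftrightarrow> (\<exists>j<L. c = (\<lambda>q. (j + q) mod L) \<or> c = (\<lambda>q. (j + (L - q)) mod L))"

text \<open>The first \<open>n\<close> sites when the columns of a sweep are filled one by one, each from row \<open>i0\<close> on.
  For growing \<open>n\<close> this is the reference path from the empty to the full set.\<close>

definition fill :: "(nat \<Rightarrow> nat) \<Rightarrow> nat \<Rightarrow> nat \<Rightarrow> vertex set" where
  "fill c i0 n = (\<lambda>m. ((i0 + m) mod K, c (m div K))) ` {..<n}"

lemma sweep_less: "sweep c \<Longrightarrow> c q < L"
  using Lpos by (auto simp: sweep_def)

lemma sweep_inj:
  assumes "sweep c" "p < L" "q < L" "c p = c q"
  shows "p = q"
proof -
  obtain j where "c = (\<lambda>q. (j + q) mod L) \<or> c = (\<lambda>q. (j + (L - q)) mod L)"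
    using assms(1) unfolding sweep_def by blast
  then show ?thesis
  proof
    assume "c = (\<lambda>q. (j + q) mod L)"
    then show ?thesis using offset_inj[of j p L q] assms by simp
  next
    assume c: "c = (\<lambda>q. (j + (L - q)) mod L)"
    have "(Suc j + (L - Suc p)) mod L = (Suc j + (L - Suc q)) mod L"
      using assms(2-4) unfolding c by (simp add: Suc_diff_Suc)
    from offset_inj[OF this] have "L - Suc p = L - Suc q" using Lpos by simp
    then show ?thesis using assms(2,3) by simp
  qed
qed

lemma sweep_eq_iff: "sweep c \<Longrightarrow> p < L \<Longrightarrow> q < L \<Longrightarrow> c p = c q \<longleftrightarrow> p = q"
  using sweep_inj by blast

lemma sweep_surj:
  assumes "sweep c" "j < L"
  shows "\<exists>q<L. j = c q"
proof -
  have "inj_on c {..<L}" using sweep_inj[OF assms(1)] by (auto intro: inj_onI)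
  then have "c ` {..<L} = {..<L}"
    using sweep_less[OF assms(1)] by (intro card_subset_eq) (auto simp: card_image)
  then show ?thesis using assms(2) by blast
qed

lemma left_sweep_prefix:
  assumes "q \<le> L"
  shows "(\<lambda>q. (j + (L - q)) mod L) ` {..<q} = arc L (Suc j + (L - q)) q" (is "?c ` _ = _")
proof (intro equalityI subsetI)
  fix y assume "y \<in> ?c ` {..<q}"
  then obtain x where x: "x < q" "y = (j + (L - x)) mod L" by auto
  have "j + (L - x) = Suc j + (L - q) + (q - Suc x)" using x assms by simp
  then have "y = (Suc j + (L - q) + (q - Suc x)) mod L" unfolding x(2) by (simp only:)
  then show "y \<in> arc L (Suc j + (L - q)) q"
    unfolding arc_def using x(1) by (intro image_eqI[of _ _ "q - Suc x"]) auto
next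
  fix y assume "y \<in> arc L (Suc j + (L - q)) q"
  then obtain x where x: "x < q" "y = (Suc j + (L - q) + x) mod L" by (auto simp: arc_def)
  have "Suc j + (L - q) + x = j + (L - (q - Suc x))" using x assms by simp
  then have "y = ?c (q - Suc x)" unfolding x(2) by (simp only:)
  then show "y \<in> ?c ` {..<q}" using x(1) by (intro image_eqI[of _ _ "q - Suc x"]) auto
qed

lemma right_sweep_prefix: "(\<lambda>q. (j + q) mod L) ` {..<q} = arc L j q"
  by (simp add: arc_def)

lemma sweep_prefix:
  assumes "sweep c" "q \<le> L"
  shows "\<exists>a. c ` {..<q} = arc L a q"
proof -
  obtain j where "c = (\<lambda>q. (j + q) mod L) \<or> c = (\<lambda>q. (j + (L - q)) mod L)"
    using assms(1) unfolding sweep_def by blast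
  then show ?thesis
    using left_sweep_prefix[OF assms(2), of j] right_sweep_prefix[of j q] by blast
qed

lemma digits_less_iff:
  assumes "x < k" "r < k"
  shows "q * k + x < d * k + r \<longleftrightarrow> q < d \<or> (q = d \<and> x < (r::nat))"
proof -
  have "q * k + x < d * k + r" if "q < d"
  proof -
    have "Suc q * k \<le> d * k" using that by (intro mult_le_mono1) simp
    then show ?thesis using assms by simp
  qed
  moreover have "\<not> q * k + x < d * k + r" if "d < q"
  proof -
    have "Suc d * k \<le> q * k" using that by (intro mult_le_mono1) simp
    then show ?thesis using assms by simp
  qed
  ultimately show ?thesis by (metis linorder_neqE_nat nat_add_left_cancel_less)
qed

lemma mem_fill:
  assumes "sweep c" "n \<le> K * L" "x < K" "q < L"
  shows "((i0 + x) mod K, c q) \<in> fill c i0 n \<longleftrightarrow> q * K + x < n"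
proof
  assume "((i0 + x) mod K, c q) \<in> fill c i0 n"
  then obtain m where m: "m < n" "(i0 + x) mod K = (i0 + m) mod K" "c q = c (m div K)"
    by (auto simp: fill_def)
  have "m div K < L" using m(1) assms(2) by (simp add: less_mult_imp_div_less mult.commute)
  then have "q = m div K" using sweep_inj[OF assms(1,4) _ m(3)] by simp
  moreover have "x = m mod K"
    by (rule offset_inj[of i0 x K]) (use m(2) assms(3) Kpos in \<open>simp_all add: mod_simps\<close>)
  ultimately show "q * K + x < n" using m(1) by simp
next
  assume "q * K + x < n"
  then show "((i0 + x) mod K, c q) \<in> fill c i0 n"
    unfolding fill_def using assms(3)
    by (intro image_eqI[of _ _ "q * K + x"])
       (simp_all add: add.left_commute[of i0] mod_add_left_eq)
qed

lemma mem_fill_digits: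
  assumes "sweep c" "n \<le> K * L" "x < K" "q < L"
  shows "((i0 + x) mod K, c q) \<in> fill c i0 n \<longleftrightarrow>
    q < n div K \<or> (q = n div K \<and> x < n mod K)"
  using mem_fill[OF assms, of i0] digits_less_iff[OF assms(3), of "n mod K" q "n div K"] Kpos
  by simp

lemma fill_subset: "sweep c \<Longrightarrow> fill c i0 n \<subseteq> V"
  using Kpos sweep_less by (auto simp: fill_def mem_V)

lemma finite_fill [simp]: "finite (fill c i0 n)" by (simp add: fill_def)

lemma fill_0 [simp]: "fill c i0 0 = {}" by (simp add: fill_def)

lemma fill_Suc: "fill c i0 (Suc n) = insert ((i0 + n) mod K, c (n div K)) (fill c i0 n)"
  by (simp add: fill_def lessThan_Suc)

lemma card_fill:
  assumes "sweep c" "n \<le> K * L"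
  shows "card (fill c i0 n) = n"
proof -
  have "inj_on (\<lambda>m. ((i0 + m) mod K, c (m div K))) {..<n}"
  proof (rule inj_onI)
    fix m m' assume mm: "m \<in> {..<n}" "m' \<in> {..<n}"
      "((i0 + m) mod K, c (m div K)) = ((i0 + m') mod K, c (m' div K))"
    have "m div K < L" "m' div K < L"
      using mm assms(2) by (auto simp: less_mult_imp_div_less mult.commute)
    then have "m div K = m' div K" using sweep_inj[OF assms(1)] mm(3) by blast
    moreover have "m mod K = m' mod K"
      by (rule offset_inj[of i0 _ K]) (use mm(3) Kpos in \<open>simp_all add: mod_simps\<close>)
    ultimately show "m = m'" by (metis div_mult_mod_eq)
  qed
  then show ?thesis unfolding fill_def by (simp add: card_image)
qed

lemma fill_all: "sweep c \<Longrightarrow> fill c i0 (K * L) = V"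
  by (rule card_subset_eq) (auto simp: card_fill card_torus fill_subset[THEN subsetD])

lemma full_col_fill:
  assumes "sweep c" "n \<le> K * L" "q < L"
  shows "full_col (fill c i0 n) (c q) \<longleftrightarrow> q < n div K"
proof
  assume "full_col (fill c i0 n) (c q)"
  then have "((i0 + (K - 1)) mod K, c q) \<in> fill c i0 n" using Kpos by (simp add: full_col_def)
  then show "q < n div K"
    using mem_fill_digits[OF assms(1,2) _ assms(3), of "K - 1" i0] Kpos mod_less_divisor[OF Kpos, of n]
    by auto
next
  assume "q < n div K"
  show "full_col (fill c i0 n) (c q)" unfolding full_col_def
  proof (intro allI impI)
    fix i assume "i < K"
    then obtain x where "x < K" "i = (i0 + x) mod K" using offset_exists by blast
    then show "(i, c q) \<in> fill c i0 n"
      using mem_fill_digits[OF assms(1,2) _ assms(3)] \<open>q < n div K\<close> by simp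
  qed
qed

lemma empty_col_fill:
  assumes "sweep c" "n \<le> K * L" "q < L" "n \<le> q * K"
  shows "empty_col (fill c i0 n) (c q)"
  unfolding empty_col_def
proof (intro allI impI)
  fix i assume "i < K"
  then obtain x where "x < K" "i = (i0 + x) mod K" using offset_exists by blast
  then show "(i, c q) \<notin> fill c i0 n" using mem_fill[OF assms(1,2) _ assms(3)] assms(4) by simp
qed

lemma has_full_fill: "sweep c \<Longrightarrow> n \<le> K * L \<Longrightarrow> K \<le> n \<Longrightarrow> has_full (fill c i0 n)"
  unfolding has_full_def using full_col_fill[of c n 0 i0] sweep_less[of c 0] Lpos Kpos
  by (auto simp: div_greater_zero_iff)

lemma row_fill:
  assumes "sweep c" "n \<le> K * L" "x < K"
  defines "q' \<equiv> n div K + (if x < n mod K then 1 else 0)"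
  shows "row (fill c i0 n) ((i0 + x) mod K) = c ` {..<q'}" and "q' \<le> L"
proof -
  have n: "n = n div K * K + n mod K" by simp
  show q': "q' \<le> L"
  proof (cases "x < n mod K")
    case True
    have "n div K < L"
    proof (rule ccontr)
      assume "\<not> n div K < L"
      then have "L * K \<le> n div K * K" by (intro mult_le_mono1) simp
      then have "K * L + n mod K \<le> n" using n by (metis add_le_mono1 mult.commute)
      then show False using True assms(2) by simp
    qed
    then show ?thesis using True by (simp add: q'_def)
  next
    case False
    have "n div K \<le> K * L div K" using assms(2) by (rule div_le_mono)
    then show ?thesis using False Kpos by (simp add: q'_def)
  qed
  have "((i0 + x) mod K, j) \<in> fill c i0 n \<longleftrightarrow> j \<in> c ` {..<q'}" for j
  proof (cases "j < L")
    case True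
    then obtain q where q: "q < L" "j = c q" using sweep_surj[OF assms(1)] by blast
    have "j \<in> c ` {..<q'} \<longleftrightarrow> q < q'"
    proof
      assume "j \<in> c ` {..<q'}"
      then obtain p where p: "p < q'" "j = c p" by blast
      then have "q = p" using sweep_inj[OF assms(1) q(1), of p] q' q(2) by simp
      then show "q < q'" using p(1) by simp
    qed (simp add: q(2))
    also have "\<dots> \<longleftrightarrow> q < n div K \<or> (q = n div K \<and> x < n mod K)" by (auto simp: q'_def)
    also have "\<dots> \<longleftrightarrow> ((i0 + x) mod K, j) \<in> fill c i0 n"
      unfolding q(2) using mem_fill_digits[OF assms(1,2,3) q(1)] by simp
    finally show ?thesis by simp
  next
    case False
    then show ?thesis
      using sweep_less[OF assms(1)] subsetD[OF fill_subset[OF assms(1)], of "((i0 + x) mod K, j)"]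
      by (auto simp: mem_V)
  qed
  then show "row (fill c i0 n) ((i0 + x) mod K) = c ` {..<q'}" by auto
qed

lemma changes_row_fill:
  assumes "sweep c" "n \<le> K * L" "i < K"
  shows "changes L (row (fill c i0 n) i) \<le> 2"
proof -
  obtain x where x: "x < K" "i = (i0 + x) mod K" using offset_exists assms(3) by blast
  obtain a where "row (fill c i0 n) i = arc L a (n div K + (if x < n mod K then 1 else 0))"
    using row_fill(1)[OF assms(1,2) x(1), of i0] sweep_prefix[OF assms(1) row_fill(2)[OF assms(1,2) x(1)]]
    unfolding x(2) by auto
  then show ?thesis using changes_arc_le row_fill(2)[OF assms(1,2) x(1)] Lpos by simp
qed

lemma changes_col_fill:
  assumes "sweep c" "n \<le> K * L" "j < L"
  shows "changes K (col (fill c i0 n) j) \<le> (if j = c (n div K) \<and> n mod K \<noteq> 0 then 2 else 0)"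
proof -
  obtain q where q: "q < L" "j = c q" using sweep_surj[OF assms(1,3)] by blast
  have col: "(i0 + x) mod K \<in> col (fill c i0 n) j \<longleftrightarrow> q < n div K \<or> (q = n div K \<and> x < n mod K)"
    if "x < K" for x
    using mem_fill_digits[OF assms(1,2) that q(1)] q by simp
  show ?thesis
  proof (cases "q = n div K")
    case True
    have "col (fill c i0 n) j \<inter> {..<K} = arc K i0 (n mod K) \<inter> {..<K}"
    proof (intro set_eqI)
      fix i show "i \<in> col (fill c i0 n) j \<inter> {..<K} \<longleftrightarrow> i \<in> arc K i0 (n mod K) \<inter> {..<K}"
      proof (cases "i < K")
        case True
        then obtain x where x: "x < K" "i = (i0 + x) mod K" using offset_exists by blast
        have "i \<in> col (fill c i0 n) j \<longleftrightarrow> x < n mod K"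
          unfolding x(2) using col[OF x(1)] \<open>q = n div K\<close> by simp
        also have "\<dots> \<longleftrightarrow> i \<in> arc K i0 (n mod K)"
          unfolding x(2) using mem_arc_iff[OF x(1), of "n mod K" i0] Kpos by simp
        finally show ?thesis by simp
      qed simp
    qed
    then have "changes K (col (fill c i0 n) j) = changes K (arc K i0 (n mod K))"
      by (rule changes_cong)
    moreover have "changes K (arc K i0 (n mod K)) \<le> 2" by (rule changes_arc_le) (use Kpos in auto)
    moreover have "changes K (arc K i0 0) = 0" by (rule changes_trivial) simp
    ultimately show ?thesis using True q by auto
  next
    case False
    have "col (fill c i0 n) j \<inter> {..<K} = {} \<or> {..<K} \<subseteq> col (fill c i0 n) j"
    proof (cases "q < n div K")
      case True
      then show ?thesis using full_col_fill[OF assms(1,2) q(1), of i0] q(2)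
        by (intro disjI2 subsetI) (simp add: full_col_def)
    next
      case f: False
      have "i \<notin> col (fill c i0 n) j" if "i < K" for i
      proof -
        obtain x where "x < K" "i = (i0 + x) mod K" using offset_exists \<open>i < K\<close> by blast
        then show ?thesis using col f False by blast
      qed
      then show ?thesis by blast
    qed
    then show ?thesis by (simp add: changes_trivial)
  qed
qed

text \<open>At most one column of a filling is mixed, and every row is an arc.\<close>

lemma bd_fill:
  assumes "sweep c" "n \<le> K * L"
  shows "bd K L (fill c i0 n) \<le> 2 * K + 2"
proof -
  have "bd K L (fill c i0 n) \<le> 2 * card {..<K} + 2 * card {c (n div K)}"
    by (rule bd_le) (use changes_row_fill[OF assms] order_trans[OF changes_col_fill[OF assms]] in auto)
  then show ?thesis by simp
qed

lemma bd_fill_band: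
  assumes "sweep c" "n \<le> K * L" "n mod K = 0"
  shows "bd K L (fill c i0 n) \<le> 2 * K"
proof -
  have "bd K L (fill c i0 n) \<le> 2 * card {..<K} + 2 * card ({}::nat set)"
    by (rule bd_le) (use changes_row_fill[OF assms(1,2)] changes_col_fill[OF assms(1,2), of _ i0] assms(3)
        in auto)
  then show ?thesis by simp
qed

text \<open>Within the first column, \<open>n < K\<close> rows are mixed instead of all \<open>K\<close>.\<close>

lemma bd_fill_column:
  assumes "sweep c" "n \<le> K"
  shows "bd K L (fill c i0 n) \<le> 2 * K"
proof (cases "n = K")
  case True
  then show ?thesis using bd_fill_band[OF assms(1), of n] Lpos by simp
next
  case False
  have n: "n \<le> K * L" using assms(2) Lpos by (metis Suc_leI le_trans mult.right_neutral mult_le_mono2 One_nat_def)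
  have "changes L (row (fill c i0 n) i) \<le> (if i \<in> arc K i0 n then 2 else 0)" if i: "i < K" for i
  proof (cases "i \<in> arc K i0 n")
    case True
    then show ?thesis using changes_row_fill[OF assms(1) n i] by simp
  next
    case f: False
    have "row (fill c i0 n) i = {}"
      using f by (auto simp: fill_def arc_def)
    then show ?thesis by (simp add: changes_trivial)
  qed
  moreover have "changes K (col (fill c i0 n) j) \<le> (if j \<in> {c 0} then 2 else 0)" if "j < L" for j
    using changes_col_fill[OF assms(1) n that, of i0] False assms(2) by (auto split: if_splits)
  ultimately have "bd K L (fill c i0 n) \<le> 2 * card (arc K i0 n) + 2 * card {c 0}"
    by (intro bd_le) (auto simp: arc_def)
  then show ?thesis using card_arc[of n K i0] assms(2) False by simp
qed


section \<open>Configurations with a full and an empty column\<close>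

definition "Rset a b = {rect K L i j a b | i j. (i, j) \<in> V}"

definition "Bset h a b = {rect K L i j a b \<union> rect K L i' j' 1 h | i j i' j'.
  (i, j) \<in> V \<and> (i', j') \<in> V \<and> (j' = (j + a) mod L \<or> (j' + 1) mod L = j) \<and>
  fst ` rect K L i' j' 1 h \<subseteq> fst ` rect K L i j a b}"

lemma rect_eq: "rect K L i j a b = arc K i b \<times> arc L j a"
  by (auto simp: rect_def arc_def)

lemma fill_band:
  assumes "sweep c" "a < L" "h < K"
  shows "fill c i0 (a * K + h) = {..<K} \<times> c ` {..<a} \<union> arc K i0 h \<times> {c a}"
proof -
  have n: "a * K + h \<le> K * L"
  proof -
    have "Suc a * K \<le> L * K" using assms(2) by (intro mult_le_mono1) simp
    then show ?thesis using assms(3) by (simp add: mult.commute)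
  qed
  have "(i, j) \<in> fill c i0 (a * K + h) \<longleftrightarrow> (i, j) \<in> {..<K} \<times> c ` {..<a} \<union> arc K i0 h \<times> {c a}"
    for i j
  proof (cases "i < K \<and> j < L")
    case True
    obtain x where x: "x < K" "i = (i0 + x) mod K" using offset_exists True by blast
    obtain q where q: "q < L" "j = c q" using sweep_surj[OF assms(1)] True by blast
    have "(i, j) \<in> fill c i0 (a * K + h) \<longleftrightarrow> q < a \<or> (q = a \<and> x < h)"
      unfolding x(2) q(2) using mem_fill_digits[OF assms(1) n x(1) q(1), of i0] assms(3) Kpos by simp
    moreover have "j \<in> c ` {..<a} \<longleftrightarrow> q < a"
    proof
      assume "j \<in> c ` {..<a}"
      then obtain p where p: "p < a" "j = c p" by blast
      then have "q = p" using sweep_inj[OF assms(1) q(1), of p] q(2) assms(2) by simp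
      then show "q < a" using p(1) by simp
    qed (simp add: q(2))
    moreover have "j = c a \<longleftrightarrow> q = a" unfolding q(2) using sweep_eq_iff[OF assms(1) q(1) assms(2)] .
    moreover have "i \<in> arc K i0 h \<longleftrightarrow> x < h" unfolding x(2) using mem_arc_iff x(1) assms(3) by simp
    ultimately show ?thesis using True by blast
  next
    case False
    have "(i, j) \<notin> fill c i0 (a * K + h)"
      using False fill_subset[OF assms(1), of i0 "a * K + h"] mem_V by blast
    moreover have "(i, j) \<notin> {..<K} \<times> c ` {..<a} \<union> arc K i0 h \<times> {c a}"
      using False sweep_less[OF assms(1)] arc_subset[OF Kpos, of i0 h] by blast
    ultimately show ?thesis by blast
  qed
  then show ?thesis by (intro set_eqI) (metis surj_pair)
qed

lemma Bset_K_iff: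
  assumes "1 \<le> a"
  shows "A \<in> Bset h a K \<longleftrightarrow> (\<exists>j i' j'. j < L \<and> i' < K \<and> j' < L \<and>
    (j' = (j + a) mod L \<or> (j' + 1) mod L = j) \<and>
    A = {..<K} \<times> arc L j a \<union> arc K i' h \<times> {j'})" (is "_ \<longleftrightarrow> ?R")
proof
  assume "A \<in> Bset h a K"
  then obtain i j i' j' where *: "(i, j) \<in> V" "(i', j') \<in> V"
    "j' = (j + a) mod L \<or> (j' + 1) mod L = j" "A = rect K L i j a K \<union> rect K L i' j' 1 h"
    unfolding Bset_def by blast
  have "A = {..<K} \<times> arc L j a \<union> arc K i' h \<times> {j'}"
    using * by (simp add: rect_eq arc_full Kpos arc_1 mem_V)
  then show ?R using * unfolding mem_V by blast
next
  assume ?R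
  then obtain j i' j' where *: "j < L" "i' < K" "j' < L" "j' = (j + a) mod L \<or> (j' + 1) mod L = j"
    "A = {..<K} \<times> arc L j a \<union> arc K i' h \<times> {j'}" by blast
  have e: "A = rect K L 0 j a K \<union> rect K L i' j' 1 h"
    using * by (simp add: rect_eq arc_full Kpos arc_1)
  have "fst ` rect K L i' j' 1 h \<subseteq> fst ` rect K L 0 j a K"
  proof -
    have "j mod L \<in> arc L j a" using assms(1) by (auto simp: arc_def intro!: image_eqI[of _ _ 0])
    then have "fst ` rect K L 0 j a K = {..<K}"
      unfolding rect_eq arc_full[OF Kpos] by (simp add: fst_image_times) blast
    moreover have "fst ` rect K L i' j' 1 h \<subseteq> {..<K}"
      unfolding rect_eq using arc_subset[OF Kpos, of i' h] by (auto simp: fst_image_times)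
    ultimately show ?thesis by simp
  qed
  moreover have "(0, j) \<in> V" "(i', j') \<in> V" using *(1-3) Kpos by (simp_all add: mem_V)
  ultimately show "A \<in> Bset h a K" unfolding Bset_def e using *(4) by blast
qed

text \<open>For a bar on the right of the band the sweep goes to the right, otherwise to the left.\<close>

lemma Bset_fill_iff:
  assumes "1 \<le> a" "a < L" "h < K"
  shows "A \<in> Bset h a K \<longleftrightarrow> (\<exists>c i0. sweep c \<and> A = fill c i0 (a * K + h))"
proof
  assume "A \<in> Bset h a K"
  then obtain j i' j' where *: "j < L" "i' < K" "j' < L" "j' = (j + a) mod L \<or> (j' + 1) mod L = j"
    "A = {..<K} \<times> arc L j a \<union> arc K i' h \<times> {j'}" unfolding Bset_K_iff[OF assms(1)] by blast
  from *(4) show "\<exists>c i0. sweep c \<and> A = fill c i0 (a * K + h)"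
  proof
    assume j': "j' = (j + a) mod L"
    let ?c = "\<lambda>q. (j + q) mod L"
    have c: "sweep ?c" using *(1) unfolding sweep_def by blast
    have "A = fill ?c i' (a * K + h)"
      unfolding fill_band[OF c assms(2,3)] right_sweep_prefix *(5) j' ..
    then show ?thesis using c by blast
  next
    assume j: "(j' + 1) mod L = j"
    define j0 where "j0 = (j' + a) mod L"
    let ?c = "\<lambda>q. (j0 + (L - q)) mod L"
    have c: "sweep ?c" using Lpos unfolding sweep_def j0_def by (metis mod_less_divisor)
    have "?c a = (j' + a + (L - a)) mod L" unfolding j0_def by (simp add: mod_add_left_eq)
    then have ca: "?c a = j'" using assms(2) *(3) by simp
    have "(Suc j0 + (L - a)) mod L = (Suc (j' + a) + (L - a)) mod L"
      unfolding j0_def by (metis mod_Suc_eq mod_add_left_eq)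
    also have "Suc (j' + a) + (L - a) = j' + 1 + L" using assms(2) by simp
    also have "(j' + 1 + L) mod L = j" unfolding mod_add_self2 by (rule j)
    finally have "(Suc j0 + (L - a)) mod L = j" .
    then have "arc L (Suc j0 + (L - a)) a = arc L j a" by (metis arc_mod)
    then have "?c ` {..<a} = arc L j a" using left_sweep_prefix[of a j0] assms(2) by simp
    then have "A = fill ?c i' (a * K + h)"
      unfolding fill_band[OF c assms(2,3)] *(5) using ca by simp
    then show ?thesis using c by blast
  qed
next
  assume "\<exists>c i0. sweep c \<and> A = fill c i0 (a * K + h)"
  then obtain c i0 where c: "sweep c" and A: "A = fill c i0 (a * K + h)" by blast
  obtain j where j: "j < L" "c = (\<lambda>q. (j + q) mod L) \<or> c = (\<lambda>q. (j + (L - q)) mod L)"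
    using c unfolding sweep_def by blast
  have A': "A = {..<K} \<times> c ` {..<a} \<union> arc K (i0 mod K) h \<times> {c a}"
    unfolding A fill_band[OF c assms(2,3)] arc_mod ..
  from j(2) show "A \<in> Bset h a K"
  proof
    assume c: "c = (\<lambda>q. (j + q) mod L)"
    have "A = {..<K} \<times> arc L j a \<union> arc K (i0 mod K) h \<times> {(j + a) mod L}"
      unfolding A' c right_sweep_prefix ..
    then show ?thesis unfolding Bset_K_iff[OF assms(1)] using j(1) Kpos Lpos
      by (intro exI[of _ j] exI[of _ "i0 mod K"] exI[of _ "(j + a) mod L"]) simp
  next
    assume c: "c = (\<lambda>q. (j + (L - q)) mod L)"
    have "A = {..<K} \<times> arc L (Suc j + (L - a)) a \<union> arc K (i0 mod K) h \<times> {(j + (L - a)) mod L}"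
      unfolding A' c using left_sweep_prefix[of a j] assms(2) by simp
    then have "A = {..<K} \<times> arc L ((Suc j + (L - a)) mod L) a \<union> arc K (i0 mod K) h \<times> {(j + (L - a)) mod L}"
      unfolding arc_mod .
    then show ?thesis unfolding Bset_K_iff[OF assms(1)] using Kpos Lpos
      by (intro exI[of _ "(Suc j + (L - a)) mod L"] exI[of _ "i0 mod K"] exI[of _ "(j + (L - a)) mod L"])
         (simp add: mod_Suc_eq)
  qed
qed

text \<open>A detached point has changes on both of its sides, besides the one at the end of the arc.\<close>

lemma arc_insert_adjacent:
  assumes "1 \<le> a" "a < n" "s < n" "j < n" "j \<notin> arc n s a" "changes n (insert j (arc n s a)) \<le> 2"
  shows "j = (s + a) mod n \<or> (j + 1) mod n = s"
proof (rule ccontr)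
  assume "\<not> ?thesis"
  then have ne: "j \<noteq> (s + a) mod n" "(j + 1) mod n \<noteq> s" by auto
  obtain x where x: "x < n" "j = (s + x) mod n" using offset_exists assms(4) by blast
  define S where "S = insert j (arc n s a)"
  have mem: "(s + y) mod n \<in> S \<longleftrightarrow> y < a \<or> y = x" if "y < n" for y
    unfolding S_def x(2) using mem_arc_iff[OF that, of a s] assms(2) offset_eq_iff[OF that x(1), of s] by auto
  have suc: "Suc ((s + y) mod n) mod n = (s + Suc y) mod n" for y by (simp add: mod_simps)
  have "a \<le> x" using assms(2,5) mem_arc_iff[OF x(1), of a s] x(2) by simp
  moreover have "x \<noteq> a" using ne(1) x(2) by blast
  moreover have "x \<noteq> n - 1"
  proof
    assume "x = n - 1"
    then have "(j + 1) mod n = (s + n) mod n" using x suc[of x] by simp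
    then show False using ne(2) assms(3) by simp
  qed
  ultimately have xa: "a < x" "Suc x < n" using x(1) by auto
  have "{(s + (a - 1)) mod n, (s + (x - 1)) mod n, (s + x) mod n}
      \<subseteq> {i. i < n \<and> (i \<in> S) \<noteq> (Suc i mod n \<in> S)}"
  proof -
    have "(s + (a - 1)) mod n \<in> S" "Suc ((s + (a - 1)) mod n) mod n \<notin> S"
      using mem[of "a - 1"] mem[of a] suc[of "a - 1"] xa assms(1,2) by auto
    moreover have "(s + (x - 1)) mod n \<notin> S" "Suc ((s + (x - 1)) mod n) mod n \<in> S"
      using mem[of "x - 1"] mem[of x] suc[of "x - 1"] xa by auto
    moreover have "(s + x) mod n \<in> S" "Suc ((s + x) mod n) mod n \<notin> S"
      using mem[of x] mem[of "Suc x"] suc[of x] xa by auto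
    ultimately show ?thesis using assms(4) by auto
  qed
  then have "card {(s + (a - 1)) mod n, (s + (x - 1)) mod n, (s + x) mod n} \<le> changes n S"
    unfolding changes_def by (intro card_mono) auto
  moreover have "card {(s + (a - 1)) mod n, (s + (x - 1)) mod n, (s + x) mod n} = 3"
  proof -
    have "(s + (a - 1)) mod n \<noteq> (s + (x - 1)) mod n" "(s + (a - 1)) mod n \<noteq> (s + x) mod n"
      "(s + (x - 1)) mod n \<noteq> (s + x) mod n"
      using xa assms(1,2) offset_eq_iff[of "a - 1" n "x - 1" s] offset_eq_iff[of "a - 1" n x s]
        offset_eq_iff[of "x - 1" n x s] by auto
    then show ?thesis by (metis card_3_iff)
  qed
  ultimately show False using assms(6) by (simp add: S_def)
qed

lemma mixed_rows_all:
  assumes "has_full A" "has_empty A"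
  shows "mixed_rows K L A = {..<K}"
proof -
  have "i \<in> mixed_rows K L A \<longleftrightarrow> i < K" for i
    using assms unfolding has_full_def has_empty_def full_col_def empty_col_def mem_mixed_rows by blast
  then show ?thesis by auto
qed

text \<open>This is the structure of the middle part of every optimal path: as soon as there is a full
  and an empty column, each of the \<open>K\<close> rows costs at least two, so that only one column may be
  mixed, and this column must touch the band.\<close>

lemma full_and_empty_column_fill:
  assumes "A \<in> Lev" "has_full A" "has_empty A"
  obtains c i0 where "sweep c" "A = fill c i0 (card A)" "K \<le> card A" "card A \<le> K * (L - 1)"
proof -
  have A: "A \<subseteq> V" "bd K L A \<le> 2 * K + 2" using assms(1) by (auto simp: Lev_def)
  have mixed_rows: "mixed_rows K L A = {..<K}" using mixed_rows_all assms by blast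
  obtain jp jm where jp: "jp < L" "full_col A jp" and jm: "jm < L" "empty_col A jm"
    using assms unfolding has_full_def has_empty_def by blast
  have "2 * card (mixed_rows K L A) + 2 * card (mixed_cols K L A) \<le> bd K L A" by (rule bd_ge)
  then have MC1: "card (mixed_cols K L A) \<le> 1" using A(2) mixed_rows by simp
  have key: "\<exists>c i0 a h. sweep c \<and> A = fill c i0 (a * K + h) \<and> 1 \<le> a \<and> a * K + h \<le> K * (L - 1)"
  proof (cases "mixed_cols K L A = {}")
    case True
    define P where "P = {j. j < L \<and> full_col A j}"
    have mem: "(i, j) \<in> A \<longleftrightarrow> i < K \<and> j \<in> P" for i j
      using True A(1) mem_mixed_cols[of j A] mem_V[of i j] unfolding P_def full_col_def empty_col_def by blast
    \<comment> \<open>all rows are equal, so a third change in one of them would cost \<open>3 K > 2 K + 2\<close>\<close>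
    have "(\<Sum>i<K. changes L P) \<le> bd K L A"
    proof -
      have "row A i = P" if "i < K" for i using mem that by auto
      then have "(\<Sum>i<K. changes L (row A i)) = (\<Sum>i<K. changes L P)" by (intro sum.cong) auto
      then show ?thesis by (simp add: bd_def)
    qed
    then have "K * changes L P \<le> 2 * K + 2" using A(2) by simp
    have "changes L P \<le> 2"
    proof (rule ccontr)
      assume "\<not> changes L P \<le> 2"
      then have "K * 3 \<le> K * changes L P" by (intro mult_le_mono2) simp
      also note \<open>K * changes L P \<le> 2 * K + 2\<close>
      finally show False using K3 by simp
    qed
    moreover have "mixed L P" unfolding mixed_iff
      using jp jm Kpos by (auto simp: P_def full_col_def empty_col_def)
    ultimately obtain s a where sa: "s < L" "1 \<le> a" "a < L" "P \<inter> {..<L} = arc L s a"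
      using mixed_arc by blast
    let ?c = "\<lambda>q. (s + q) mod L"
    have c: "sweep ?c" using sa(1) unfolding sweep_def by blast
    have "A = {..<K} \<times> arc L s a" unfolding sa(4)[symmetric] using mem by (auto simp: P_def)
    then have "A = fill ?c 0 (a * K + 0)"
      unfolding fill_band[OF c sa(3) Kpos] right_sweep_prefix by simp
    moreover have "a * K \<le> K * (L - 1)" using sa(3) by (subst mult.commute) (intro mult_le_mono2, simp)
    ultimately show ?thesis using c sa(2) by (intro exI[of _ ?c] exI[of _ 0] exI[of _ a] exI[of _ 0]) simp
  next
    case False
    then obtain j0 where j0: "mixed_cols K L A = {j0}"
      using MC1 by (metis card_1_singletonE card_gt_0_iff finite_mixed_cols le_antisym less_eq_Suc_le One_nat_def)
    have j0L: "j0 < L" "\<not> full_col A j0" "\<not> empty_col A j0" using j0 mem_mixed_cols[of j0 A] by auto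
    have rows: "changes L (row A i) \<le> 2" if "i < K" for i
      using row_changes_le[of i K L A] A(2) mixed_rows j0 that by simp
    have cols: "changes K (col A j0) \<le> 2"
      using col_changes_le[of j0 K L A] A(2) mixed_rows j0 by simp
    have "mixed K (col A j0)" using j0 unfolding mixed_cols_def by auto
    then obtain i' h where h: "i' < K" "1 \<le> h" "h < K" "col A j0 \<inter> {..<K} = arc K i' h"
      using mixed_arc[OF cols] by blast
    obtain i1 where i1: "i1 < K" "(i1, j0) \<notin> A" using j0L unfolding full_col_def by blast
    obtain i2 where i2: "i2 < K" "(i2, j0) \<in> A" using j0L unfolding empty_col_def by blast
    have "mixed L (row A i1)" using mixed_rows i1(1) unfolding mixed_rows_def by auto
    then obtain s a where sa: "s < L" "1 \<le> a" "a < L" "row A i1 \<inter> {..<L} = arc L s a"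
      using mixed_arc[OF rows[OF i1(1)]] by blast
    have other: "(i, j) \<in> A \<longleftrightarrow> j \<in> arc L s a" if "i < K" "j < L" "j \<noteq> j0" for i j
    proof -
      have "full_col A j \<or> empty_col A j" using j0 that mem_mixed_cols[of j A] by blast
      then have "(i, j) \<in> A \<longleftrightarrow> (i1, j) \<in> A" using that i1 unfolding full_col_def empty_col_def by blast
      also have "\<dots> \<longleftrightarrow> j \<in> arc L s a" unfolding sa(4)[symmetric] using that by simp
      finally show ?thesis .
    qed
    have j0a: "j0 \<notin> arc L s a" unfolding sa(4)[symmetric] using i1 by simp
    have eq: "A = {..<K} \<times> arc L s a \<union> arc K i' h \<times> {j0}"
    proof -
      have "(i, j) \<in> A \<longleftrightarrow> (i, j) \<in> {..<K} \<times> arc L s a \<union> arc K i' h \<times> {j0}" for i j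
      proof (cases "i < K \<and> j < L")
        case True
        show ?thesis
        proof (cases "j = j0")
          case True
          then show ?thesis using \<open>i < K \<and> j < L\<close> j0a unfolding h(4)[symmetric] by simp
        next
          case False
          then show ?thesis using \<open>i < K \<and> j < L\<close> other by simp
        qed
      next
        case False
        then show ?thesis
          using A(1) mem_V[of i j] arc_subset[OF Kpos, of i' h] arc_subset[OF Lpos, of s a] j0L(1) by blast
      qed
      then show ?thesis by (intro set_eqI) (metis surj_pair)
    qed
    have "row A i2 \<inter> {..<L} = insert j0 (arc L s a) \<inter> {..<L}"
    proof (rule set_eqI)
      fix j show "j \<in> row A i2 \<inter> {..<L} \<longleftrightarrow> j \<in> insert j0 (arc L s a) \<inter> {..<L}"
        using other[OF i2(1), of j] i2(2) by (cases "j = j0") auto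
    qed
    then have "changes L (insert j0 (arc L s a)) \<le> 2"
      using rows[OF i2(1)] changes_cong by metis
    then have adj: "j0 = (s + a) mod L \<or> (j0 + 1) mod L = s"
      using arc_insert_adjacent[OF sa(2,3,1) j0L(1) j0a] by blast
    have "A \<in> Bset h a K" unfolding Bset_K_iff[OF sa(2)] using sa(1) h(1) j0L(1) adj eq by blast
    then obtain c i0 where c: "sweep c" "A = fill c i0 (a * K + h)"
      using Bset_fill_iff[OF sa(2,3) h(3)] by blast
    have "Suc a < L"
    proof -
      have "jm \<notin> arc L s a" "jm \<noteq> j0"
        using jm other[OF i1(1), of jm] i1(1) j0L(3) unfolding empty_col_def by blast+
      then have "card (insert jm (insert j0 (arc L s a))) = Suc (Suc a)"
        using j0a card_arc[of a L s] sa(3) by (simp add: arc_def)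
      moreover have "card (insert jm (insert j0 (arc L s a))) \<le> card {..<L}"
        using arc_subset[OF Lpos, of s a] jm(1) j0L(1) by (intro card_mono) auto
      ultimately show ?thesis by simp
    qed
    then have "Suc a * K \<le> (L - 1) * K" by (intro mult_le_mono1) simp
    then have "a * K + h \<le> K * (L - 1)" using h(3) by (simp add: mult.commute)
    then show ?thesis using c sa(2) by blast
  qed
  then obtain c i0 a h where r: "sweep c" "A = fill c i0 (a * K + h)" "1 \<le> a" "a * K + h \<le> K * (L - 1)"
    by blast
  have "a * K + h \<le> K * L" using r(4) by (rule order_trans) simp
  then have "card A = a * K + h" unfolding r(2) by (rule card_fill[OF r(1)])
  moreover have "K \<le> a * K + h" using mult_le_mono1[OF r(3), of K] by linarith
  ultimately have "A = fill c i0 (card A)" "K \<le> card A" "card A \<le> K * (L - 1)"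
    using r(2,4) by auto
  then show ?thesis using that r(1) by blast
qed

lemma has_empty_fill:
  assumes "sweep c" "n \<le> K * (L - 1)"
  shows "has_empty (fill c i0 n)"
proof -
  have "n \<le> K * L" using assms(2) by (rule order_trans) simp
  then have "empty_col (fill c i0 n) (c (L - 1))"
    using assms Lpos by (intro empty_col_fill) (auto simp: mult.commute)
  then show ?thesis unfolding has_empty_def using sweep_less[OF assms(1)] by blast
qed

lemma bd_fill_eq:
  assumes "sweep c" "K \<le> n" "n \<le> K * (L - 1)" "n mod K \<noteq> 0"
  shows "bd K L (fill c i0 n) = 2 * K + 2"
proof (rule antisym)
  have n: "n \<le> K * L" using assms(3) by (rule order_trans) simp
  then show "bd K L (fill c i0 n) \<le> 2 * K + 2" using bd_fill assms(1) by blast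
  have mixed_rows: "mixed_rows K L (fill c i0 n) = {..<K}"
    using mixed_rows_all has_full_fill[OF assms(1) n assms(2)] has_empty_fill[OF assms(1,3)] by blast
  have "n div K \<le> K * (L - 1) div K" using assms(3) by (rule div_le_mono)
  then have q: "n div K < L" using Kpos Lpos by simp
  have "(i0 mod K, c (n div K)) \<in> fill c i0 n"
    using mem_fill_digits[OF assms(1) n Kpos q, of i0] assms(4) by simp
  moreover have "((i0 + (n mod K)) mod K, c (n div K)) \<notin> fill c i0 n"
    using mem_fill_digits[OF assms(1) n _ q, of "n mod K" i0] Kpos by simp
  ultimately have "c (n div K) \<in> mixed_cols K L (fill c i0 n)"
    using sweep_less[OF assms(1)] Kpos unfolding mem_mixed_cols full_col_def empty_col_def by (metis mod_less_divisor)
  then have "2 * card {..<K} + 2 * card {c (n div K)} \<le> bd K L (fill c i0 n)"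
    by (intro bd_ge_card) (auto simp: mixed_rows)
  then show "2 * K + 2 \<le> bd K L (fill c i0 n)" by simp
qed


lemma Bset_K_memD:
  assumes "A \<in> Bset h a K" "1 \<le> h" "h < K" "1 \<le> a" "a + 2 \<le> L"
  shows "A \<subseteq> V" "bd K L A = 2 * K + 2" "has_full A" "has_empty A" "card A = a * K + h"
    "\<exists>c i0. sweep c \<and> A = fill c i0 (a * K + h)"
proof -
  have aL: "a < L" using assms(5) by simp
  obtain c i0 where c: "sweep c" and A: "A = fill c i0 (a * K + h)"
    using Bset_fill_iff[OF assms(4) aL assms(3)] assms(1) by blast
  have "Suc a * K \<le> (L - 1) * K" using assms(5) by (intro mult_le_mono1) simp
  then have n: "a * K + h \<le> K * (L - 1)" using assms(3) by (simp add: mult.commute)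
  have n': "a * K + h \<le> K * L" using n by (rule order_trans) simp
  have n'': "K \<le> a * K + h" using assms(4) by (simp add: trans_le_add1)
  have md: "(a * K + h) mod K \<noteq> 0" using assms(2,3) by simp
  show "A \<subseteq> V" unfolding A by (rule fill_subset[OF c])
  show "bd K L A = 2 * K + 2" unfolding A by (rule bd_fill_eq[OF c n'' n md])
  show "has_full A" unfolding A by (rule has_full_fill[OF c n' n''])
  show "has_empty A" unfolding A by (rule has_empty_fill[OF c n])
  show "card A = a * K + h" unfolding A by (rule card_fill[OF c n'])
  show "\<exists>c i0. sweep c \<and> A = fill c i0 (a * K + h)" using c A by blast
qed

text \<open>Division with remainder by \<open>K\<close> recovers the shape of a band with a bar from its size.\<close>

lemma Bset_K_memI:
  assumes "A \<in> Lev" "has_full A" "has_empty A" "card A = a * K + h" "h < K"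
  shows "A \<in> Bset h a K"
proof -
  obtain c i0 where c: "sweep c" "A = fill c i0 (card A)" "K \<le> card A" "card A \<le> K * (L - 1)"
    using full_and_empty_column_fill assms(1-3) by blast
  have a1: "1 \<le> a" using c(3) assms(4,5) by (cases a) auto
  have "a = card A div K" using assms(4,5) by simp
  also have "\<dots> \<le> K * (L - 1) div K" using c(4) by (rule div_le_mono)
  finally have "a < L" using Kpos Lpos by simp
  then show ?thesis using Bset_fill_iff[OF a1 _ assms(5)] c(1,2) unfolding assms(4) by blast
qed

section \<open>Configurations in two neighbouring columns\<close>

definition "adj j j' \<longleftrightarrow> j' = (j + 1) mod L \<or> (j' + 1) mod L = (j::nat)"

lemma adj_neq: "adj j j' \<Longrightarrow> j < L \<Longrightarrow> j' < L \<Longrightarrow> j \<noteq> j'"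
  unfolding adj_def using L4 by (cases "Suc j = L"; cases "Suc j' = L") auto

lemma arc_2: "j < L \<Longrightarrow> arc L j 2 = {j, (j + 1) mod L}"
  unfolding numeral_2_eq_2 arc_Suc by auto

lemma adj_arc:
  assumes "adj j j'" "j < L" "j' < L"
  shows "\<exists>k<L. {j, j'} = arc L k 2"
  using assms arc_2[of j] arc_2[of j'] unfolding adj_def by blast

lemma arc_but_one: "arc K i (K - 1) = {..<K} - {(i + (K - 1)) mod K}"
proof -
  have "arc K i K = insert ((i + (K - 1)) mod K) (arc K i (K - 1))"
    using arc_Suc[of K i "K - 1"] Kpos by simp
  moreover have "(i + (K - 1)) mod K \<notin> arc K i (K - 1)" using mem_arc_iff[of "K - 1" K "K - 1" i] Kpos by simp
  ultimately show ?thesis using arc_full[OF Kpos, of i] by (metis Diff_insert_absorb)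
qed

lemma all_but_one_arc: "r < K \<Longrightarrow> {..<K} - {r} = arc K (Suc r) (K - 1)"
  using arc_compl[of K 1 r] Kpos K3 by (simp add: arc_1)

definition "twocol I j J j' = I \<times> {j} \<union> J \<times> {j' :: nat}"

lemma mem_twocol: "(p, q) \<in> twocol I j J j' \<longleftrightarrow> (q = j \<and> p \<in> I) \<or> (q = j' \<and> p \<in> J)"
  by (auto simp: twocol_def)

lemma bd_twocol:
  assumes "adj j j'" "j < L" "j' < L" "l \<le> K" "m \<le> K" "arc K i' m \<subseteq> arc K i l"
  shows "bd K L (twocol (arc K i l) j (arc K i' m) j') \<le> 2 * l + 4"
    and "twocol (arc K i l) j (arc K i' m) j' \<subseteq> V"
proof -
  let ?A = "twocol (arc K i l) j (arc K i' m) j'"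
  have jj: "j \<noteq> j'" using adj_neq assms by blast
  obtain k where k: "k < L" "{j, j'} = arc L k 2" using adj_arc assms by blast
  have rows: "changes L (row ?A p) \<le> (if p \<in> arc K i l then 2 else 0)" for p
  proof -
    have "row ?A p = (if p \<in> arc K i' m then {j, j'} else if p \<in> arc K i l then {j} else {})"
      using assms(6) by (auto simp: mem_twocol)
    moreover have "changes L {j, j'} \<le> 2" unfolding k(2) by (rule changes_arc_le) (use L4 in auto)
    moreover have "changes L {j} \<le> 2"
      using changes_arc_le[of 1 L j] L4 assms(2) by (simp add: arc_1)
    moreover have "changes L {} = 0" by (rule changes_trivial) simp
    ultimately show ?thesis using assms(6) by auto
  qed
  have cols: "changes K (col ?A q) \<le> (if q \<in> {j, j'} then 2 else 0)" for q
  proof -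
    have "col ?A q = (if q = j then arc K i l else if q = j' then arc K i' m else {})"
      using jj by (auto simp: mem_twocol)
    moreover have "changes K (arc K i l) \<le> 2" "changes K (arc K i' m) \<le> 2"
      using changes_arc_le assms(4,5) Kpos by auto
    moreover have "changes K {} = 0" by (rule changes_trivial) simp
    ultimately show ?thesis by auto
  qed
  have "bd K L ?A \<le> 2 * card (arc K i l) + 2 * card {j, j'}"
    by (rule bd_le) (use rows cols in \<open>auto simp: arc_def\<close>)
  then show "bd K L ?A \<le> 2 * l + 4" using card_arc[OF assms(4), of i] jj by simp
  show "?A \<subseteq> V" using subsetD[OF arc_subset[OF Kpos]] assms(2,3)
    by (auto simp: twocol_def mem_V)
qed

lemma Bset_low_iff:
  "A \<in> Bset h 1 (K - 1) \<longleftrightarrow> (\<exists>i j i' j'. i < K \<and> j < L \<and> i' < K \<and> j' < L \<and> adj j j' \<and>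
     arc K i' h \<subseteq> arc K i (K - 1) \<and> A = twocol (arc K i (K - 1)) j (arc K i' h) j')"
proof -
  have r: "rect K L i j 1 b = arc K i b \<times> {j}" if "j < L" for i j b
    using that by (simp add: rect_eq arc_1)
  have f: "fst ` rect K L i j 1 b = arc K i b" if "j < L" for i j b
    using r[OF that] by simp
  show ?thesis
  proof
    assume "A \<in> Bset h 1 (K - 1)"
    then obtain i j i' j' where *: "(i, j) \<in> V" "(i', j') \<in> V"
      "j' = (j + 1) mod L \<or> (j' + 1) mod L = j" "A = rect K L i j 1 (K - 1) \<union> rect K L i' j' 1 h"
      "fst ` rect K L i' j' 1 h \<subseteq> fst ` rect K L i j 1 (K - 1)"
      unfolding Bset_def by blast
    then have lt: "i < K" "j < L" "i' < K" "j' < L" by (auto simp: mem_V)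
    have "adj j j'" using *(3) unfolding adj_def .
    moreover have "arc K i' h \<subseteq> arc K i (K - 1)" using *(5) unfolding f[OF lt(2)] f[OF lt(4)] .
    moreover have "A = twocol (arc K i (K - 1)) j (arc K i' h) j'"
      using *(4) unfolding r[OF lt(2)] r[OF lt(4)] twocol_def .
    ultimately show "\<exists>i j i' j'. i < K \<and> j < L \<and> i' < K \<and> j' < L \<and> adj j j' \<and>
     arc K i' h \<subseteq> arc K i (K - 1) \<and> A = twocol (arc K i (K - 1)) j (arc K i' h) j'"
      using lt by (intro exI conjI)
  next
    assume "\<exists>i j i' j'. i < K \<and> j < L \<and> i' < K \<and> j' < L \<and> adj j j' \<and>
     arc K i' h \<subseteq> arc K i (K - 1) \<and> A = twocol (arc K i (K - 1)) j (arc K i' h) j'"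
    then obtain i j i' j' where *: "i < K" "j < L" "i' < K" "j' < L" "adj j j'"
     "arc K i' h \<subseteq> arc K i (K - 1)" "A = twocol (arc K i (K - 1)) j (arc K i' h) j'" by blast
    have "A = rect K L i j 1 (K - 1) \<union> rect K L i' j' 1 h"
      "fst ` rect K L i' j' 1 h \<subseteq> fst ` rect K L i j 1 (K - 1)"
      unfolding f[OF *(2)] f[OF *(4)] r[OF *(2)] r[OF *(4)] using *(6,7) unfolding twocol_def by auto
    moreover have "(i, j) \<in> V" "(i', j') \<in> V" using *(1-4) by (simp_all add: mem_V)
    moreover note *(5)[unfolded adj_def]
    ultimately show "A \<in> Bset h 1 (K - 1)" unfolding Bset_def mem_Collect_eq
      by (intro exI conjI)
  qed
qed

lemma Rset_low_iff:
  "A \<in> Rset 2 (K - 1) \<longleftrightarrow> (\<exists>i j j'. i < K \<and> j < L \<and> j' < L \<and> adj j j' \<and>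
     A = twocol (arc K i (K - 1)) j (arc K i (K - 1)) j')"
proof
  assume "A \<in> Rset 2 (K - 1)"
  then obtain i j where *: "(i, j) \<in> V" "A = rect K L i j 2 (K - 1)" unfolding Rset_def by blast
  then have "i < K" "j < L" by (auto simp: mem_V)
  moreover have "A = twocol (arc K i (K - 1)) j (arc K i (K - 1)) ((j + 1) mod L)"
    unfolding *(2) rect_eq arc_2[OF \<open>j < L\<close>] twocol_def by blast
  moreover have "(j + 1) mod L < L" "adj j ((j + 1) mod L)" using Lpos by (auto simp: adj_def)
  ultimately show "\<exists>i j j'. i < K \<and> j < L \<and> j' < L \<and> adj j j' \<and>
     A = twocol (arc K i (K - 1)) j (arc K i (K - 1)) j'" by blast
next
  assume "\<exists>i j j'. i < K \<and> j < L \<and> j' < L \<and> adj j j' \<and>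
     A = twocol (arc K i (K - 1)) j (arc K i (K - 1)) j'"
  then obtain i j j' where *: "i < K" "j < L" "j' < L" "adj j j'"
     "A = twocol (arc K i (K - 1)) j (arc K i (K - 1)) j'" by blast
  obtain k where k: "k < L" "{j, j'} = arc L k 2" using adj_arc * by blast
  have "A = rect K L i k 2 (K - 1)" unfolding *(5) rect_eq twocol_def k(2)[symmetric] by blast
  then show "A \<in> Rset 2 (K - 1)" unfolding Rset_def using *(1) k(1) mem_V by blast
qed

text \<open>The shapes \<open>Bset h 1 (K - 1)\<close> and \<open>Rset 2 (K - 1)\<close> at once: a column lacking one site and a
  nonempty bar in a neighbouring column, within the same rows.\<close>

lemma low_shape:
  assumes "i < K" "j < L" "j' < L" "adj j j'" "1 \<le> h" "h \<le> K - 1"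
    and "arc K i' h \<subseteq> arc K i (K - 1)"
    and A: "A = twocol (arc K i (K - 1)) j (arc K i' h) j'"
  shows "A \<subseteq> V" "bd K L A = 2 * K + 2" "\<not> has_full A" "card A = K - 1 + h"
    "\<exists>v c i0. v \<notin> A \<and> sweep c \<and> insert v A = fill c i0 (K + h)"
    "mixed_rows K L A = arc K i (K - 1)" "mixed_cols K L A = {j, j'}"
proof -
  define r where "r = (i + (K - 1)) mod K"
  have r: "r < K" "arc K i (K - 1) = {..<K} - {r}" unfolding r_def arc_but_one using Kpos by auto
  have jj: "j \<noteq> j'" using adj_neq assms by blast
  show sub: "A \<subseteq> V" unfolding A by (rule bd_twocol(2)) (use assms in auto)
  have le: "bd K L A \<le> 2 * (K - 1) + 4" unfolding A by (rule bd_twocol(1)) (use assms in auto)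
  have r': "r \<notin> arc K i' h" using assms(7) r(2) by blast
  have ne: "arc K i' h \<noteq> {}" using assms(5) card_arc[of h K i'] assms(6) by fastforce
  obtain u where u: "u \<in> arc K i' h" using ne by blast
  have u': "u < K" "u \<noteq> r" using u assms(7) r(2) by auto
  obtain k where k: "k < L" "k \<noteq> j" "k \<noteq> j'"
  proof -
    have "\<not> {..<L} \<subseteq> {j, j'}"
    proof
      assume "{..<L} \<subseteq> {j, j'}"
      then have "card {..<L} \<le> card {j, j'}" by (intro card_mono) auto
      then show False using L4 by (auto simp: card_insert_if split: if_splits)
    qed
    then show ?thesis using that by blast
  qed
  have col_j: "(p, j) \<in> A \<longleftrightarrow> p < K \<and> p \<noteq> r" for p using jj r(2) unfolding A mem_twocol by auto
  have col_j': "(p, j') \<in> A \<longleftrightarrow> p \<in> arc K i' h" for p using jj unfolding A mem_twocol by auto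
  have col_q: "(p, q) \<notin> A" if "q \<noteq> j" "q \<noteq> j'" for p q using that unfolding A mem_twocol by auto
  have npj: "\<not> full_col A j" "\<not> empty_col A j"
    unfolding full_col_def empty_col_def using r(1) u' col_j by blast+
  have npj': "\<not> full_col A j'" "\<not> empty_col A j'"
    unfolding full_col_def empty_col_def using r(1) r' u u' col_j' by blast+
  have mq: "empty_col A q" if "q \<noteq> j" "q \<noteq> j'" for q using col_q that unfolding empty_col_def by blast
  show mixed_cols: "mixed_cols K L A = {j, j'}"
  proof (rule set_eqI)
    fix q show "q \<in> mixed_cols K L A \<longleftrightarrow> q \<in> {j, j'}"
      using mem_mixed_cols[of q A] npj npj' mq[of q] assms(2,3) by (cases "q = j"; cases "q = j'") auto
  qed
  have "p \<in> mixed_rows K L A \<longleftrightarrow> p < K \<and> p \<noteq> r" for p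
  proof
    assume "p \<in> mixed_rows K L A"
    then obtain q where "p < K" "(p, q) \<in> A" unfolding mem_mixed_rows by blast
    then show "p < K \<and> p \<noteq> r"
      using col_j[of p] col_j'[of p] col_q[of q p] r' by (cases "q = j"; cases "q = j'") auto
  next
    assume "p < K \<and> p \<noteq> r"
    then have "(p, j) \<in> A" "(p, k) \<notin> A" using col_j[of p] col_q[OF k(2,3), of p] by auto
    then show "p \<in> mixed_rows K L A" unfolding mem_mixed_rows using \<open>p < K \<and> p \<noteq> r\<close> assms(2) k(1) by blast
  qed
  then show mixed_rows: "mixed_rows K L A = arc K i (K - 1)" unfolding r(2) by auto
  have "2 * card (arc K i (K - 1)) + 2 * card {j, j'} \<le> bd K L A"
    using bd_ge[of K L A] unfolding mixed_rows mixed_cols .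
  then show "bd K L A = 2 * K + 2" using le jj card_arc[of "K - 1" K i] Kpos by simp
  show "\<not> has_full A" unfolding has_full_def
  proof
    assume "\<exists>q<L. full_col A q"
    then obtain q where "q < L" "full_col A q" by blast
    then show False using npj npj' col_q[of q 0] Kpos unfolding full_col_def by blast
  qed
  have "card A = card (arc K i (K - 1) \<times> {j}) + card (arc K i' h \<times> {j'})"
    unfolding A twocol_def using jj by (intro card_Un_disjoint) (auto simp: arc_def)
  also have "\<dots> = K - 1 + h"
    using card_arc[of "K - 1" K i] card_arc[of h K i'] assms(6) by (simp add: card_cartesian_product)
  finally show "card A = K - 1 + h" .
  have "insert (r, j) A = {..<K} \<times> arc L j 1 \<union> arc K (i' mod K) h \<times> {j'}"
    using r assms(2) unfolding A twocol_def by (auto simp: arc_1 arc_mod)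
  then have "insert (r, j) A \<in> Bset h 1 K"
    unfolding Bset_K_iff[OF le_refl] using assms(2,3,4) Kpos unfolding adj_def
    by (intro exI[of _ j] exI[of _ "i' mod K"] exI[of _ j']) simp
  moreover have "1 < L" "h < K" using assms(6) Kpos L4 by auto
  ultimately obtain c i0 where "sweep c" "insert (r, j) A = fill c i0 (1 * K + h)"
    using Bset_fill_iff[OF le_refl] by blast
  then show "\<exists>v c i0. v \<notin> A \<and> sweep c \<and> insert v A = fill c i0 (K + h)"
    using col_j by (intro exI[of _ "(r, j)"]) auto
qed

lemma Bset_low_memD:
  assumes "A \<in> Bset h 1 (K - 1)" "1 \<le> h" "h \<le> K - 1"
  shows "A \<subseteq> V" "bd K L A = 2 * K + 2" "\<not> has_full A" "card A = K - 1 + h"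
    "\<exists>v c i0. v \<notin> A \<and> sweep c \<and> insert v A = fill c i0 (K + h)"
proof -
  obtain i j i' j' where *: "i < K" "j < L" "i' < K" "j' < L" "adj j j'"
     "arc K i' h \<subseteq> arc K i (K - 1)" "A = twocol (arc K i (K - 1)) j (arc K i' h) j'"
    using assms(1) unfolding Bset_low_iff by blast
  note s = low_shape[OF *(1,2,4,5) assms(2,3) *(6,7)]
  show "A \<subseteq> V" "bd K L A = 2 * K + 2" "\<not> has_full A" "card A = K - 1 + h"
    "\<exists>v c i0. v \<notin> A \<and> sweep c \<and> insert v A = fill c i0 (K + h)" using s(1-5) by auto
qed

lemma Rset_memD:
  assumes "A \<in> Rset 2 (K - 1)"
  shows "A \<subseteq> V" "bd K L A = 2 * K + 2" "\<not> has_full A" "card A = 2 * K - 2"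
    "\<exists>v c i0. v \<notin> A \<and> sweep c \<and> insert v A = fill c i0 (2 * K - 1)"
    "\<exists>Z \<in> Bset (K - 2) 1 (K - 1). near Z A"
proof -
  obtain i j j' where *: "i < K" "j < L" "j' < L" "adj j j'"
     "A = twocol (arc K i (K - 1)) j (arc K i (K - 1)) j'"
    using assms unfolding Rset_low_iff by blast
  have "1 \<le> K - 1" using K3 by simp
  note s = low_shape[OF *(1-4) this le_refl subset_refl *(5)]
  have e: "K + (K - 1) = 2 * K - 1" "K - 1 + (K - 1) = 2 * K - 2" using Kpos by auto
  show "A \<subseteq> V" "bd K L A = 2 * K + 2" "\<not> has_full A" using s(1-3) by auto
  show "card A = 2 * K - 2" "\<exists>v c i0. v \<notin> A \<and> sweep c \<and> insert v A = fill c i0 (2 * K - 1)"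
    using s(4,5) unfolding e .
  have f: "arc K i (K - 1) = insert i (arc K (Suc i) (K - 2))"
  proof -
    have "K - 1 = Suc (K - 2)" using K3 by simp
    then show ?thesis using arc_Suc_front[of K i "K - 2"] *(1) by simp
  qed
  have f2: "arc K (Suc i mod K) (K - 2) = arc K (Suc i) (K - 2)" by (rule arc_mod)
  define Z where "Z = twocol (arc K i (K - 1)) j (arc K (Suc i mod K) (K - 2)) j'"
  have "Z \<in> Bset (K - 2) 1 (K - 1)"
    unfolding Bset_low_iff Z_def using * f f2 Kpos
    by (intro exI[of _ i] exI[of _ j] exI[of _ "Suc i mod K"] exI[of _ j']) auto
  moreover have "A = insert (i, j') Z" unfolding *(5) Z_def twocol_def f2 using f by blast
  then have "near Z A" unfolding near_def by blast
  ultimately show "\<exists>Z \<in> Bset (K - 2) 1 (K - 1). near Z A" by blast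
qed

text \<open>The shape uses up the whole budget of \<open>K + 1\<close> mixed rows and columns. A site can be added only in
  the free row of its two columns, and after removing a site the column concerned must still be an
  arc.\<close>

lemma Rset_near:
  assumes "A \<in> Rset 2 (K - 1)" "near A B" "B \<in> Lev"
  shows "B = A \<or> B \<in> Bset (K - 2) 1 (K - 1) \<or> (has_full B \<and> has_empty B \<and> card B = 2 * K - 1)"
proof -
  obtain i j j' where *: "i < K" "j < L" "j' < L" "adj j j'"
     "A = twocol (arc K i (K - 1)) j (arc K i (K - 1)) j'"
    using assms unfolding Rset_low_iff by blast
  have B: "B \<subseteq> V" "bd K L B \<le> 2 * K + 2" using assms(3) by (auto simp: Lev_def)
  have "1 \<le> K - 1" using K3 by simp
  note s = low_shape[OF *(1-4) this le_refl subset_refl *(5)]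
  have jj: "j \<noteq> j'" using adj_neq * by blast
  define r where "r = (i + (K - 1)) mod K"
  have r: "r < K" "arc K i (K - 1) = {..<K} - {r}" unfolding r_def arc_but_one using Kpos by auto
  have A: "(p, q) \<in> A \<longleftrightarrow> (q = j \<or> q = j') \<and> p < K \<and> p \<noteq> r" for p q
    unfolding *(5) mem_twocol r(2) by auto
  have cardR: "card (arc K i (K - 1)) = K - 1" using card_arc[of "K - 1" K i] by simp
  obtain k k' where k: "k < L" "k \<noteq> j" "k \<noteq> j'" "k' < L" "k' \<noteq> j" "k' \<noteq> j'" "k \<noteq> k'"
  proof -
    have "2 \<le> card ({..<L} - {j, j'})" using jj *(2,3) L4 by (simp add: card_Diff_subset)
    then obtain T where "T \<subseteq> {..<L} - {j, j'}" "card T = 2" by (meson obtain_subset_with_card_n)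
    then show ?thesis using that unfolding card_2_iff by blast
  qed
  obtain v where "B = insert v A \<or> B = A - {v}" using assms(2) unfolding near_def by blast
  then consider "B = A" | "B = insert v A" "v \<notin> A" | "B = A - {v}" "v \<in> A" by auto
  then show ?thesis
  proof cases
    case 2
    obtain p q where v: "v = (p, q)" by force
    have pq: "p < K" "q < L" using B(1) 2(1) mem_V unfolding v by auto
    have memB: "(x, y) \<in> B \<longleftrightarrow> ((y = j \<or> y = j') \<and> x < K \<and> x \<noteq> r) \<or> (x = p \<and> y = q)" for x y
      using 2(1) A unfolding v by auto
    show ?thesis
    proof (cases "q = j \<or> q = j'")
      case True
      then have pr: "p = r" using 2(2) A pq(1) unfolding v by blast
      have "full_col B q" unfolding full_col_def memB using True pr by blast
      moreover have "empty_col B k" unfolding empty_col_def memB using k True by blast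
      moreover have "card B = Suc (card A)"
        using 2 finite_subset[OF s(1) finite_torus] by simp
      ultimately show ?thesis unfolding has_full_def has_empty_def using s(4) pq(2) k(1) Kpos by auto
    next
      case False
      have d: "{..<K} - {r} \<subseteq> mixed_rows K L B"
      proof
        fix x assume x: "x \<in> {..<K} - {r}"
        have "(x, j) \<in> B" "(x, k) \<notin> B \<or> (x, k') \<notin> B"
          unfolding memB using x k by auto
        then show "x \<in> mixed_rows K L B" unfolding mem_mixed_rows using x *(2) k by auto
      qed
      obtain u where u: "u < K" "u \<noteq> r"
      proof -
        have "(if r = 0 then 1 else 0) < K" "(if r = 0 then 1 else 0) \<noteq> r" using K3 by auto
        then show ?thesis using that by blast
      qed
      obtain w where w: "w < K" "w \<noteq> p"
      proof -
        have "(if p = 0 then 1 else 0) < K" "(if p = 0 then 1 else 0) \<noteq> p" using K3 by auto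
        then show ?thesis using that by blast
      qed
      have "\<not> full_col B j" "\<not> full_col B j'" unfolding full_col_def memB using r(1) False by blast+
      moreover have "\<not> empty_col B j" "\<not> empty_col B j'" unfolding empty_col_def memB using u by blast+
      moreover have "\<not> full_col B q" unfolding full_col_def memB using w False by blast
      moreover have "\<not> empty_col B q" unfolding empty_col_def memB using pq by blast
      ultimately have e: "{j, j', q} \<subseteq> mixed_cols K L B" using pq(2) *(2,3) by (simp add: mem_mixed_cols)
      have "2 * card ({..<K} - {r}) + 2 * card {j, j', q} \<le> bd K L B"
        by (rule bd_ge_card[OF _ _ d e]) auto
      moreover have "card {j, j', q} = 3" using False jj by auto
      moreover have "card ({..<K} - {r}) = K - 1" using r cardR by simp
      ultimately have False using B(2) Kpos by simp
      then show ?thesis ..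
    qed
  next
    case 3
    obtain p q where v: "v = (p, q)" by force
    have q: "q = j \<or> q = j'" and p: "p < K" "p \<noteq> r" using 3(2) A unfolding v by auto
    define q' where "q' = (if q = j then j' else j)"
    have q': "{j, j'} = {q, q'}" "q \<noteq> q'" "adj q' q" "q < L" "q' < L"
      using q jj * unfolding q'_def adj_def by auto
    have A': "(x, y) \<in> A \<longleftrightarrow> (y = q \<or> y = q') \<and> x < K \<and> x \<noteq> r" for x y
      using A[of x y] q'(1) by blast
    have memB: "(x, y) \<in> B \<longleftrightarrow> (y = q' \<and> x < K \<and> x \<noteq> r) \<or> (y = q \<and> x < K \<and> x \<noteq> r \<and> x \<noteq> p)" for x y
      unfolding 3(1) v using A' q'(2) by auto
    have kq: "k \<noteq> q" "k \<noteq> q'" using k q'(1) by auto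
    have d: "{..<K} - {r} \<subseteq> mixed_rows K L B"
      unfolding mem_mixed_rows[abs_def] subset_iff mem_mixed_rows memB using q'(5) k(1) kq by auto
    obtain u where u: "u < K" "u \<noteq> r" "u \<noteq> p"
    proof -
      have "\<not> {..<K} \<subseteq> {r, p}"
      proof
        assume "{..<K} \<subseteq> {r, p}"
        then have "card {..<K} \<le> card {r, p}" by (intro card_mono) auto
        then show False using K3 by (auto simp: card_insert_if split: if_splits)
      qed
      then show ?thesis using that by blast
    qed
    have "\<not> full_col B q" "\<not> full_col B q'" unfolding full_col_def memB using r(1) q'(2) by blast+
    moreover have "\<not> empty_col B q" "\<not> empty_col B q'" unfolding empty_col_def memB using u by blast+
    ultimately have e: "{q, q'} \<subseteq> mixed_cols K L B" using q'(4,5) by (simp add: mem_mixed_cols)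
    have "card {..<K} - 1 \<le> card (mixed_rows K L B)"
      using card_mono[OF finite_mixed_rows d] r(1) by simp
    moreover have "2 \<le> card (mixed_cols K L B)"
      using card_mono[OF finite_mixed_cols e] q'(2) by simp
    moreover have "q \<in> mixed_cols K L B" using e by simp
    then have "2 * card (mixed_rows K L B) + 2 * card (mixed_cols K L B) + changes K (col B q) \<le> bd K L B + 2"
      by (rule col_changes_le)
    ultimately have "changes K (col B q) \<le> 2" using B(2) by simp
    moreover have "mixed K (col B q)" using e unfolding mixed_cols_def by auto
    ultimately obtain a l where al: "a < K" "l < K" "col B q \<inter> {..<K} = arc K a l"
      using mixed_arc by blast
    have "col B q \<inter> {..<K} = {..<K} - {r, p}" using memB q'(2) by auto
    then have arcB: "arc K a l = {..<K} - {r, p}" using al(3) by simp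
    have "l = K - 2"
    proof -
      have "card (arc K a l) = card {..<K} - card {r, p}"
        unfolding arcB using r(1) p(1) by (intro card_Diff_subset) auto
      then show ?thesis using card_arc[of l K a] al(2) p(2) by simp
    qed
    have "B = twocol (arc K i (K - 1)) q' (arc K a l) q"
    proof (rule set_eqI)
      fix z show "z \<in> B \<longleftrightarrow> z \<in> twocol (arc K i (K - 1)) q' (arc K a l) q"
        unfolding r(2) arcB by (cases z) (auto simp: memB mem_twocol)
    qed
    moreover have "arc K a l \<subseteq> arc K i (K - 1)" unfolding arcB r(2) by blast
    ultimately have "B \<in> Bset (K - 2) 1 (K - 1)"
      unfolding Bset_low_iff using *(1) q'(3-5) al(1) \<open>l = K - 2\<close> by blast
    then show ?thesis by blast
  qed blast
qed

lemma sweep_adj: "sweep c \<Longrightarrow> adj (c 0) (c 1)"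
proof -
  assume "sweep c"
  then obtain j where j: "j < L" "c = (\<lambda>q. (j + q) mod L) \<or> c = (\<lambda>q. (j + (L - q)) mod L)"
    unfolding sweep_def by blast
  from j(2) show ?thesis
  proof
    assume "c = (\<lambda>q. (j + q) mod L)"
    then show ?thesis using j(1) by (simp add: adj_def)
  next
    assume c: "c = (\<lambda>q. (j + (L - q)) mod L)"
    have "(c 1 + 1) mod L = (j + (L - 1) + 1) mod L" unfolding c by (rule mod_add_left_eq)
    also have "\<dots> = c 0" unfolding c using Lpos by simp
    finally show ?thesis by (simp add: adj_def)
  qed
qed

text \<open>If the removed site lay in a row met by the bar, all \<open>K\<close> rows would stay mixed and two
  columns would be, at a cost of \<open>2 K + 4\<close>. So it lies in a row free of the bar, and what remains of the full
  column is an arc of length \<open>K - 1\<close> containing the rows of the bar.\<close>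

lemma lose_full_column:
  assumes "A \<in> Lev" "has_full A" "has_empty A" "B = A - {y}" "B \<in> Lev" "\<not> has_full B"
  shows "\<exists>h<K. card A = K + h \<and> (h = 0 \<or> (1 \<le> h \<and> h \<le> K - 2 \<and> B \<in> Bset h 1 (K - 1)) \<or>
    (h = K - 1 \<and> B \<in> Rset 2 (K - 1)))"
proof -
  obtain c i0 where c: "sweep c" "A = fill c i0 (card A)" "K \<le> card A" "card A \<le> K * (L - 1)"
    using full_and_empty_column_fill assms(1-3) by blast
  have nL: "card A \<le> K * L" using c(4) by (rule order_trans) simp
  have cL: "c q < L" for q using sweep_less c(1) by blast
  have c012: "c 0 \<noteq> c 1" "c 0 \<noteq> c 2" "c 1 \<noteq> c 2"
    using sweep_eq_iff[OF c(1), of 0 1] sweep_eq_iff[OF c(1), of 0 2] sweep_eq_iff[OF c(1), of 1 2] L4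
    by auto
  have bdB: "bd K L B \<le> 2 * K + 2" using assms(5) by (simp add: Lev_def)
  have lost: "snd y = q" if "q < L" "full_col A q" for q
  proof (rule ccontr)
    assume "snd y \<noteq> q"
    then have "full_col B q" using that(2) unfolding assms(4) full_col_def by auto
    then show False using assms(6) that(1) unfolding has_full_def by blast
  qed
  have "card A div K < 2"
  proof (rule ccontr)
    assume "\<not> card A div K < 2"
    then have "full_col A (c 0)" "full_col A (c 1)"
      using full_col_fill[OF c(1) nL, of 0 i0] full_col_fill[OF c(1) nL, of 1 i0] L4 c(2) by auto
    then show False using lost cL c012(1) by metis
  qed
  moreover have "1 \<le> card A div K" using c(3) Kpos by (simp add: Suc_le_eq div_greater_zero_iff)
  ultimately have "card A div K = 1" by simp
  define h where "h = card A mod K"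
  have h: "h < K" "card A = 1 * K + h"
    using \<open>card A div K = 1\<close> Kpos div_mult_mod_eq[of "card A" K] unfolding h_def by simp_all
  have A: "A = {..<K} \<times> {c 0} \<union> arc K i0 h \<times> {c 1}"
    using c(2) fill_band[OF c(1) _ h(1), of 1 i0] L4 unfolding h(2) by (simp add: lessThan_Suc)
  have "full_col A (c 0)" unfolding full_col_def A by auto
  then have "snd y = c 0" using lost cL by blast
  then obtain r where y: "y = (r, c 0)" by (metis prod.collapse)
  have rK: "r < K"
  proof (rule ccontr)
    assume "\<not> r < K"
    then have "full_col B (c 0)" unfolding assms(4) full_col_def A y by auto
    then show False using assms(6) cL unfolding has_full_def by blast
  qed
  have memB: "(p, q) \<in> B \<longleftrightarrow> (q = c 0 \<and> p < K \<and> p \<noteq> r) \<or> (q = c 1 \<and> p \<in> arc K i0 h)" for p q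
    unfolding assms(4) A y using c012(1) by auto
  have "h = 0 \<or> (1 \<le> h \<and> h \<le> K - 2 \<and> B \<in> Bset h 1 (K - 1)) \<or> (h = K - 1 \<and> B \<in> Rset 2 (K - 1))"
  proof (cases "h = 0")
    case False
    then have h1: "1 \<le> h" by simp
    have hK: "arc K i0 h \<subseteq> {..<K}" by (rule arc_subset[OF Kpos])
    have ch: "card (arc K i0 h) = h" using card_arc h(1) by simp
    have rh: "r \<notin> arc K i0 h"
    proof
      assume r: "r \<in> arc K i0 h"
      have "\<not> {..<K} \<subseteq> arc K i0 h"
      proof
        assume "{..<K} \<subseteq> arc K i0 h"
        then have "arc K i0 h = {..<K}" using hK by blast
        then show False using ch h(1) by simp
      qed
      then obtain w where w: "w < K" "w \<notin> arc K i0 h" by blast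
      then have wr: "w \<noteq> r" using r by blast
      have d: "{..<K} \<subseteq> mixed_rows K L B"
      proof
        fix p assume p: "p \<in> {..<K}"
        have "(p, c 0) \<in> B \<or> (p, c 1) \<in> B" using p r memB by blast
        moreover have "(p, c 2) \<notin> B" using memB c012 by metis
        ultimately show "p \<in> mixed_rows K L B" unfolding mem_mixed_rows using p cL by blast
      qed
      have "\<not> full_col B (c 0)" "\<not> empty_col B (c 0)"
        unfolding full_col_def empty_col_def memB using rK w wr c012(1) by blast+
      moreover have "\<not> full_col B (c 1)" "\<not> empty_col B (c 1)"
        unfolding full_col_def empty_col_def memB using rK w r c012(1) by metis+
      ultimately have e: "{c 0, c 1} \<subseteq> mixed_cols K L B" using cL by (simp add: mem_mixed_cols)
      have "2 * card {..<K} + 2 * card {c 0, c 1} \<le> bd K L B"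
        by (rule bd_ge_card[OF _ _ d e]) auto
      then show False using bdB c012(1) by simp
    qed
    have I: "{..<K} - {r} = arc K (Suc r mod K) (K - 1)"
      using all_but_one_arc[OF rK] by (simp add: arc_mod)
    have "arc K i0 h \<subseteq> {..<K} - {r}" using hK rh by auto
    then have sub: "arc K (i0 mod K) h \<subseteq> arc K (Suc r mod K) (K - 1)"
      unfolding I arc_mod .
    have B: "B = twocol (arc K (Suc r mod K) (K - 1)) (c 0) (arc K (i0 mod K) h) (c 1)"
    proof (rule set_eqI)
      fix z show "z \<in> B \<longleftrightarrow> z \<in> twocol (arc K (Suc r mod K) (K - 1)) (c 0) (arc K (i0 mod K) h) (c 1)"
        unfolding I[symmetric] by (cases z) (auto simp: memB mem_twocol arc_mod)
    qed
    have less: "Suc r mod K < K" "i0 mod K < K" using Kpos by auto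
    show ?thesis
    proof (cases "h \<le> K - 2")
      case True
      have "B \<in> Bset h 1 (K - 1)"
        unfolding Bset_low_iff using B sub less cL sweep_adj[OF c(1)] by blast
      then show ?thesis using True h1 by blast
    next
      case False
      then have hh: "h = K - 1" using h(1) by simp
      have "arc K (i0 mod K) h = arc K (Suc r mod K) (K - 1)"
        by (rule card_subset_eq[OF _ sub]) (use hh card_arc[of "K - 1" K] in \<open>auto simp: arc_def\<close>)
      then have "B \<in> Rset 2 (K - 1)"
        unfolding Rset_low_iff using B less cL sweep_adj[OF c(1)] by metis
      then show ?thesis using hh by blast
    qed
  qed blast
  then show ?thesis using h by (intro exI[of _ h]) simp
qed

end

section \<open>Paths of vertex sets\<close>

text \<open>Connection by single moves within \<open>U\<close>; moves are reversible, so this is symmetric.\<close>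

definition joined :: "vertex set set \<Rightarrow> vertex set \<Rightarrow> vertex set \<Rightarrow> bool" where
  "joined U = (\<lambda>X Y. X \<in> U \<and> Y \<in> U \<and> near X Y)\<^sup>*\<^sup>*"

lemma joined_refl [simp]: "joined U A A" by (simp add: joined_def)

lemma joined_trans: "joined U A B \<Longrightarrow> joined U B C \<Longrightarrow> joined U A C"
  unfolding joined_def by (rule rtranclp_trans)

lemma joined_step: "A \<in> U \<Longrightarrow> B \<in> U \<Longrightarrow> near A B \<Longrightarrow> joined U A B"
  unfolding joined_def by (intro r_into_rtranclp conjI)

lemma joined_sym: "joined U A B \<Longrightarrow> joined U B A"
  unfolding joined_def
proof (induction rule: rtranclp_induct)
  case (step Y Z)
  then have "Z \<in> U \<and> Y \<in> U \<and> near Z Y" using near_sym by blast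
  then show ?case using step.IH by (rule converse_rtranclp_into_rtranclp)
qed simp

lemma joined_mono:
  assumes "joined U A B" "U \<subseteq> W"
  shows "joined W A B"
  using assms(1) unfolding joined_def
  by (rule rtranclp_mono[THEN predicate2D, rotated]) (use assms(2) in blast)

lemma joined_closed:
  assumes "joined U A B" "A \<in> D"
    and "\<And>X Y. X \<in> D \<Longrightarrow> X \<in> U \<Longrightarrow> Y \<in> U \<Longrightarrow> near X Y \<Longrightarrow> Y \<in> D"
  shows "B \<in> D"
  using assms(1) unfolding joined_def
  by (induction rule: rtranclp_induct) (use assms(2,3) in auto)

lemma joined_chain:
  fixes m n :: nat
  assumes "m \<le> n" "\<And>k. m \<le> k \<Longrightarrow> k \<le> n \<Longrightarrow> f k \<in> U"
    and "\<And>k. m \<le> k \<Longrightarrow> k < n \<Longrightarrow> near (f k) (f (Suc k))"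
  shows "joined U (f m) (f n)"
  using assms
proof (induction n rule: dec_induct)
  case (step n)
  have "joined U (f m) (f n)" using step by simp
  moreover have "joined U (f n) (f (Suc n))" using step by (intro joined_step) auto
  ultimately show ?case by (rule joined_trans)
qed simp

context ising_torus begin

lemma Non_Lev: "Non \<subseteq> Lev" by (auto simp: Non_def Lev_def)

lemma fill_Lev: "sweep c \<Longrightarrow> n \<le> K * L \<Longrightarrow> fill c i0 n \<in> Lev"
  using fill_subset bd_fill by (simp add: Lev_def)

lemma fill_Non: "sweep c \<Longrightarrow> n \<le> K \<Longrightarrow> fill c i0 n \<in> Non"
  using fill_subset[of c i0 n] bd_fill_column[of c n i0] by (simp add: Non_def)

lemma fill_joined:
  assumes "m \<le> n" "\<And>k. m \<le> k \<Longrightarrow> k \<le> n \<Longrightarrow> fill c i0 k \<in> U"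
  shows "joined U (fill c i0 m) (fill c i0 n)"
  using assms by (rule joined_chain) (auto simp: fill_Suc near_def)

lemma Suc_mod_inj: "Suc a mod K = Suc b mod K \<Longrightarrow> a mod K = b mod K"
  by (rule offset_inj[of 1 _ K]) (use Kpos in \<open>simp_all add: mod_Suc_eq\<close>)

text \<open>The column is kept one site shorter, at an end not covered by the bar, until the bar is
  complete: a column of length \<open>K - 2\<close> with a bar beside it costs at most \<open>2 K\<close>, so that only the
  last move reaches the barrier.\<close>

lemma low_link:
  assumes "A \<in> Bset h 1 (K - 1)" "1 \<le> h" "h \<le> K - 2"
  shows "joined (insert A Non) {} A"
proof -
  obtain i j i' j' where *: "i < K" "j < L" "i' < K" "j' < L" "adj j j'"
     "arc K i' h \<subseteq> arc K i (K - 1)" "A = twocol (arc K i (K - 1)) j (arc K i' h) j'"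
    using assms(1) unfolding Bset_low_iff by blast
  have hK: "h \<le> K" "2 \<le> K - h" using assms(3) K3 by auto
  have K1: "K - 1 = Suc (K - 2)" using K3 by simp
  define r where "r = (i + (K - 1)) mod K"
  have r: "r < K" "arc K i (K - 1) = {..<K} - {r}" unfolding r_def arc_but_one using Kpos by auto
  have co: "{..<K} - arc K i' h = arc K (i' + h) (K - h)" by (rule arc_compl[OF Kpos hK(1)])
  have "r \<in> arc K (i' + h) (K - h)" using co r *(6) by blast
  then obtain x where x: "x < K - h" "r = (i' + h + x) mod K" unfolding arc_def by blast
  \<comment> \<open>the rows outside the bar form an arc of length at least two containing the free row \<open>r\<close>,
    hence also one of the two neighbours of \<open>r\<close>, which are the ends of the column\<close>
  have "\<exists>s e. arc K i (K - 1) = insert e (arc K s (K - 2)) \<and> e \<notin> arc K i' h"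
  proof (cases "Suc x < K - h")
    case True
    have "i = Suc (i + (K - 1)) mod K" using *(1) Kpos by simp
    also have "\<dots> = Suc r mod K" unfolding r_def by (simp only: mod_Suc_eq)
    also have "\<dots> = (i' + h + Suc x) mod K" unfolding x(2) by (simp add: mod_Suc_eq)
    finally have "i \<in> arc K (i' + h) (K - h)" using True unfolding arc_def by blast
    then have "i \<notin> arc K i' h" using co by blast
    moreover have "arc K i (K - 1) = insert i (arc K (Suc i) (K - 2))"
      unfolding K1 arc_Suc_front using *(1) by simp
    ultimately show ?thesis by blast
  next
    case False
    then obtain x' where x': "x = Suc x'" using x(1) hK(2) by (cases x) auto
    have "Suc (i + (K - 2)) mod K = Suc (i' + h + x') mod K"
      using x(2) unfolding r_def K1 x' by simp
    then have "(i + (K - 2)) mod K = (i' + h + x') mod K" by (rule Suc_mod_inj)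
    then have "(i + (K - 2)) mod K \<in> arc K (i' + h) (K - h)"
      using x(1) unfolding x' arc_def by force
    then have "(i + (K - 2)) mod K \<notin> arc K i' h" using co by blast
    then show ?thesis unfolding K1 arc_Suc by blast
  qed
  then obtain s e where s: "arc K i (K - 1) = insert e (arc K s (K - 2))" "e \<notin> arc K i' h" by blast
  have sub: "arc K i' h \<subseteq> arc K s (K - 2)"
    using *(6) unfolding s(1) by (rule iffD1[OF subset_insert[OF s(2)]])
  have NonI: "twocol (arc K s l) j (arc K i' m) j' \<in> Non"
    if "l \<le> K - 2" "m \<le> h" "arc K i' m \<subseteq> arc K s l" for l m
  proof -
    have lm: "l \<le> K" "m \<le> K" using that hK(1) by auto
    have "2 * l + 4 < 2 * K + 2" using that(1) K3 by simp
    then show ?thesis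
      using bd_twocol[OF *(5,2,4) lm that(3)] unfolding Non_def by simp
  qed
  have "joined Non (twocol (arc K s 0) j (arc K i' 0) j') (twocol (arc K s (K - 2)) j (arc K i' 0) j')"
  proof (rule joined_chain[where f = "\<lambda>l. twocol (arc K s l) j (arc K i' 0) j'"])
    fix l assume "l \<le> K - 2"
    then show "twocol (arc K s l) j (arc K i' 0) j' \<in> Non" by (rule NonI) simp_all
  next
    fix l show "near (twocol (arc K s l) j (arc K i' 0) j') (twocol (arc K s (Suc l)) j (arc K i' 0) j')"
      unfolding near_def twocol_def arc_Suc by blast
  qed simp
  moreover have "joined Non (twocol (arc K s (K - 2)) j (arc K i' 0) j')
      (twocol (arc K s (K - 2)) j (arc K i' h) j')"
  proof (rule joined_chain[where f = "\<lambda>m. twocol (arc K s (K - 2)) j (arc K i' m) j'"])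
    fix m assume "m \<le> h"
    then have "arc K i' m \<subseteq> arc K i' h" by (auto simp: arc_def)
    then show "twocol (arc K s (K - 2)) j (arc K i' m) j' \<in> Non" using NonI \<open>m \<le> h\<close> sub by blast
  next
    fix m show "near (twocol (arc K s (K - 2)) j (arc K i' m) j')
        (twocol (arc K s (K - 2)) j (arc K i' (Suc m)) j')"
      unfolding near_def twocol_def arc_Suc by blast
  qed simp
  ultimately have "joined Non {} (twocol (arc K s (K - 2)) j (arc K i' h) j')"
    using joined_trans by (simp add: twocol_def)
  then have "joined (insert A Non) {} (twocol (arc K s (K - 2)) j (arc K i' h) j')"
    by (rule joined_mono) blast
  moreover have "joined (insert A Non) (twocol (arc K s (K - 2)) j (arc K i' h) j') A"
  proof (rule joined_step)
    show "twocol (arc K s (K - 2)) j (arc K i' h) j' \<in> insert A Non" using NonI sub by blast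
    have "A = insert (e, j) (twocol (arc K s (K - 2)) j (arc K i' h) j')"
      unfolding *(7) s(1) twocol_def by blast
    then show "near (twocol (arc K s (K - 2)) j (arc K i' h) j') A" unfolding near_def by blast
  qed simp
  ultimately show ?thesis by (rule joined_trans)
qed

section \<open>The far side of the barrier\<close>

definition "band r = ({..<K} - {r}) \<times> {..<L}"

text \<open>The far side of the crossing. A band lacking one row has no full column; it is included because
  for \<open>L = K + 1\<close> it is an admissible neighbour of sets with a full column, and of no other sets but
  itself.\<close>

definition "plusside A \<longleftrightarrow> has_full A \<or> (\<exists>r<K. A = band r)"

lemma mem_band: "(p, q) \<in> band r \<longleftrightarrow> p < K \<and> p \<noteq> r \<and> q < L"
  by (auto simp: band_def)

lemma two_other_rows: "\<exists>p<K. \<exists>p'<K. p \<noteq> r \<and> p' \<noteq> r \<and> p \<noteq> p'"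
proof -
  have "card {..<K} - card {r} \<le> card ({..<K} - {r})" by (rule diff_card_le_card_Diff) simp
  then have "2 \<le> card ({..<K} - {r})" using K3 by simp
  then obtain T where "T \<subseteq> {..<K} - {r}" "card T = 2" by (meson obtain_subset_with_card_n)
  then show ?thesis unfolding card_2_iff by blast
qed

lemma band_not_has_empty: "\<not> has_empty (band r)"
proof -
  obtain p where "p < K" "p \<noteq> r" using two_other_rows by blast
  then show ?thesis unfolding has_empty_def empty_col_def using mem_band by blast
qed

text \<open>A mixed row in addition to \<open>L > K\<close> mixed columns would exceed the barrier.\<close>

lemma all_columns_mixed:
  assumes "A \<in> Lev" "\<not> has_full A" "\<not> has_empty A" "i < K" "j < L" "j' < L"
  shows "(i, j) \<in> A \<longleftrightarrow> (i, j') \<in> A"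
proof (rule ccontr)
  assume ne: "\<not> ?thesis"
  have "{..<L} \<subseteq> mixed_cols K L A" using assms(2,3) unfolding has_full_def has_empty_def by (auto simp: mem_mixed_cols)
  moreover have "{i} \<subseteq> mixed_rows K L A" using ne assms(4-6) by (auto simp: mem_mixed_rows)
  ultimately have "2 * card {i} + 2 * card {..<L} \<le> bd K L A" by (intro bd_ge_card) auto
  then show False using assms(1) KL by (simp add: Lev_def)
qed

text \<open>With neither a full nor an empty column all columns are mixed, which forces \<open>L = K + 1\<close> and
  a horizontal band; such a band is a dead end, as its neighbours of admissible energy show.\<close>

lemma plusside_exit:
  assumes "B \<in> Lev" "plusside B" "A \<in> Lev" "\<not> plusside A" "near B A"
  shows "has_full B \<and> has_empty B \<and> (\<exists>y. A = B - {y})"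
proof -
  have AV: "A \<subseteq> V" and BV: "B \<subseteq> V" using assms(1,3) by (auto simp: Lev_def)
  have nA: "\<not> has_full A" "\<And>r. r < K \<Longrightarrow> A \<noteq> band r" using assms(4) unfolding plusside_def by auto
  obtain y where y: "A = insert y B \<or> A = B - {y}" using assms(5) unfolding near_def by blast
  show ?thesis
  proof (cases "has_full B")
    case True
    then have "A \<noteq> insert y B" using nA(1) unfolding has_full_def full_col_def by blast
    then have A: "A = B - {y}" using y by blast
    obtain j where j: "j < L" "full_col B j" using True unfolding has_full_def by blast
    have "\<not> full_col A j" using nA(1) j(1) unfolding has_full_def by blast
    then obtain r where r: "r < K" "(r, j) \<notin> A" unfolding full_col_def by blast
    then have yr: "y = (r, j)" using j(2) A unfolding full_col_def by blast
    have "has_empty B"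
    proof (rule ccontr)
      assume nm: "\<not> has_empty B"
      have "\<not> has_empty A"
      proof
        assume "has_empty A"
        then obtain q where q: "q < L" "empty_col A q" unfolding has_empty_def by blast
        obtain p where p: "p < K" "p \<noteq> r" using two_other_rows by blast
        show False
        proof (cases "q = j")
          case True
          have "(p, j) \<in> A" using j(2) p A yr unfolding full_col_def by auto
          then show False using q(2) True p(1) unfolding empty_col_def by blast
        next
          case False
          then have "empty_col B q" using q(2) A yr unfolding empty_col_def by auto
          then show False using nm q(1) unfolding has_empty_def by blast
        qed
      qed
      then have same: "(p, q) \<in> A \<longleftrightarrow> (p, j) \<in> A" if "p < K" "q < L" for p q
        using all_columns_mixed[OF assms(3) nA(1)] that j(1) by blast
      have "(p, j) \<in> A \<longleftrightarrow> p \<noteq> r" if "p < K" for p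
        using j(2) that A yr unfolding full_col_def by auto
      then have "(p, q) \<in> A \<longleftrightarrow> (p, q) \<in> band r" for p q
        using same[of p q] AV mem_V[of p q] mem_band[of p q r] by blast
      then have "A = band r" by (intro set_eqI) (metis surj_pair)
      then show False using nA(2) r(1) by blast
    qed
    then show ?thesis using True A by blast
  next
    case False
    then obtain r where r: "r < K" "B = band r" using assms(2) unfolding plusside_def by blast
    obtain p q where pq: "y = (p, q)" by force
    have ne: "A \<noteq> B" using assms(2,4) by blast
    from y have False
    proof
      assume A: "A = insert y B"
      then have "p < K" "q < L" using AV pq mem_V by auto
      then have "p = r" using ne A unfolding r(2) pq using mem_band[of p q r] by blast
      then have "full_col A q" unfolding full_col_def A pq r(2) using mem_band \<open>q < L\<close> by blast
      then show False using nA(1) \<open>q < L\<close> unfolding has_full_def by blast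
    next
      assume A: "A = B - {y}"
      then have "y \<in> B" using ne by blast
      then have p: "p < K" "p \<noteq> r" "q < L" unfolding pq r(2) mem_band by auto
      obtain p' where p': "p' < K" "p' \<noteq> r" "p' \<noteq> p" using two_other_rows[of r] by metis
      have "\<not> has_empty A"
      proof
        assume "has_empty A"
        then obtain q' where "q' < L" "empty_col A q'" unfolding has_empty_def by blast
        moreover have "(p', q') \<in> A" if "q' < L" using p' that unfolding A pq r(2) by (simp add: mem_band)
        ultimately show False using p'(1) unfolding empty_col_def by blast
      qed
      moreover obtain q' where q': "q' < L" "q' \<noteq> q"
      proof -
        have "(if q = 0 then 1 else 0) < L" "(if q = 0 then 1 else 0) \<noteq> q" using L4 by auto
        then show ?thesis using that by blast
      qed
      ultimately have "(p, q) \<in> A \<longleftrightarrow> (p, q') \<in> A"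
        using all_columns_mixed[OF assms(3) nA(1)] p(1,3) by blast
      moreover have "(p, q') \<in> A" using p(1,2) q' unfolding A pq r(2) by (simp add: mem_band)
      ultimately show False unfolding A pq by blast
    qed
    then show ?thesis ..
  qed
qed

text \<open>In the middle part, where the size determines the shape, the far side is cut down to the sizes
  above \<open>N\<close>.\<close>

definition "far N = {A \<in> Lev. plusside A \<and> (has_empty A \<longrightarrow> N < card A)}"

lemma V_far: "V \<in> far N"
proof -
  have c: "sweep (\<lambda>q. (0 + q) mod L)" unfolding sweep_def using Lpos by blast
  have "V \<in> Lev" using fill_Lev[OF c le_refl, of 0] fill_all[OF c] by simp
  moreover have "has_full V" unfolding has_full_def full_col_def using Lpos mem_V by blast
  moreover have "\<not> has_empty V" unfolding has_empty_def empty_col_def using Kpos mem_V by blast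
  ultimately show ?thesis by (simp add: far_def plusside_def)
qed

lemma empty_not_plusside: "\<not> plusside {}"
proof -
  have "band r \<noteq> {}" for r
  proof -
    obtain p where "p < K" "p \<noteq> r" using two_other_rows by metis
    then have "(p, 0) \<in> band r" using Lpos by (simp add: mem_band)
    then show ?thesis by blast
  qed
  then show ?thesis unfolding plusside_def has_full_def full_col_def using Kpos by blast
qed

text \<open>A move out of \<open>far N\<close> either destroys the last full column, which fixes the shapes involved, or
  reaches size \<open>N\<close>. A set whose empty column has just appeared is not too small for this, as it
  has no other empty column and at most one mixed column.\<close>

lemma far_step:
  assumes "A \<in> far N" "B \<in> Lev" "near A B" "N \<le> (L - 2) * K + 1"
  shows "B \<in> far N \<or> (has_full B \<and> has_empty B \<and> card B = N) \<or>
    (\<exists>h<K. has_full A \<and> has_empty A \<and> card A = K + h \<and> N < K + h \<and>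
      (h = 0 \<or> (1 \<le> h \<and> h \<le> K - 2 \<and> B \<in> Bset h 1 (K - 1)) \<or> (h = K - 1 \<and> B \<in> Rset 2 (K - 1))))"
proof -
  have A: "A \<in> Lev" "plusside A" "has_empty A \<Longrightarrow> N < card A" using assms(1) by (auto simp: far_def)
  have fin: "finite A" "finite B"
    using A(1) assms(2) finite_subset[OF _ finite_torus] by (auto simp: Lev_def)
  obtain y where y: "B = insert y A \<or> B = A - {y}" using assms(3) unfolding near_def by blast
  show ?thesis
  proof (cases "plusside B")
    case False
    then obtain z where z: "has_full A" "has_empty A" "B = A - {z}"
      using plusside_exit[OF A(1,2) assms(2) False assms(3)] by blast
    have "\<not> has_full B" using False unfolding plusside_def by blast
    from lose_full_column[OF A(1) z assms(2) this] show ?thesis using A(3)[OF z(2)] z(1,2) by metis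
  next
    case True
    show ?thesis
    proof (cases "has_empty B")
      case False
      then show ?thesis using True assms(2) by (simp add: far_def)
    next
      case mc: True
      then have pc: "has_full B" using True band_not_has_empty unfolding plusside_def by blast
      have "N \<le> card B"
      proof (cases "has_empty A")
        case True
        have "card A \<le> Suc (card B)" using y fin by (auto simp: card_insert_if card_Diff_singleton_if)
        then show ?thesis using A(3)[OF True] by simp
      next
        case False
        have "A \<subseteq> insert y B" using y by blast
        obtain c i0 where c: "sweep c" "B = fill c i0 (card B)" "K \<le> card B" "card B \<le> K * (L - 1)"
          using full_and_empty_column_fill[OF assms(2) pc mc] by blast
        have n: "card B \<le> K * L" using c(4) by (rule order_trans) simp
        have "(L - 2) * K + 1 \<le> card B"
        proof (rule ccontr)
          assume "\<not> (L - 2) * K + 1 \<le> card B"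
          then have le: "card B \<le> (L - 2) * K" by simp
          have le': "card B \<le> (L - 1) * K" using c(4) by (simp add: mult.commute)
          have m: "empty_col B (c (L - 2))" "empty_col B (c (L - 1))"
            using empty_col_fill[OF c(1) n _ le, of i0] empty_col_fill[OF c(1) n _ le', of i0] Lpos c(2) by auto
          have "c (L - 2) \<noteq> c (L - 1)" using sweep_eq_iff[OF c(1), of "L - 2" "L - 1"] L4 by auto
          then obtain q where q: "q < L" "empty_col B q" "q \<noteq> snd y"
            using m sweep_less[OF c(1)] by metis
          then have "empty_col A q" using \<open>A \<subseteq> insert y B\<close> unfolding empty_col_def by auto
          then show False using False q(1) unfolding has_empty_def by blast
        qed
        then show ?thesis using assms(4) by simp
      qed
      then show ?thesis using True assms(2) pc mc by (auto simp: far_def)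
    qed
  qed
qed

section \<open>Minimal gates as families of vertex sets\<close>

text \<open>Removing \<open>W\<close> separates the ground states at the barrier level, and putting back any one member
  reconnects them through that member.\<close>

definition "mingate W \<longleftrightarrow>
  (\<forall>X\<in>W. X \<subseteq> V \<and> bd K L X = 2 * K + 2 \<and>
     joined (Lev - (W - {X})) {} X \<and> joined (Lev - (W - {X})) X V) \<and>
  \<not> joined (Lev - W) {} V"

text \<open>\<open>D\<close> is the far side of the gate. Arguing backwards from the full set avoids a description of the
  many shapes without a full column.\<close>

lemma mingateI:
  assumes "\<And>X. X \<in> W \<Longrightarrow> X \<subseteq> V \<and> bd K L X = 2 * K + 2"
    and "\<And>X. X \<in> W \<Longrightarrow> joined (Lev - (W - {X})) {} X"
    and "\<And>X. X \<in> W \<Longrightarrow> joined (Lev - (W - {X})) X V"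
    and "V \<in> D" "{} \<notin> D"
    and "\<And>X Y. X \<in> D \<Longrightarrow> X \<in> Lev \<Longrightarrow> Y \<in> Lev \<Longrightarrow> near X Y \<Longrightarrow> Y \<notin> W \<Longrightarrow> Y \<in> D"
  shows "mingate W"
proof -
  have "\<not> joined (Lev - W) {} V"
  proof
    assume "joined (Lev - W) {} V"
    then have "joined (Lev - W) V {}" by (rule joined_sym)
    then have "{} \<in> D" using assms(4) by (rule joined_closed) (use assms(6) in blast)
    then show False using assms(5) by blast
  qed
  then show ?thesis unfolding mingate_def using assms(1-3) by blast
qed

lemma fill_path:
  assumes "sweep c" "n \<le> K * L" "\<And>k. k \<le> K * L \<Longrightarrow> k \<noteq> n \<Longrightarrow> fill c i0 k \<notin> W"
  shows "joined (Lev - (W - {fill c i0 n})) {} (fill c i0 n)"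
    "joined (Lev - (W - {fill c i0 n})) (fill c i0 n) V"
proof -
  have U: "fill c i0 k \<in> Lev - (W - {fill c i0 n})" if "k \<le> K * L" for k
    using fill_Lev[OF assms(1) that] assms(3)[OF that] by (cases "k = n") auto
  show "joined (Lev - (W - {fill c i0 n})) {} (fill c i0 n)"
    using fill_joined[of 0 n c i0, OF _ U] assms(2) by simp
  have "joined (Lev - (W - {fill c i0 n})) (fill c i0 n) (fill c i0 (K * L))"
    using fill_joined[of n "K * L" c i0, OF assms(2) U] by simp
  then show "joined (Lev - (W - {fill c i0 n})) (fill c i0 n) V"
    unfolding fill_all[OF assms(1)] .
qed

text \<open>The size bounds ensure that neither end of the crossing bypasses the sets of size
  \<open>a * K + h\<close>: a path enters the sets with a full and an empty column at a size of at most \<open>2 K - 1\<close>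
  and leaves them at a size of at least \<open>(L - 2) K + 1\<close>.\<close>

lemma mingate_band_bar:
  assumes "1 \<le> a" "a + 2 \<le> L" "1 \<le> h" "h < K"
    and N: "2 * K - 1 \<le> a * K + h" "a * K + h \<le> (L - 2) * K + 1"
  shows "mingate (Bset h a K)"
proof (rule mingateI[where D = "far (a * K + h)"])
  fix X assume X: "X \<in> Bset h a K"
  note XD = Bset_K_memD[OF X assms(3,4,1,2)]
  show "X \<subseteq> V \<and> bd K L X = 2 * K + 2" using XD by blast
  obtain c i0 where c: "sweep c" "X = fill c i0 (a * K + h)" using XD(6) by blast
  have n: "a * K + h \<le> K * L"
    using card_mono[OF finite_torus XD(1)] XD(5) by (simp add: card_torus)
  have "fill c i0 k \<notin> Bset h a K" if "k \<le> K * L" "k \<noteq> a * K + h" for k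
    using Bset_K_memD(5)[OF _ assms(3,4,1,2)] card_fill[OF c(1) that(1)] that(2) by metis
  from fill_path[OF c(1) n this]
  show "joined (Lev - (Bset h a K - {X})) {} X" "joined (Lev - (Bset h a K - {X})) X V"
    unfolding c(2) by auto
next
  show "V \<in> far (a * K + h)" by (rule V_far)
  show "{} \<notin> far (a * K + h)" using empty_not_plusside by (simp add: far_def)
next
  fix X Y assume *: "X \<in> far (a * K + h)" "X \<in> Lev" "Y \<in> Lev" "near X Y" "Y \<notin> Bset h a K"
  from far_step[OF *(1,3,4) N(2)] show "Y \<in> far (a * K + h)"
  proof (elim disjE)
    assume "has_full Y \<and> has_empty Y \<and> card Y = a * K + h"
    then have "Y \<in> Bset h a K" using Bset_K_memI[OF *(3)] assms(4) by blast
    then show ?thesis using *(5) by blast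
  next
    assume "\<exists>h'<K. has_full X \<and> has_empty X \<and> card X = K + h' \<and> a * K + h < K + h' \<and>
      (h' = 0 \<or> (1 \<le> h' \<and> h' \<le> K - 2 \<and> Y \<in> Bset h' 1 (K - 1)) \<or> (h' = K - 1 \<and> Y \<in> Rset 2 (K - 1)))"
    then obtain h' where "h' < K" "a * K + h < K + h'" by blast
    then show ?thesis using N(1) by simp
  qed
qed

lemma K_plus_le: "h \<le> K \<Longrightarrow> K + h \<le> (L - 2) * K" "h \<le> K \<Longrightarrow> K + h \<le> K * L"
proof -
  assume h: "h \<le> K"
  have "2 * K \<le> (L - 2) * K" using L4 by (intro mult_le_mono1) simp
  then show "K + h \<le> (L - 2) * K" using h by linarith
  also have "\<dots> \<le> L * K" by (intro mult_le_mono1) simp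
  finally show "K + h \<le> K * L" by (simp add: mult.commute)
qed

text \<open>A full column with a bar of length \<open>K - 1\<close> has two kinds of smaller admissible neighbours: either
  the bar loses an end, or the column loses the site beside the gap of the bar.\<close>

lemma mingate_two_columns:
  shows "mingate (Rset 2 (K - 1) \<union> Bset (K - 2) 1 K)"
proof (rule mingateI[where D = "far (2 * K - 2)"])
  let ?W = "Rset 2 (K - 1) \<union> Bset (K - 2) 1 K"
  have h: "1 \<le> K - 2" "K - 2 < K" "K - 2 \<le> K - 1" "K - 2 \<le> K" and a: "(1::nat) \<le> 1" "1 + 2 \<le> L"
    using K3 L4 by auto
  have e: "K + (K - 2) = 2 * K - 2" "1 * K + (K - 2) = 2 * K - 2" "K + (K - 1) = 2 * K - 1"
    using K3 by auto
  note BD = Bset_K_memD[OF _ h(1,2) a]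
  have cardW: "card X = 2 * K - 2" if "X \<in> ?W" for X
    using that Rset_memD(4) BD(5) unfolding e by blast
  fix X assume X: "X \<in> ?W"
  show "X \<subseteq> V \<and> bd K L X = 2 * K + 2" using X Rset_memD(1,2) BD(1,2) by blast
  have n: "2 * K - 2 \<le> K * L" "2 * K - 1 \<le> K * L" using K_plus_le(2)[of K] by auto
  have "joined (Lev - (?W - {X})) {} X \<and> joined (Lev - (?W - {X})) X V"
  proof (cases "X \<in> Rset 2 (K - 1)")
    case False
    then obtain c i0 where c: "sweep c" "X = fill c i0 (2 * K - 2)" using X BD(6) unfolding e by blast
    have "fill c i0 k \<notin> ?W" if "k \<le> K * L" "k \<noteq> 2 * K - 2" for k
      using cardW card_fill[OF c(1) that(1)] that(2) by metis
    from fill_path[OF c(1) n(1) this] show ?thesis unfolding c(2) by blast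
  next
    case True
    note RD = Rset_memD[OF True]
    have XU: "X \<in> Lev - (?W - {X})" using RD(1,2) by (simp add: Lev_def)
    obtain Z where Z: "Z \<in> Bset (K - 2) 1 (K - 1)" "near Z X" using RD(6) by blast
    note ZD = Bset_low_memD[OF Z(1) h(1,3)]
    have ZW: "Z \<notin> ?W"
    proof
      assume "Z \<in> ?W"
      then show False using cardW ZD(4) K3 by fastforce
    qed
    have "insert Z Non \<subseteq> Lev - (?W - {X})"
    proof
      fix Y assume "Y \<in> insert Z Non"
      then show "Y \<in> Lev - (?W - {X})"
      proof
        assume "Y = Z"
        then show ?thesis using ZW ZD(1,2) by (simp add: Lev_def)
      next
        assume Y: "Y \<in> Non"
        then have "Y \<notin> ?W" using Rset_memD(2)[of Y] BD(2)[of Y] by (auto simp: Non_def)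
        then show ?thesis using Y Non_Lev by blast
      qed
    qed
    then have "joined (Lev - (?W - {X})) {} Z"
      by (rule joined_mono[OF low_link[OF Z(1) h(1) le_refl]])
    moreover have "joined (Lev - (?W - {X})) Z X"
      by (rule joined_step[OF _ XU Z(2)]) (use ZW ZD(1,2) in \<open>simp add: Lev_def\<close>)
    ultimately have down: "joined (Lev - (?W - {X})) {} X" by (rule joined_trans)
    obtain v c i0 where c: "sweep c" "insert v X = fill c i0 (2 * K - 1)" using RD(5) by blast
    have U: "fill c i0 k \<in> Lev - (?W - {X})" if "2 * K - 1 \<le> k" "k \<le> K * L" for k
    proof -
      have "card (fill c i0 k) \<noteq> 2 * K - 2" using card_fill[OF c(1) that(2)] that(1) K3 by simp
      then show ?thesis using cardW fill_Lev[OF c(1) that(2)] by blast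
    qed
    have "near X (fill c i0 (2 * K - 1))" unfolding c(2)[symmetric] near_def by blast
    then have "joined (Lev - (?W - {X})) X (fill c i0 (2 * K - 1))"
      using XU U[OF le_refl n(2)] by (intro joined_step)
    moreover have "joined (Lev - (?W - {X})) (fill c i0 (2 * K - 1)) V"
      using fill_joined[of "2 * K - 1" "K * L" c i0, OF n(2) U] unfolding fill_all[OF c(1)] .
    ultimately have "joined (Lev - (?W - {X})) X V" by (rule joined_trans)
    then show ?thesis using down by blast
  qed
  then show "joined (Lev - (?W - {X})) {} X" "joined (Lev - (?W - {X})) X V" by auto
next
  let ?W = "Rset 2 (K - 1) \<union> Bset (K - 2) 1 K"
  show "V \<in> far (2 * K - 2)" by (rule V_far)
  show "{} \<notin> far (2 * K - 2)" using empty_not_plusside by (simp add: far_def)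
  fix X Y assume *: "X \<in> far (2 * K - 2)" "X \<in> Lev" "Y \<in> Lev" "near X Y" "Y \<notin> ?W"
  have N: "2 * K - 2 \<le> (L - 2) * K + 1" using K_plus_le(1)[of K] by simp
  from far_step[OF *(1,3,4) N] show "Y \<in> far (2 * K - 2)"
  proof (elim disjE)
    assume Y: "has_full Y \<and> has_empty Y \<and> card Y = 2 * K - 2"
    then have "card Y = 1 * K + (K - 2)" using K3 by simp
    then have "Y \<in> Bset (K - 2) 1 K" using Bset_K_memI[OF *(3)] Y K3 by simp
    then show ?thesis using *(5) by blast
  next
    assume "\<exists>h'<K. has_full X \<and> has_empty X \<and> card X = K + h' \<and> 2 * K - 2 < K + h' \<and>
      (h' = 0 \<or> (1 \<le> h' \<and> h' \<le> K - 2 \<and> Y \<in> Bset h' 1 (K - 1)) \<or> (h' = K - 1 \<and> Y \<in> Rset 2 (K - 1)))"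
    then show ?thesis using *(5) K3 by auto
  qed
qed

text \<open>Here \<open>Rset 2 (K - 1)\<close> belongs to the far side: its neighbours on the near side have the shape
  \<open>Bset (K - 2) 1 (K - 1)\<close>, which is in the gate. The path through \<open>X\<close> of shape
  \<open>Bset g 1 (K - 1)\<close> stays strictly below the barrier before \<open>X\<close> and completes the full column
  right after it.\<close>

lemma mingate_wide_bars:
  assumes "1 \<le> i" "i + 3 \<le> K"
  shows "mingate (Bset i 1 K \<union> (\<Union>h\<in>{i+1..K-2}. Bset h 1 (K - 1)))"
proof (rule mingateI[where D = "far (K + i) \<union> Rset 2 (K - 1)"])
  let ?W = "Bset i 1 K \<union> (\<Union>h\<in>{i+1..K-2}. Bset h 1 (K - 1))"
  have h: "i < K" and a: "(1::nat) \<le> 1" "1 + 2 \<le> L" and n: "K + i \<le> K * L"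
    using assms L4 K_plus_le(2)[of i] by auto
  note BD = Bset_K_memD[OF _ assms(1) h a]
  have low: "X \<subseteq> V" "bd K L X = 2 * K + 2" "\<not> has_full X"
    "\<exists>v c i0. sweep c \<and> insert v X = fill c i0 (K + g)" "joined (insert X Non) {} X"
    if "X \<in> Bset g 1 (K - 1)" "i + 1 \<le> g" "g \<le> K - 2" for X g
  proof -
    have "1 \<le> g" "g \<le> K - 1" using that by auto
    note LD = Bset_low_memD[OF that(1) this]
    show "X \<subseteq> V" "bd K L X = 2 * K + 2" "\<not> has_full X"
      "\<exists>v c i0. sweep c \<and> insert v X = fill c i0 (K + g)" using LD by blast+
    show "joined (insert X Non) {} X" by (rule low_link[OF that(1) \<open>1 \<le> g\<close> that(3)])
  qed
  have bdW: "X \<subseteq> V \<and> bd K L X = 2 * K + 2" if X: "X \<in> ?W" for X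
  proof -
    consider "X \<in> Bset i 1 K" | g where "X \<in> Bset g 1 (K - 1)" "i + 1 \<le> g" "g \<le> K - 2"
      using X by auto
    then show ?thesis by cases (use BD(1,2) low(1,2) in blast)+
  qed
  have pcW: "card X = K + i" if X: "X \<in> ?W" "has_full X" for X
  proof -
    consider "X \<in> Bset i 1 K" | g where "X \<in> Bset g 1 (K - 1)" "i + 1 \<le> g" "g \<le> K - 2"
      using X(1) by auto
    then show ?thesis by cases (use BD(5) low(3) X(2) in auto)
  qed
  have fillW: "fill c i0 k \<notin> ?W" if "sweep c" "k \<le> K * L" "k \<noteq> K + i" for c i0 k
  proof (cases "k \<le> K")
    case True
    then have "bd K L (fill c i0 k) \<noteq> 2 * K + 2" using bd_fill_column[OF that(1) True, of i0] by simp
    then show ?thesis using bdW by blast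
  next
    case False
    then have "has_full (fill c i0 k)" using has_full_fill[OF that(1,2)] by simp
    then show ?thesis using pcW card_fill[OF that(1,2)] that(3) by metis
  qed
  fix X assume X: "X \<in> ?W"
  show "X \<subseteq> V \<and> bd K L X = 2 * K + 2" by (rule bdW[OF X])
  have "joined (Lev - (?W - {X})) {} X \<and> joined (Lev - (?W - {X})) X V"
  proof (cases "X \<in> Bset i 1 K")
    case True
    then obtain c i0 where c: "sweep c" "X = fill c i0 (K + i)" using BD(6) unfolding mult_1 by blast
    from fill_path[OF c(1) n fillW[OF c(1)]] show ?thesis unfolding c(2) by blast
  next
    case False
    then obtain g where g: "X \<in> Bset g 1 (K - 1)" "i + 1 \<le> g" "g \<le> K - 2" using X by auto
    have XU: "X \<in> Lev - (?W - {X})" using low(1,2)[OF g] by (simp add: Lev_def)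
    have "insert X Non \<subseteq> Lev - (?W - {X})"
    proof
      fix Y assume "Y \<in> insert X Non"
      then show "Y \<in> Lev - (?W - {X})"
      proof
        assume Y: "Y \<in> Non"
        then have "Y \<notin> ?W" using bdW[of Y] unfolding Non_def mem_Collect_eq by linarith
        then show ?thesis using subsetD[OF Non_Lev Y] by (simp only: Diff_iff) blast
      qed (simp only: XU)
    qed
    then have down: "joined (Lev - (?W - {X})) {} X" by (rule joined_mono[OF low(5)[OF g]])
    obtain v c i0 where c: "sweep c" "insert v X = fill c i0 (K + g)" using low(4)[OF g] by blast
    have gK: "K + g \<le> K * L" using K_plus_le(2)[of g] g(3) by simp
    have U: "fill c i0 k \<in> Lev - (?W - {X})" if "K + g \<le> k" "k \<le> K * L" for k
      using fillW[OF c(1) that(2)] fill_Lev[OF c(1) that(2)] that(1) g(2) by auto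
    have "near X (fill c i0 (K + g))" unfolding c(2)[symmetric] near_def by blast
    then have "joined (Lev - (?W - {X})) X (fill c i0 (K + g))"
      using XU U[OF le_refl gK] by (intro joined_step)
    moreover have "joined (Lev - (?W - {X})) (fill c i0 (K + g)) V"
      using fill_joined[of "K + g" "K * L" c i0, OF gK U] unfolding fill_all[OF c(1)] .
    ultimately have "joined (Lev - (?W - {X})) X V" by (rule joined_trans)
    then show ?thesis using down by blast
  qed
  then show "joined (Lev - (?W - {X})) {} X" "joined (Lev - (?W - {X})) X V" by auto
next
  let ?W = "Bset i 1 K \<union> (\<Union>h\<in>{i+1..K-2}. Bset h 1 (K - 1))"
  show "V \<in> far (K + i) \<union> Rset 2 (K - 1)" using V_far by blast
  have "{} \<notin> Rset 2 (K - 1)" using Rset_memD(4)[of "{}"] K3 by auto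
  then show "{} \<notin> far (K + i) \<union> Rset 2 (K - 1)" using empty_not_plusside by (simp add: far_def)
  fix X Y assume *: "X \<in> far (K + i) \<union> Rset 2 (K - 1)" "X \<in> Lev" "Y \<in> Lev" "near X Y" "Y \<notin> ?W"
  have N: "K + i \<le> (L - 2) * K + 1" using K_plus_le(1)[of i] assms by simp
  from *(1) show "Y \<in> far (K + i) \<union> Rset 2 (K - 1)"
  proof
    assume X: "X \<in> far (K + i)"
    from far_step[OF X *(3,4) N] show ?thesis
    proof (elim disjE)
      assume Y: "has_full Y \<and> has_empty Y \<and> card Y = K + i"
      then have "Y \<in> Bset i 1 K" using Bset_K_memI[OF *(3), of 1 i] assms by simp
      then show ?thesis using *(5) by blast
    next
      assume "\<exists>h'<K. has_full X \<and> has_empty X \<and> card X = K + h' \<and> K + i < K + h' \<and>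
        (h' = 0 \<or> (1 \<le> h' \<and> h' \<le> K - 2 \<and> Y \<in> Bset h' 1 (K - 1)) \<or> (h' = K - 1 \<and> Y \<in> Rset 2 (K - 1)))"
      then obtain h' where h': "i < h'"
        "h' = 0 \<or> (1 \<le> h' \<and> h' \<le> K - 2 \<and> Y \<in> Bset h' 1 (K - 1)) \<or> (h' = K - 1 \<and> Y \<in> Rset 2 (K - 1))"
        by auto
      then show ?thesis using *(5) by auto
    qed blast
  next
    assume X: "X \<in> Rset 2 (K - 1)"
    from Rset_near[OF X *(4,3)] show ?thesis
    proof (elim disjE)
      assume "Y \<in> Bset (K - 2) 1 (K - 1)"
      moreover have "K - 2 \<in> {i+1..K-2}" using assms by simp
      ultimately have "Y \<in> ?W" by blast
      then show ?thesis using *(5) by blast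
    next
      assume Y: "has_full Y \<and> has_empty Y \<and> card Y = 2 * K - 1"
      then have "K + i < card Y" using assms by linarith
      then show ?thesis using *(3) Y by (simp add: far_def plusside_def)
    qed (use X in blast)
  qed
qed


section \<open>Exchanging the two spins\<close>

lemma near_compl:
  assumes "near A B" "A \<subseteq> V"
  shows "near (V - A) (V - B)"
proof -
  obtain v where "B = insert v A \<or> B = A - {v}" using assms(1) unfolding near_def by blast
  then consider "V - B = (V - A) - {v}" | "V - B = insert v (V - A)" | "B = A"
    using assms(2) by (cases "v \<in> A") auto
  then show ?thesis
  proof cases
    case 1
    then show ?thesis unfolding near_def by blast
  next
    case 2
    then show ?thesis unfolding near_def by blast
  next
    case 3
    then show ?thesis using near_refl by simp
  qed
qed

lemma joined_compl:
  assumes "joined U A B" "U \<subseteq> Pow V"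
  shows "joined ((\<lambda>X. V - X) ` U) (V - A) (V - B)"
  using assms(1) unfolding joined_def[of U]
proof (induction rule: rtranclp_induct)
  case (step Y Z)
  have "joined ((\<lambda>X. V - X) ` U) (V - Y) (V - Z)"
    using step.hyps(2) near_compl[of Y Z] assms(2) by (intro joined_step) auto
  with step.IH show ?case by (rule joined_trans)
qed simp

lemma compl_compl: "A \<subseteq> V \<Longrightarrow> V - (V - A) = A" by blast

lemma Lev_compl: "A \<in> Lev \<Longrightarrow> V - A \<in> Lev"
  by (simp add: Lev_def bd_compl)

lemma Non_compl: "A \<in> Non \<Longrightarrow> V - A \<in> Non"
  by (simp add: Non_def bd_compl)

lemma has_full_compl: "has_full (V - A) \<longleftrightarrow> has_empty A"
  unfolding has_full_def has_empty_def full_col_def empty_col_def using mem_V by blast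

lemma has_empty_compl: "has_empty (V - A) \<longleftrightarrow> has_full A"
  unfolding has_full_def has_empty_def full_col_def empty_col_def using mem_V by blast

lemma card_compl: "A \<subseteq> V \<Longrightarrow> card (V - A) = K * L - card A"
  using card_Diff_subset[of A V] finite_subset[OF _ finite_torus] by (simp add: card_torus)

lemma mingate_compl:
  assumes "mingate W"
  shows "mingate ((\<lambda>X. V - X) ` W)"
proof -
  let ?c = "\<lambda>X. V - X"
  have W: "X \<subseteq> V" "bd K L X = 2 * K + 2" "joined (Lev - (W - {X})) {} X" "joined (Lev - (W - {X})) X V"
    if "X \<in> W" for X using assms that unfolding mingate_def by blast+
  have LevV: "Lev \<subseteq> Pow V" by (auto simp: Lev_def)
  have img: "?c ` (Lev - T) = Lev - ?c ` T" if "T \<subseteq> Pow V" for T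
  proof (intro equalityI subsetI)
    fix Y assume "Y \<in> ?c ` (Lev - T)"
    then obtain X where X: "X \<in> Lev" "X \<notin> T" "Y = V - X" by blast
    have "Y \<notin> ?c ` T"
    proof
      assume "Y \<in> ?c ` T"
      then obtain Z where "Z \<in> T" "V - X = V - Z" using X(3) by blast
      moreover have "X \<subseteq> V" "Z \<subseteq> V" using X(1) LevV \<open>Z \<in> T\<close> that by auto
      ultimately have "X = Z" using compl_compl by metis
      then show False using X(2) \<open>Z \<in> T\<close> by simp
    qed
    then show "Y \<in> Lev - ?c ` T" using Lev_compl X(1,3) by simp
  next
    fix Y assume Y: "Y \<in> Lev - ?c ` T"
    then have "V - (V - Y) = Y" using LevV by (intro compl_compl) auto
    moreover have "V - Y \<notin> T"
    proof
      assume "V - Y \<in> T"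
      then have "V - (V - Y) \<in> ?c ` T" by (rule imageI)
      then show False using Y calculation by simp
    qed
    moreover have "V - Y \<in> Lev" using Y Lev_compl by simp
    ultimately show "Y \<in> ?c ` (Lev - T)" by (metis DiffI imageI)
  qed
  have WV: "W \<subseteq> Pow V" using W(1) by blast
  have J: "joined (Lev - ?c ` T) (V - A) (V - B)" if "joined (Lev - T) A B" "T \<subseteq> Pow V" for A B T
    using joined_compl[OF that(1)] LevV img[OF that(2)] by auto
  have "Y \<subseteq> V \<and> bd K L Y = 2 * K + 2 \<and> joined (Lev - (?c ` W - {Y})) {} Y \<and>
      joined (Lev - (?c ` W - {Y})) Y V" if Y: "Y \<in> ?c ` W" for Y
  proof -
    obtain X where X: "X \<in> W" "Y = V - X" using Y by blast
    have sub: "W - {X} \<subseteq> Pow V" using WV by blast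
    have inj: "?c ` (W - {X}) = ?c ` W - {Y}"
    proof -
      have "inj_on ?c (Pow V)" by (rule inj_on_inverseI[where g = ?c]) auto
      then have "inj_on ?c W" using WV by (rule inj_on_subset)
      then show ?thesis using X by (simp add: inj_on_image_set_diff)
    qed
    have "joined (Lev - (?c ` W - {Y})) (V - V) Y"
      using joined_sym[OF J[OF W(4)[OF X(1)] sub]] unfolding inj X(2)[symmetric] .
    moreover have "joined (Lev - (?c ` W - {Y})) Y (V - {})"
      using joined_sym[OF J[OF W(3)[OF X(1)] sub]] unfolding inj X(2)[symmetric] .
    ultimately show ?thesis using X W(2) bd_compl by auto
  qed
  moreover have "\<not> joined (Lev - ?c ` W) {} V"
  proof
    assume *: "joined (Lev - ?c ` W) {} V"
    have "?c ` W \<subseteq> Pow V" by blast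
    from J[OF * this] have "joined (Lev - ?c ` ?c ` W) V {}" by simp
    moreover have "?c ` ?c ` W = W"
    proof -
      have "?c ` ?c ` W = (\<lambda>X. X) ` W" unfolding image_image
        using WV compl_compl by (intro image_cong) auto
      then show ?thesis by simp
    qed
    ultimately have "joined (Lev - W) {} V" using joined_sym by simp
    then show False using assms unfolding mingate_def by blast
  qed
  ultimately show ?thesis unfolding mingate_def by blast
qed

section \<open>Avoiding the inessential saddles\<close>

text \<open>The gates near the empty set; those near the full set are their images under exchange of the
  spins.\<close>

definition "lowcore = Bset (K - 1) 1 K \<union> (Rset 2 (K - 1) \<union> Bset (K - 2) 1 K) \<union>
  (\<Union>i\<in>{1..K-3}. Bset i 1 K \<union> (\<Union>h\<in>{i+1..K-2}. Bset h 1 (K - 1)))"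

definition "core = (\<Union>a\<in>{2..L-3}. \<Union>h\<in>{1..K-1}. Bset h a K) \<union> lowcore \<union> (\<lambda>X. V - X) ` lowcore"

lemma lowcore_column: "1 \<le> h \<Longrightarrow> h < K \<Longrightarrow> Bset h 1 K \<subseteq> lowcore"
proof -
  assume "1 \<le> h" "h < K"
  then consider "h = K - 1" | "h = K - 2" | "h \<in> {1..K-3}" by fastforce
  then show ?thesis unfolding lowcore_def by cases blast+
qed

lemma lowcore_Rset: "Rset 2 (K - 1) \<subseteq> lowcore"
  unfolding lowcore_def by blast

lemma lowcore_bar: "2 \<le> h \<Longrightarrow> h \<le> K - 2 \<Longrightarrow> Bset h 1 (K - 1) \<subseteq> lowcore"
proof -
  assume "2 \<le> h" "h \<le> K - 2"
  then have "1 \<in> {1..K-3}" "h \<in> {1+1..K-2}" by auto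
  then show ?thesis unfolding lowcore_def by blast
qed

lemma rect_subset: "rect K L i j a b \<subseteq> V"
  unfolding rect_eq torus_def lessThan_atLeast0[symmetric]
  by (intro Sigma_mono arc_subset Kpos Lpos)

lemma Bset_subset: "X \<in> Bset h a b \<Longrightarrow> X \<subseteq> V"
  unfolding Bset_def by (auto dest: subsetD[OF rect_subset])

lemma Rset_subset: "X \<in> Rset a b \<Longrightarrow> X \<subseteq> V"
  unfolding Rset_def by (auto dest: subsetD[OF rect_subset])

lemma lowcore_subset: "X \<in> lowcore \<Longrightarrow> X \<subseteq> V"
proof -
  assume "X \<in> lowcore"
  then consider h a b where "X \<in> Bset h a b" | a b where "X \<in> Rset a b"
    unfolding lowcore_def by blast
  then show ?thesis by cases (rule Bset_subset Rset_subset; assumption)+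
qed

lemma Bset_compl:
  assumes "X \<in> Bset h a K" "1 \<le> h" "h < K" "1 \<le> a" "a + 2 \<le> L"
  shows "V - X \<in> Bset (K - h) (L - 1 - a) K"
proof -
  note D = Bset_K_memD[OF assms]
  have "V - X \<in> Lev" using D(1,2) by (intro Lev_compl) (simp add: Lev_def)
  moreover have "card (V - X) = (L - 1 - a) * K + (K - h)"
  proof -
    obtain m where m: "L = m + a + 2" using assms(5) le_Suc_ex by (metis add.assoc add.commute)
    have "K * L = (L - 1 - a) * K + K + a * K" unfolding m by (simp add: algebra_simps)
    then show ?thesis using card_compl[OF D(1)] D(5) assms(3) by simp
  qed
  ultimately show ?thesis
    using Bset_K_memI[of "V - X" "L - 1 - a" "K - h"] D(3,4) has_full_compl has_empty_compl assms(2) Kpos by simp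
qed

lemma core_compl: "X \<in> core \<Longrightarrow> V - X \<in> core"
proof -
  assume "X \<in> core"
  then consider a h where "2 \<le> a" "a \<le> L - 3" "1 \<le> h" "h \<le> K - 1" "X \<in> Bset h a K"
    | "X \<in> lowcore" | Y where "Y \<in> lowcore" "X = V - Y"
    unfolding core_def by auto
  then show ?thesis
  proof cases
    case (1 a h)
    have "V - X \<in> Bset (K - h) (L - 1 - a) K" by (rule Bset_compl) (use 1 Kpos in auto)
    moreover have "L - 1 - a \<in> {2..L-3}" "K - h \<in> {1..K-1}" using 1 Kpos by auto
    ultimately show ?thesis unfolding core_def by blast
  next
    case 2
    then show ?thesis unfolding core_def by blast
  next
    case (3 Y)
    then have "V - X = Y" using lowcore_subset compl_compl by simp
    then show ?thesis using 3 unfolding core_def by blast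
  qed
qed

text \<open>A saddle of this kind is a band of \<open>a\<close> columns with a proper bar, as a bare band has lower
  energy. For \<open>a = 1\<close> it is in one of the gates near the empty set; for \<open>a = L - 2\<close> exchanging the
  spins leads back to \<open>a = 1\<close>.\<close>

lemma middle_saddles_core:
  assumes "X \<in> Lev" "bd K L X = 2 * K + 2" "has_full X" "has_empty X"
  shows "X \<in> core"
proof -
  obtain c i0 where c: "sweep c" "X = fill c i0 (card X)" "K \<le> card X" "card X \<le> K * (L - 1)"
    using full_and_empty_column_fill assms(1,3,4) by blast
  have n: "card X \<le> K * L" using c(4) by (rule order_trans) simp
  define a h where "a = card X div K" and "h = card X mod K"
  have ah: "card X = a * K + h" "h < K" using Kpos by (auto simp: a_def h_def)
  have "h \<noteq> 0" using bd_fill_band[OF c(1) n, of i0] c(2) assms(2) unfolding h_def by fastforce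
  have XB: "X \<in> Bset h a K" by (rule Bset_K_memI[OF assms(1,3,4) ah])
  have a1: "1 \<le> a" using c(3) Kpos unfolding a_def by (simp add: Suc_le_eq div_greater_zero_iff)
  have "a < L - 1"
  proof (rule ccontr)
    assume "\<not> a < L - 1"
    then have "(L - 1) * K \<le> a * K" by (intro mult_le_mono1) simp
    then show False using c(4) ah(1) \<open>h \<noteq> 0\<close> unfolding mult.commute[of K] by linarith
  qed
  then have a2: "a + 2 \<le> L" by simp
  have h1: "1 \<le> h" using \<open>h \<noteq> 0\<close> by simp
  consider "a = 1" | "a \<in> {2..L-3}" | "a = L - 2" using a1 a2 by fastforce
  then show ?thesis
  proof cases
    case 1
    then show ?thesis using lowcore_column[OF h1 ah(2)] XB unfolding core_def by blast
  next
    case 2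
    have "h \<in> {1..K-1}" using h1 ah(2) by auto
    with 2 show ?thesis using XB unfolding core_def by blast
  next
    case 3
    have "V - X \<in> Bset (K - h) (L - 1 - a) K" by (rule Bset_compl[OF XB h1 ah(2) a1 a2])
    moreover have "L - 1 - a = 1" using 3 L4 by simp
    moreover have "1 \<le> K - h" "K - h < K" using h1 ah(2) by linarith+
    ultimately have "V - X \<in> lowcore" using lowcore_column[of "K - h"] by auto
    moreover have "V - (V - X) = X" using assms(1) by (intro compl_compl) (simp add: Lev_def)
    ultimately show ?thesis unfolding core_def by (metis UnCI imageI)
  qed
qed

definition "farend = {X. plusside X \<and> \<not> has_empty X}"

text \<open>The path is cut at its last move from the near side, from \<open>A\<close> to \<open>B\<close>. If \<open>A\<close> belongs to
  \<open>core\<close>, it can be reached with no saddle before it; otherwise \<open>B\<close> has at most one site outside its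
  full column and can itself be reached with no saddle before it. The induction runs backwards from
  the full set and thus finds the last such move. On the far side, saddles with an empty column are
  in \<open>core\<close>; the others, collected in \<open>farend\<close>, are left to the same argument for exchanged
  spins.\<close>

lemma reroute_start:
  assumes "4 \<le> K" "S \<subseteq> {X \<in> Lev. bd K L X = 2 * K + 2}" "joined (Non \<union> S) {} V"
  shows "joined (Non \<union> (S \<inter> (core \<union> farend))) {} V"
proof -
  define U where "U = Non \<union> S"
  define U' where "U' = Non \<union> (S \<inter> (core \<union> farend))"
  define D where "D = {X. plusside X} \<union> Rset 2 (K - 1)"
  have ULev: "X \<in> Lev" if "X \<in> U" for X using that Non_Lev assms(2) unfolding U_def by blast
  have NonU': "Non \<subseteq> U'" unfolding U'_def by blast
  have coreU': "X \<in> U'" if "X \<in> U" "X \<in> core \<union> farend" for X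
    using that unfolding U_def U'_def by blast
  have keep: "X \<in> U'" if X: "X \<in> U" "X \<in> D" for X
  proof (cases "X \<in> Non")
    case True
    then show ?thesis using NonU' by blast
  next
    case False
    then have XS: "X \<in> Lev" "bd K L X = 2 * K + 2" using X(1) assms(2) unfolding U_def by blast+
    consider "X \<in> Rset 2 (K - 1)" | "plusside X" "\<not> has_empty X" | "plusside X" "has_empty X"
      using X(2) unfolding D_def by blast
    then have "X \<in> core \<union> farend"
    proof cases
      case 1
      then show ?thesis using lowcore_Rset unfolding core_def by blast
    next
      case 2
      then show ?thesis unfolding farend_def by blast
    next
      case 3
      then have "has_full X" using band_not_has_empty unfolding plusside_def by blast
      then show ?thesis using middle_saddles_core[OF XS] 3(2) by blast
    qed
    then show ?thesis by (rule coreU'[OF X(1)])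
  qed
  have via: "joined U' {} V"
    if A: "A \<in> U" "A \<in> Bset h 1 (K - 1)" "2 \<le> h" "h \<le> K - 2"
      and B: "B \<in> U'" "near A B" "joined U' B V" for A B h
  proof -
    have AU: "A \<in> U'" using coreU'[OF A(1)] lowcore_bar[OF A(3,4)] A(2) unfolding core_def by blast
    have "1 \<le> h" using A(3) by simp
    have "insert A Non \<subseteq> U'" using AU NonU' by blast
    then have "joined U' {} A" by (rule joined_mono[OF low_link[OF A(2) \<open>1 \<le> h\<close> A(4)]])
    moreover have "joined U' A B" by (rule joined_step[OF AU B(1,2)])
    ultimately show ?thesis using B(3) joined_trans by blast
  qed
  have "joined U' {} V \<or> (A \<in> D \<and> joined U' A V)" if "joined U A V" for A
    using that unfolding joined_def[of U]
  proof (induction rule: converse_rtranclp_induct)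
    case base
    then show ?case using V_far[of 0] by (simp add: D_def far_def)
  next
    case (step A B)
    have AB: "A \<in> U" "B \<in> U" "near A B" "near B A" using step.hyps(1) near_sym by blast+
    show ?case
    proof (cases "joined U' {} V")
      case False
      then have B: "B \<in> D" "joined U' B V" using step.IH by blast+
      have BU: "B \<in> U'" by (rule keep[OF AB(2) B(1)])
      show ?thesis
      proof (cases "A \<in> D")
        case True
        have "joined U' A B" by (rule joined_step[OF keep[OF AB(1) True] BU AB(3)])
        then show ?thesis using True B(2) joined_trans by blast
      next
        case AD: False
        then have nA: "\<not> plusside A" "A \<notin> Rset 2 (K - 1)" unfolding D_def by blast+
        show ?thesis
        proof (cases "plusside B")
          case False
          then have BR: "B \<in> Rset 2 (K - 1)" using B(1) unfolding D_def by blast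
          have "A \<in> Bset (K - 2) 1 (K - 1)"
            using Rset_near[OF BR AB(4) ULev[OF AB(1)]] nA BR unfolding plusside_def by blast
          \<comment> \<open>for \<open>K = 3\<close> the bar would have length one, and this shape would not belong to \<open>core\<close>\<close>
          moreover have "2 \<le> K - 2" using assms(1) by simp
          ultimately show ?thesis using via[OF AB(1) _ _ le_refl BU AB(3) B(2)] by blast
        next
          case True
          obtain y where y: "has_full B" "has_empty B" "A = B - {y}"
            using plusside_exit[OF ULev[OF AB(2)] True ULev[OF AB(1)] nA(1) AB(4)] by blast
          have "\<not> has_full A" using nA(1) unfolding plusside_def by blast
          from lose_full_column[OF ULev[OF AB(2)] y(1,2,3) ULev[OF AB(1)] this]
          obtain h where h: "h < K" "card B = K + h"
            "h = 0 \<or> (1 \<le> h \<and> h \<le> K - 2 \<and> A \<in> Bset h 1 (K - 1)) \<or> (h = K - 1 \<and> A \<in> Rset 2 (K - 1))"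
            by blast
          have small: "joined U' {} B" if "h \<le> 1"
          proof -
            obtain c i0 where c: "sweep c" "B = fill c i0 (K + h)"
              using full_and_empty_column_fill[OF ULev[OF AB(2)] y(1,2)] h(2) by metis
            have "fill c i0 k \<in> U'" if "k \<le> K + h" for k
            proof (cases "k \<le> K")
              case True
              then show ?thesis using fill_Non[OF c(1)] NonU' by blast
            next
              case False
              then have "k = K + h" using that \<open>h \<le> 1\<close> by simp
              then show ?thesis using BU c(2) by simp
            qed
            then show ?thesis using fill_joined[of 0 "K + h" c i0 U'] c(2) by simp
          qed
          consider "h \<le> 1" | "2 \<le> h" "h \<le> K - 2" "A \<in> Bset h 1 (K - 1)"
            using h(3) nA(2) by fastforce
          then show ?thesis
          proof cases
            case 1
            then show ?thesis using small B(2) joined_trans by blast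
          next
            case 2
            then show ?thesis using via[OF AB(1) 2(3,1,2) BU AB(3) B(2)] by blast
          qed
        qed
      qed
    qed blast
  qed
  from this[of "{}"] have "joined U' {} V \<or> {} \<in> D" using assms(3) unfolding U_def by blast
  moreover have "{} \<notin> D"
    using empty_not_plusside Rset_memD(4)[of "{}"] K3 unfolding D_def by auto
  ultimately show ?thesis unfolding U'_def by blast
qed

lemma farend_compl:
  assumes "Y \<in> farend"
  shows "V - Y \<notin> farend"
proof
  assume "V - Y \<in> farend"
  then have "\<not> has_full Y" "\<not> has_full (V - Y)" "plusside (V - Y)" "plusside Y"
    using assms has_full_compl has_empty_compl unfolding farend_def by auto
  then obtain r r' where r: "Y = band r" "V - Y = band r'" unfolding plusside_def by blast
  obtain p where p: "p < K" "p \<noteq> r" "p \<noteq> r'" using two_other_rows[of r] by metis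
  have "(p, 0) \<in> Y" unfolding r(1) using p Lpos by (simp add: mem_band)
  moreover have "(p, 0) \<in> V - Y" unfolding r(2) using p Lpos by (simp add: mem_band)
  ultimately show False by blast
qed

text \<open>The start of the path is rerouted, then its end, by applying \<open>reroute_start\<close> to the path with
  exchanged spins. No saddle of \<open>farend\<close> survives both, by \<open>farend_compl\<close>.\<close>

lemma reroute:
  assumes "4 \<le> K" "S \<subseteq> {X \<in> Lev. bd K L X = 2 * K + 2}" "joined (Non \<union> S) {} V"
  shows "joined (Non \<union> (S \<inter> core)) {} V"
proof -
  let ?c = "\<lambda>X. V - X"
  define S1 where "S1 = S \<inter> (core \<union> farend)"
  have SV: "X \<subseteq> V" if "X \<in> S" for X using that assms(2) unfolding Lev_def by blast
  have "joined (Non \<union> S1) {} V" unfolding S1_def by (rule reroute_start[OF assms])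
  moreover have "Non \<union> S1 \<subseteq> Pow V" using SV unfolding S1_def Non_def by blast
  ultimately have "joined (?c ` (Non \<union> S1)) V {}" using joined_compl by force
  moreover have "?c ` (Non \<union> S1) \<subseteq> Non \<union> ?c ` S1" using Non_compl by blast
  ultimately have "joined (Non \<union> ?c ` S1) {} V" using joined_mono joined_sym by metis
  moreover have "?c ` S1 \<subseteq> {X \<in> Lev. bd K L X = 2 * K + 2}"
    using assms(2) Lev_compl bd_compl[of K L] unfolding S1_def by auto
  ultimately have "joined (Non \<union> (?c ` S1 \<inter> (core \<union> farend))) {} V"
    using reroute_start[OF assms(1)] by blast
  moreover have "Non \<union> (?c ` S1 \<inter> (core \<union> farend)) \<subseteq> Pow V" unfolding Non_def by blast
  ultimately have "joined (?c ` (Non \<union> (?c ` S1 \<inter> (core \<union> farend)))) V {}" using joined_compl by force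
  moreover have "?c ` (Non \<union> (?c ` S1 \<inter> (core \<union> farend))) \<subseteq> Non \<union> (S \<inter> core)"
  proof
    fix Y assume "Y \<in> ?c ` (Non \<union> (?c ` S1 \<inter> (core \<union> farend)))"
    then obtain Z where Z: "Z \<in> Non \<union> (?c ` S1 \<inter> (core \<union> farend))" "Y = V - Z" by blast
    show "Y \<in> Non \<union> (S \<inter> core)"
    proof (cases "Z \<in> Non")
      case True
      then show ?thesis using Non_compl Z(2) by blast
    next
      case False
      then obtain X where X: "X \<in> S1" "Z = V - X" "Z \<in> core \<union> farend" using Z(1) by blast
      have YX: "Y = X" unfolding Z(2) X(2) by (rule compl_compl[OF SV]) (use X(1) in \<open>simp add: S1_def\<close>)
      have "Y \<in> S" "Y \<in> core \<union> farend" using X(1) unfolding YX S1_def by blast+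
      moreover have "Y \<in> core" if "Z \<in> core" using core_compl[OF that] Z(2) by simp
      moreover have "Z \<notin> farend" if "Y \<in> farend" using farend_compl[OF that] X(2) YX by simp
      ultimately show ?thesis using X(3) by blast
    qed
  qed
  ultimately show ?thesis using joined_mono joined_sym by metis
qed

end

section \<open>Paths and minimal gates in energy landscapes\<close>

definition linked :: "('a \<Rightarrow> 'a \<Rightarrow> real) \<Rightarrow> 'a set \<Rightarrow> 'a \<Rightarrow> 'a \<Rightarrow> bool" where
  "linked Q U = (\<lambda>x y. x \<in> U \<and> y \<in> U \<and> Q x y > 0)\<^sup>*\<^sup>*"

lemma linked_snoc: "linked Q U x y \<Longrightarrow> y \<in> U \<Longrightarrow> z \<in> U \<Longrightarrow> Q y z > 0 \<Longrightarrow> linked Q U x z"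
  unfolding linked_def by (erule rtranclp.rtrancl_into_rtrancl) (intro conjI)

lemma Cons_in_paths:
  assumes "\<omega> \<in> paths X Q y z" "x \<in> X" "Q x y > 0"
  shows "x # \<omega> \<in> paths X Q x z"
proof -
  have \<omega>: "\<omega> \<noteq> []" "hd \<omega> = y" "\<And>i. Suc i < length \<omega> \<Longrightarrow> Q (\<omega> ! i) (\<omega> ! Suc i) > 0"
    using assms(1) by (auto simp: paths_def)
  have "Q ((x # \<omega>) ! i) ((x # \<omega>) ! Suc i) > 0" if "Suc i < length (x # \<omega>)" for i
  proof (cases i)
    case 0
    then show ?thesis using assms(3) \<omega>(1,2) by (simp add: hd_conv_nth)
  next
    case (Suc k)
    then show ?thesis using \<omega>(3)[of k] that by simp
  qed
  then show ?thesis using assms by (auto simp: paths_def)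
qed

lemma append_in_paths:
  assumes "\<omega> \<in> paths X Q x y" "\<omega>' \<in> paths X Q y z"
  shows "\<exists>\<eta>\<in>paths X Q x z. set \<eta> = set \<omega> \<union> set \<omega>'"
  using assms(1)
proof (induction \<omega> arbitrary: x)
  case Nil
  then show ?case by (simp add: paths_def)
next
  case (Cons a \<omega>)
  have a: "a = x" using Cons.prems by (simp add: paths_def)
  show ?case
  proof (cases "\<omega> = []")
    case True
    then have "x = y" using Cons.prems a by (simp add: paths_def)
    then have "set \<omega>' = set (a # \<omega>) \<union> set \<omega>'" using a True assms(2) hd_in_set[of \<omega>'] by (auto simp: paths_def)
    then show ?thesis using assms(2) \<open>x = y\<close> by blast
  next
    case False
    have nth: "Q ((a # \<omega>) ! i) ((a # \<omega>) ! Suc i) > 0" if "Suc i < length (a # \<omega>)" for i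
      using Cons.prems that unfolding paths_def by blast
    have "\<omega> \<in> paths X Q (hd \<omega>) y"
      using Cons.prems False nth[of "Suc _"] by (auto simp: paths_def)
    then obtain \<eta> where \<eta>: "\<eta> \<in> paths X Q (hd \<omega>) z" "set \<eta> = set \<omega> \<union> set \<omega>'" using Cons.IH by blast
    have "Q x (hd \<omega>) > 0" using nth[of 0] False a by (simp add: hd_conv_nth)
    moreover have "x \<in> X" using Cons.prems a by (simp add: paths_def)
    ultimately have "x # \<eta> \<in> paths X Q x z" using Cons_in_paths[OF \<eta>(1)] by blast
    moreover have "set (x # \<eta>) = set (a # \<omega>) \<union> set \<omega>'" using \<eta>(2) a by simp
    ultimately show ?thesis by blast
  qed
qed

lemma path_of_linked:
  assumes "linked Q U x y" "x \<in> U" "U \<subseteq> X"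
  shows "\<exists>\<omega>\<in>paths X Q x y. set \<omega> \<subseteq> U"
  using assms(1,2) unfolding linked_def
proof (induction rule: converse_rtranclp_induct)
  case base
  then have "[y] \<in> paths X Q y y" "set [y] \<subseteq> U" using assms(3) by (auto simp: paths_def)
  then show ?case by blast
next
  case (step x z)
  then obtain \<omega> where "\<omega> \<in> paths X Q z y" "set \<omega> \<subseteq> U" by blast
  then have "x # \<omega> \<in> paths X Q x y" "set (x # \<omega>) \<subseteq> U"
    using step.hyps(1) assms(3) Cons_in_paths[of \<omega> X Q z y x] by auto
  then show ?case by blast
qed

lemma linked_of_path:
  assumes "\<omega> \<in> paths X Q x y" "set \<omega> \<subseteq> U"
  shows "linked Q U x y"
  using assms
proof (induction \<omega> arbitrary: x)
  case Nil
  then show ?case by (simp add: paths_def)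
next
  case (Cons a \<omega>)
  have a: "a = x" using Cons.prems(1) by (simp add: paths_def)
  show ?case
  proof (cases "\<omega> = []")
    case True
    then show ?thesis using Cons.prems(1) a by (simp add: paths_def linked_def)
  next
    case False
    have nth: "Q ((a # \<omega>) ! i) ((a # \<omega>) ! Suc i) > 0" if "Suc i < length (a # \<omega>)" for i
      using Cons.prems(1) that unfolding paths_def by blast
    have "\<omega> \<in> paths X Q (hd \<omega>) y"
      using Cons.prems(1) False nth[of "Suc _"] by (auto simp: paths_def)
    then have "linked Q U (hd \<omega>) y" using Cons.IH Cons.prems(2) by simp
    moreover have "Q x (hd \<omega>) > 0" using nth[of 0] False a by (simp add: hd_conv_nth)
    moreover have "x \<in> U" "hd \<omega> \<in> U" using Cons.prems(2) a False by auto
    ultimately show ?thesis unfolding linked_def by (intro converse_rtranclp_into_rtranclp[of _ x "hd \<omega>"]) auto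
  qed
qed

lemma set_path_nonempty: "\<omega> \<in> paths X Q x y \<Longrightarrow> set \<omega> \<noteq> {}"
  by (simp add: paths_def)

lemma height_le_iff: "\<omega> \<in> paths X Q x y \<Longrightarrow> height H \<omega> \<le> c \<longleftrightarrow> (\<forall>z\<in>set \<omega>. H z \<le> c)"
  by (simp add: height_def paths_def)

lemma finite_heights: "finite X \<Longrightarrow> finite (height H ` paths X Q x y)"
proof (rule finite_subset)
  show "height H ` paths X Q x y \<subseteq> H ` X"
  proof
    fix h assume "h \<in> height H ` paths X Q x y"
    then obtain \<omega> where \<omega>: "\<omega> \<in> paths X Q x y" "h = Max (H ` set \<omega>)" by (auto simp: height_def)
    have "Max (H ` set \<omega>) \<in> H ` set \<omega>" using set_path_nonempty[OF \<omega>(1)] by (intro Max_in) auto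
    moreover have "set \<omega> \<subseteq> X" using \<omega>(1) by (simp add: paths_def)
    ultimately show "h \<in> H ` X" unfolding \<omega>(2) by blast
  qed
qed simp

lemma comm_height_le: "finite X \<Longrightarrow> \<omega> \<in> paths X Q x y \<Longrightarrow> comm_height X Q H x y \<le> height H \<omega>"
  unfolding comm_height_def by (rule Min_le) (auto simp: finite_heights)

text \<open>Since \<open>W\<close> is hit by every path of height at most \<open>c\<close> and lies at level \<open>c\<close>, there is no path of
  smaller height.\<close>

lemma minimal_gateI:
  assumes fin: "finite X" and "W \<noteq> {}" and WX: "W \<subseteq> X"
    and level: "\<And>\<xi>. \<xi> \<in> W \<Longrightarrow> H \<xi> = c"
    and through: "\<And>\<xi>. \<xi> \<in> W \<Longrightarrow> \<exists>\<omega>\<in>paths X Q \<sigma> \<sigma>'. (\<forall>z\<in>set \<omega>. H z \<le> c) \<and> set \<omega> \<inter> W = {\<xi>}"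
    and hit: "\<And>\<omega>. \<omega> \<in> paths X Q \<sigma> \<sigma>' \<Longrightarrow> \<forall>z\<in>set \<omega>. H z \<le> c \<Longrightarrow> set \<omega> \<inter> W \<noteq> {}"
  shows "minimal_gate X Q H \<sigma> \<sigma>' W" "comm_height X Q H \<sigma> \<sigma>' = c"
proof -
  have ge: "c \<le> height H \<omega>" if \<omega>: "\<omega> \<in> paths X Q \<sigma> \<sigma>'" for \<omega>
  proof (rule ccontr)
    assume "\<not> c \<le> height H \<omega>"
    then have lt: "height H \<omega> < c" by simp
    then have "\<forall>z\<in>set \<omega>. H z \<le> c" using height_le_iff[OF \<omega>, of H c] by simp
    then obtain \<xi> where "\<xi> \<in> set \<omega>" "\<xi> \<in> W" using hit[OF \<omega>] by blast
    then have "c \<le> height H \<omega>" using height_le_iff[OF \<omega>, of H "height H \<omega>"] level by force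
    then show False using lt by simp
  qed
  have eq: "height H \<omega> = c" if "\<omega> \<in> paths X Q \<sigma> \<sigma>'" "\<forall>z\<in>set \<omega>. H z \<le> c" for \<omega>
    using ge[OF that(1)] height_le_iff[OF that(1), of H c] that(2) by simp
  obtain \<xi> where "\<xi> \<in> W" using \<open>W \<noteq> {}\<close> by blast
  then obtain \<omega> where \<omega>: "\<omega> \<in> paths X Q \<sigma> \<sigma>'" "\<forall>z\<in>set \<omega>. H z \<le> c" using through by blast
  show ch: "comm_height X Q H \<sigma> \<sigma>' = c" unfolding comm_height_def
  proof (rule Min_eqI)
    show "finite (height H ` paths X Q \<sigma> \<sigma>')" by (rule finite_heights[OF fin])
    show "c \<in> height H ` paths X Q \<sigma> \<sigma>'" using eq[OF \<omega>] \<omega>(1) by (metis imageI)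
  qed (use ge in blast)
  have opt: "\<omega> \<in> optimal_paths X Q H \<sigma> \<sigma>' \<longleftrightarrow> \<omega> \<in> paths X Q \<sigma> \<sigma>' \<and> (\<forall>z\<in>set \<omega>. H z \<le> c)" for \<omega>
    using eq[of \<omega>] height_le_iff[of \<omega> X Q \<sigma> \<sigma>' H c] unfolding optimal_paths_def ch by auto
  have hc: "height H \<omega> = c" if "\<omega> \<in> optimal_paths X Q H \<sigma> \<sigma>'" for \<omega>
    using that unfolding optimal_paths_def ch by blast
  have "W \<subseteq> minimal_saddles X Q H \<sigma> \<sigma>'"
  proof
    fix \<xi> assume \<xi>: "\<xi> \<in> W"
    then obtain \<omega> where "\<omega> \<in> paths X Q \<sigma> \<sigma>'" "\<forall>z\<in>set \<omega>. H z \<le> c" "set \<omega> \<inter> W = {\<xi>}"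
      using through by blast
    then have "\<omega> \<in> optimal_paths X Q H \<sigma> \<sigma>'" "\<xi> \<in> set \<omega>" using opt by blast+
    moreover have "H \<xi> = height H \<omega>" using level[OF \<xi>] hc[OF calculation(1)] by simp
    ultimately show "\<xi> \<in> minimal_saddles X Q H \<sigma> \<sigma>'"
      using \<xi> WX unfolding minimal_saddles_def by blast
  qed
  then have "gate X Q H \<sigma> \<sigma>' W" unfolding gate_def using opt hit by blast
  moreover have "\<exists>\<omega>\<in>optimal_paths X Q H \<sigma> \<sigma>'. set \<omega> \<inter> W' = {}" if W': "W' \<subset> W" for W'
  proof -
    obtain \<xi> where \<xi>: "\<xi> \<in> W" "\<xi> \<notin> W'" using W' by blast
    then obtain \<omega> where \<omega>: "\<omega> \<in> paths X Q \<sigma> \<sigma>'" "\<forall>z\<in>set \<omega>. H z \<le> c" "set \<omega> \<inter> W = {\<xi>}"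
      using through by blast
    have "set \<omega> \<inter> W' \<subseteq> {\<xi>}" using \<omega>(3) W' by auto
    then have "set \<omega> \<inter> W' = {}" using \<xi>(2) by blast
    then show ?thesis using opt \<omega>(1,2) by blast
  qed
  ultimately show "minimal_gate X Q H \<sigma> \<sigma>' W" unfolding minimal_gate_def by blast
qed

text \<open>If every optimal path can be replaced by one whose saddles are saddles in \<open>G\<close> of the old one,
  then \<open>W \<inter> G\<close> is a gate for every gate \<open>W\<close>, so a minimal gate lies within \<open>G\<close>.\<close>

lemma minimal_gate_subset:
  assumes fin: "finite X" and W: "minimal_gate X Q H \<sigma> \<sigma>' W"
    and ch: "comm_height X Q H \<sigma> \<sigma>' = c"
    and re: "\<And>\<omega>. \<omega> \<in> paths X Q \<sigma> \<sigma>' \<Longrightarrow> \<forall>z\<in>set \<omega>. H z \<le> c \<Longrightarrow>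
      \<exists>\<omega>'\<in>paths X Q \<sigma> \<sigma>'. \<forall>z\<in>set \<omega>'. H z \<le> c \<and> (H z = c \<longrightarrow> z \<in> set \<omega> \<inter> G)"
  shows "W \<subseteq> G"
proof (rule ccontr)
  assume "\<not> W \<subseteq> G"
  then have "W \<inter> G \<subset> W" by blast
  then obtain \<omega> where \<omega>: "\<omega> \<in> optimal_paths X Q H \<sigma> \<sigma>'" "set \<omega> \<inter> (W \<inter> G) = {}"
    using W unfolding minimal_gate_def by blast
  have \<omega>p: "\<omega> \<in> paths X Q \<sigma> \<sigma>'" "height H \<omega> = c" using \<omega>(1) unfolding optimal_paths_def ch by blast+
  then have "\<forall>z\<in>set \<omega>. H z \<le> c" using height_le_iff[OF \<omega>p(1), of H c] by simp
  then obtain \<omega>' where \<omega>': "\<omega>' \<in> paths X Q \<sigma> \<sigma>'"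
    "\<forall>z\<in>set \<omega>'. H z \<le> c \<and> (H z = c \<longrightarrow> z \<in> set \<omega> \<inter> G)" using re[OF \<omega>p(1)] by blast
  then have "height H \<omega>' = c"
    using height_le_iff[OF \<omega>'(1), of H c] comm_height_le[OF fin \<omega>'(1), of H] ch by auto
  then have "\<omega>' \<in> optimal_paths X Q H \<sigma> \<sigma>'" using \<omega>'(1) unfolding optimal_paths_def ch by blast
  then obtain \<xi> where \<xi>: "\<xi> \<in> set \<omega>'" "\<xi> \<in> W"
    using W unfolding minimal_gate_def gate_def by blast
  have "\<xi> \<in> minimal_saddles X Q H \<sigma> \<sigma>'" using \<xi>(2) W unfolding minimal_gate_def gate_def by blast
  then have "H \<xi> = c" unfolding minimal_saddles_def optimal_paths_def ch by auto
  then have "\<xi> \<in> set \<omega> \<inter> G" using \<omega>'(2) \<xi>(1) by blast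
  then show False using \<omega>(2) \<xi>(2) by blast
qed

context ising_torus begin

section \<open>Minimal gates of the Ising model\<close>

abbreviation "barrier \<equiv> 2 * real K + 2 - 2 * real (K * L)"

lemma V_nonempty: "V \<noteq> {}" using mem_V[of 0 0] Kpos Lpos by blast

lemma energy_eq: "A \<subseteq> V \<Longrightarrow> energy K L (cfg K L A) = real (bd K L A) - 2 * real (K * L)"
  using energy_cfg[OF K3, of L A] L4 by simp

lemma energy_le_iff: "A \<subseteq> V \<Longrightarrow> energy K L (cfg K L A) \<le> barrier \<longleftrightarrow> A \<in> Lev"
proof -
  assume A: "A \<subseteq> V"
  have "real (bd K L A) \<le> real (2 * K + 2) \<longleftrightarrow> bd K L A \<le> 2 * K + 2" by (rule of_nat_le_iff)
  then show ?thesis using energy_eq[OF A] A by (auto simp: Lev_def)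
qed

lemma energy_eq_iff: "A \<subseteq> V \<Longrightarrow> energy K L (cfg K L A) = barrier \<longleftrightarrow> bd K L A = 2 * K + 2"
proof -
  assume A: "A \<subseteq> V"
  have "real (bd K L A) = real (2 * K + 2) \<longleftrightarrow> bd K L A = 2 * K + 2" by (rule of_nat_eq_iff)
  then show ?thesis using energy_eq[OF A] by auto
qed

lemma linked_of_joined:
  assumes "joined U A B" "U \<subseteq> Pow V"
  shows "linked (conn K L) (cfg K L ` U) (cfg K L A) (cfg K L B)"
  using assms(1) unfolding joined_def
proof (induction rule: rtranclp_induct)
  case base
  then show ?case by (simp add: linked_def)
next
  case (step Y Z)
  then have "Y \<in> U" "Z \<in> U" "near Y Z" by auto
  then have "conn K L (cfg K L Y) (cfg K L Z) > 0"
    using conn_cfg_iff[OF _ _ V_nonempty, of Y Z] assms(2) by blast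
  then show ?case by (rule linked_snoc[OF step.IH imageI[OF \<open>Y \<in> U\<close>] imageI[OF \<open>Z \<in> U\<close>]])
qed

lemma joined_of_linked:
  assumes "linked (conn K L) (cfg K L ` U) (cfg K L A) \<tau>" "A \<subseteq> V" "U \<subseteq> Pow V"
  shows "\<exists>B. B \<subseteq> V \<and> \<tau> = cfg K L B \<and> joined U A B"
  using assms(1) unfolding linked_def
proof (induction rule: rtranclp_induct)
  case base
  then show ?case using assms(2) by (intro exI[of _ A]) simp
next
  case (step y z)
  then obtain Y where Y: "Y \<subseteq> V" "y = cfg K L Y" "joined U A Y" by blast
  obtain Y' Z where YZ: "Y' \<in> U" "y = cfg K L Y'" "Z \<in> U" "z = cfg K L Z" "conn K L y z > 0"
    using step.hyps(2) by blast
  have "Y' = Y" using inj_onD[OF inj_on_cfg[of K L], of Y' Y] YZ(1,2) Y(1,2) assms(3) by auto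
  then have "Y \<in> U" using YZ(1) by simp
  have V': "Z \<subseteq> V" using YZ(3) assms(3) by blast
  have "near Y Z" using YZ(5) conn_cfg_iff[OF Y(1) V' V_nonempty] unfolding Y(2) YZ(4) by blast
  then have "joined U Y Z" using \<open>Y \<in> U\<close> YZ(3) by (intro joined_step)
  then show ?case using V' YZ(4) joined_trans[OF Y(3)] by blast
qed

lemma path_of_joined:
  assumes "joined U A B" "A \<in> U" "U \<subseteq> Pow V"
  shows "\<exists>\<omega>\<in>paths (configs K L) (conn K L) (cfg K L A) (cfg K L B). set \<omega> \<subseteq> cfg K L ` U"
  using path_of_linked[OF linked_of_joined[OF assms(1,3)]] assms(2,3) unfolding configs_eq by blast

lemma joined_of_path:
  assumes "\<omega> \<in> paths (configs K L) (conn K L) (cfg K L A) (cfg K L B)" "set \<omega> \<subseteq> cfg K L ` U"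
    and "A \<subseteq> V" "B \<subseteq> V" "U \<subseteq> Pow V"
  shows "joined U A B"
proof -
  obtain B' where "B' \<subseteq> V" "cfg K L B = cfg K L B'" "joined U A B'"
    using joined_of_linked[OF linked_of_path[OF assms(1,2)] assms(3,5)] by blast
  then show ?thesis using inj_onD[OF inj_on_cfg[of K L], of B B'] assms(4) by auto
qed

lemma empty_Lev: "{} \<in> Lev"
proof -
  have c: "sweep (\<lambda>q. (0 + q) mod L)" unfolding sweep_def using Lpos by blast
  show ?thesis using fill_Lev[OF c, of 0 0] by simp
qed

lemma joined_Lev: "joined Lev {} V"
proof -
  have c: "sweep (\<lambda>q. (0 + q) mod L)" unfolding sweep_def using Lpos by blast
  show ?thesis
    using fill_joined[of 0 "K * L" "\<lambda>q. (0 + q) mod L" 0 Lev] fill_Lev[OF c] fill_all[OF c] by simp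
qed

lemma Lev_Pow: "Lev \<subseteq> Pow V" by (auto simp: Lev_def)

lemma ising_minimal_gate_mingate:
  assumes "mingate W"
  shows "ising_minimal_gate K L (cfg K L ` W)"
    "comm_height (configs K L) (conn K L) (energy K L) (const_config K L (-1)) (const_config K L 1) = barrier"
proof -
  let ?P = "paths (configs K L) (conn K L) (cfg K L {}) (cfg K L V)"
  have W: "X \<subseteq> V" "bd K L X = 2 * K + 2" "joined (Lev - (W - {X})) {} X" "joined (Lev - (W - {X})) X V"
    if "X \<in> W" for X using assms that unfolding mingate_def by blast+
  have WV: "W \<subseteq> Pow V" using W(1) by blast
  have ends: "{} \<notin> W" "V \<notin> W"
  proof -
    have "bd K L {} = 0" unfolding bd_def row_def col_def by (simp add: changes_trivial)
    moreover have "bd K L V = bd K L {}" using bd_compl[of K L "{}"] by simp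
    ultimately show "{} \<notin> W" "V \<notin> W" using W(2) by force+
  qed
  have 1: "finite (configs K L)" by (rule finite_configs)
  have 2: "cfg K L ` W \<noteq> {}" using assms joined_Lev unfolding mingate_def by auto
  have 3: "cfg K L ` W \<subseteq> configs K L" using WV unfolding configs_eq by blast
  have 4: "energy K L \<xi> = barrier" if \<xi>: "\<xi> \<in> cfg K L ` W" for \<xi>
    using \<xi> W(1,2) energy_eq_iff by blast
  have 5: "\<exists>\<omega>\<in>?P. (\<forall>z\<in>set \<omega>. energy K L z \<le> barrier) \<and> set \<omega> \<inter> cfg K L ` W = {\<xi>}"
    if \<xi>: "\<xi> \<in> cfg K L ` W" for \<xi>
  proof -
    obtain X where X: "X \<in> W" "\<xi> = cfg K L X" using \<xi> by blast
    define U where "U = Lev - (W - {X})"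
    have U: "U \<subseteq> Pow V" "{} \<in> U" "X \<in> U"
      using Lev_Pow empty_Lev ends W(1,2)[OF X(1)] unfolding U_def by (auto simp: Lev_def)
    obtain \<omega>1 where \<omega>1: "\<omega>1 \<in> paths (configs K L) (conn K L) (cfg K L {}) (cfg K L X)" "set \<omega>1 \<subseteq> cfg K L ` U"
      using path_of_joined[OF W(3)[OF X(1), folded U_def] U(2,1)] by blast
    obtain \<omega>2 where \<omega>2: "\<omega>2 \<in> paths (configs K L) (conn K L) (cfg K L X) (cfg K L V)" "set \<omega>2 \<subseteq> cfg K L ` U"
      using path_of_joined[OF W(4)[OF X(1), folded U_def] U(3,1)] by blast
    obtain \<omega> where \<omega>: "\<omega> \<in> ?P" "set \<omega> = set \<omega>1 \<union> set \<omega>2" using append_in_paths[OF \<omega>1(1) \<omega>2(1)] by blast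
    have sub: "set \<omega> \<subseteq> cfg K L ` U" using \<omega>(2) \<omega>1(2) \<omega>2(2) by blast
    have "\<xi> \<in> set \<omega>2" using \<omega>2(1) hd_in_set[of \<omega>2] unfolding X(2) paths_def by auto
    then have "\<xi> \<in> set \<omega>" unfolding \<omega>(2) by blast
    moreover have "energy K L z \<le> barrier" if z: "z \<in> set \<omega>" for z
    proof -
      obtain Z where "Z \<in> U" "z = cfg K L Z" using sub z by blast
      then show ?thesis using energy_le_iff[of Z] U(1) unfolding U_def by blast
    qed
    moreover have "z = \<xi>" if z: "z \<in> set \<omega>" "z \<in> cfg K L ` W" for z
    proof -
      obtain Z where Z: "Z \<in> U" "z = cfg K L Z" using sub z(1) by blast
      obtain Z' where Z': "Z' \<in> W" "z = cfg K L Z'" using z(2) by blast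
      have "Z = Z'" using inj_onD[OF inj_on_cfg[of K L], of Z Z'] Z Z' U(1) WV by auto
      then have "Z = X" using Z(1) Z'(1) unfolding U_def by blast
      then show ?thesis using Z(2) X(2) by simp
    qed
    ultimately have "(\<forall>z\<in>set \<omega>. energy K L z \<le> barrier) \<and> set \<omega> \<inter> cfg K L ` W = {\<xi>}"
      using \<xi> by blast
    then show ?thesis using \<omega>(1) by blast
  qed
  have 6: "set \<omega> \<inter> cfg K L ` W \<noteq> {}" if \<omega>: "\<omega> \<in> ?P" "\<forall>z\<in>set \<omega>. energy K L z \<le> barrier" for \<omega>
  proof
    assume dis: "set \<omega> \<inter> cfg K L ` W = {}"
    have "set \<omega> \<subseteq> cfg K L ` (Lev - W)"
    proof
      fix z assume z: "z \<in> set \<omega>"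
      have "set \<omega> \<subseteq> configs K L" using \<omega>(1) unfolding paths_def by blast
      then have "z \<in> configs K L" using z by blast
      then obtain Z where Z: "Z \<subseteq> V" "z = cfg K L Z" unfolding configs_eq by blast
      then have "Z \<in> Lev" using energy_le_iff[OF Z(1)] \<omega>(2) z by blast
      moreover have "Z \<notin> W" using dis z Z(2) by blast
      ultimately show "z \<in> cfg K L ` (Lev - W)" using Z(2) by blast
    qed
    then have "joined (Lev - W) {} V" by (rule joined_of_path[OF \<omega>(1)]) (use Lev_Pow in auto)
    then show False using assms unfolding mingate_def by blast
  qed
  note m = minimal_gateI[where H = "energy K L" and Q = "conn K L", OF 1 2 3 4 5 6]
  show "ising_minimal_gate K L (cfg K L ` W)" using m(1) unfolding cfg_empty cfg_torus .
  show "comm_height (configs K L) (conn K L) (energy K L) (const_config K L (-1)) (const_config K L 1) = barrier"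
    using m(2) unfolding cfg_empty cfg_torus .
qed

lemma ising_minimal_gate_core:
  assumes "4 \<le> K" "ising_minimal_gate K L W"
  shows "W \<subseteq> cfg K L ` core"
proof (rule minimal_gate_subset[OF finite_configs assms(2) ising_minimal_gate_mingate(2)[OF mingate_two_columns]])
  let ?P = "paths (configs K L) (conn K L) (const_config K L (-1)) (const_config K L 1)"
  fix \<omega> assume \<omega>: "\<omega> \<in> ?P" "\<forall>z\<in>set \<omega>. energy K L z \<le> barrier"
  define S where "S = {X \<in> Lev. bd K L X = 2 * K + 2 \<and> cfg K L X \<in> set \<omega>}"
  have sub: "Non \<union> T \<subseteq> Pow V" if "T \<subseteq> S" for T using that Lev_Pow Non_Lev unfolding S_def by blast
  have "set \<omega> \<subseteq> cfg K L ` (Non \<union> S)"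
  proof
    fix z assume z: "z \<in> set \<omega>"
    have "set \<omega> \<subseteq> configs K L" using \<omega>(1) unfolding paths_def by blast
    then have "z \<in> configs K L" using z by blast
    then obtain Z where Z: "Z \<subseteq> V" "z = cfg K L Z" unfolding configs_eq by blast
    then have "Z \<in> Lev" using energy_le_iff[OF Z(1)] \<omega>(2) z by blast
    then have "Z \<in> Non \<union> S" using z Z(2) by (auto simp: Non_def Lev_def S_def)
    then show "z \<in> cfg K L ` (Non \<union> S)" using Z(2) by blast
  qed
  then have "joined (Non \<union> S) {} V"
    by (rule joined_of_path[OF \<omega>(1)[folded cfg_empty cfg_torus]]) (use sub in auto)
  then have j: "joined (Non \<union> (S \<inter> core)) {} V" by (rule reroute[OF assms(1), rotated]) (auto simp: S_def)
  have c: "sweep (\<lambda>q. (0 + q) mod L)" unfolding sweep_def using Lpos by blast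
  have "{} \<in> Non \<union> (S \<inter> core)" using fill_Non[OF c, of 0 0] by simp
  then obtain \<omega>' where \<omega>': "\<omega>' \<in> ?P" "set \<omega>' \<subseteq> cfg K L ` (Non \<union> (S \<inter> core))"
    using path_of_joined[OF j _ sub] unfolding cfg_empty cfg_torus by blast
  have "energy K L z \<le> barrier \<and> (energy K L z = barrier \<longrightarrow> z \<in> set \<omega> \<inter> cfg K L ` core)"
    if z: "z \<in> set \<omega>'" for z
  proof -
    obtain Z where Z: "Z \<in> Non \<union> (S \<inter> core)" "z = cfg K L Z" using \<omega>'(2) z by blast
    then have ZL: "Z \<in> Lev" using Non_Lev unfolding S_def by blast
    then have ZV: "Z \<subseteq> V" using Lev_Pow by blast
    have "z \<in> set \<omega> \<inter> cfg K L ` core" if "energy K L z = barrier"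
    proof -
      have "bd K L Z = 2 * K + 2" using that energy_eq_iff[OF ZV] unfolding Z(2) by blast
      then have "Z \<notin> Non" by (simp add: Non_def)
      then show ?thesis using Z unfolding S_def by blast
    qed
    then show ?thesis using energy_le_iff[OF ZV] ZL unfolding Z(2) by blast
  qed
  then show "\<exists>\<omega>'\<in>?P. \<forall>z\<in>set \<omega>'. energy K L z \<le> barrier \<and>
      (energy K L z = barrier \<longrightarrow> z \<in> set \<omega> \<inter> cfg K L ` core)" using \<omega>'(1) by blast
qed

lemma R_bar_eq: "R_bar K L a b (-1) 1 = cfg K L ` Rset a b"
  unfolding R_bar_def Rset_def cfg_def by blast

lemma B_bar_eq: "B_bar K L h a b (-1) 1 = cfg K L ` Bset h a b"
  unfolding B_bar_def Bset_def cfg_def by blast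

lemma R_tilde_eq: "R_tilde K L a b (-1) 1 = cfg K L ` (\<lambda>X. V - X) ` Rset a b"
  unfolding R_tilde_def R_bar_def Rset_def two_valued_compl by blast

lemma B_tilde_eq: "B_tilde K L h a b (-1) 1 = cfg K L ` (\<lambda>X. V - X) ` Bset h a b"
proof -
  define C where "C i j i' j' \<longleftrightarrow> (i, j) \<in> V \<and> (i', j') \<in> V \<and>
    (j' = (j + a) mod L \<or> (j' + 1) mod L = j) \<and>
    fst ` rect K L i' j' 1 h \<subseteq> fst ` rect K L i j a b" for i j i' j'
  define r where "r i j i' j' = rect K L i j a b \<union> rect K L i' j' 1 h" for i j i' j'
  have "B_tilde K L h a b (-1) 1 = {cfg K L (V - r i j i' j') | i j i' j'. C i j i' j'}"
    unfolding B_tilde_def B_bar_def two_valued_compl C_def r_def ..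
  also have "\<dots> = cfg K L ` (\<lambda>X. V - X) ` {r i j i' j' | i j i' j'. C i j i' j'}" by blast
  also have "{r i j i' j' | i j i' j'. C i j i' j'} = Bset h a b" unfolding Bset_def C_def r_def ..
  finally show ?thesis .
qed

abbreviation "Pset \<equiv> Bset (K - 1) 1 K"
abbreviation "Qset \<equiv> Rset 2 (K - 1) \<union> Bset (K - 2) 1 K"
abbreviation "Hset i \<equiv> Bset i 1 K \<union> (\<Union>h\<in>{i+1..K-2}. Bset h 1 (K - 1))"

lemma bar_families:
  "P_bar K L (-1) 1 = cfg K L ` Pset"
  "Q_bar K L (-1) 1 = cfg K L ` Qset"
  "Hi_bar K L i (-1) 1 = cfg K L ` Hset i"
  "Wh K L j h (-1) 1 = cfg K L ` Bset h j K"
  unfolding P_bar_def Q_bar_def Hi_bar_def Wh_def B_bar_eq R_bar_eq by (simp_all add: image_Un image_UN)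

lemma tilde_families:
  "P_tilde K L (-1) 1 = cfg K L ` (\<lambda>X. V - X) ` Pset"
  "Q_tilde K L (-1) 1 = cfg K L ` (\<lambda>X. V - X) ` Qset"
  "Hi_tilde K L i (-1) 1 = cfg K L ` (\<lambda>X. V - X) ` Hset i"
  unfolding P_tilde_def Q_tilde_def Hi_tilde_def B_tilde_eq R_tilde_eq by (simp_all add: image_Un image_UN)

lemma core_families:
  "cfg K L ` core = (\<Union>j\<in>{2..L-3}. Wj K L j (-1) 1) \<union>
     H_bar K L (-1) 1 \<union> H_tilde K L (-1) 1 \<union> Q_bar K L (-1) 1 \<union> Q_tilde K L (-1) 1 \<union>
     P_bar K L (-1) 1 \<union> P_tilde K L (-1) 1"
proof -
  have low: "lowcore = Pset \<union> Qset \<union> (\<Union>i\<in>{1..K-3}. Hset i)" unfolding lowcore_def ..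
  show ?thesis
    unfolding core_def low Wj_def H_bar_def H_tilde_def bar_families tilde_families
      image_Un image_UN by (simp only: Un_ac)
qed

lemma mingate_Pset: "mingate Pset"
proof -
  have "K + (K - 1) \<le> (L - 2) * K" by (rule K_plus_le) simp
  then show ?thesis using K3 L4 by (intro mingate_band_bar) auto
qed

lemma mingate_Hset: "i \<in> {1..K-3} \<Longrightarrow> mingate (Hset i)"
  by (intro mingate_wide_bars) auto

lemma mingate_middle:
  assumes "j \<in> {2..L-3}" "h \<in> {1..K-1}"
  shows "mingate (Bset h j K)"
proof (rule mingate_band_bar)
  have "2 * K \<le> j * K" using assms(1) by (intro mult_le_mono1) simp
  then show "2 * K - 1 \<le> j * K + h" by linarith
  have "Suc j * K \<le> (L - 2) * K" using assms(1) by (intro mult_le_mono1) auto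
  then show "j * K + h \<le> (L - 2) * K + 1" using assms(2) by auto
qed (use assms Kpos in auto)

end

theorem corollary3p4:
  fixes K L :: nat
  assumes "K < L" and "3 \<le> L" and "3 \<le> K"
  shows
    "(ising_minimal_gate K L (P_bar K L (-1) 1) \<and> ising_minimal_gate K L (P_tilde K L (-1) 1)) \<and>
     (ising_minimal_gate K L (Q_bar K L (-1) 1) \<and> ising_minimal_gate K L (Q_tilde K L (-1) 1)) \<and>
     (\<forall>i\<in>{1..K-3}. ising_minimal_gate K L (Hi_bar K L i (-1) 1) \<and>
                   ising_minimal_gate K L (Hi_tilde K L i (-1) 1)) \<and>
     (\<forall>j\<in>{2..L-3}. \<forall>h\<in>{1..K-1}. ising_minimal_gate K L (Wh K L j h (-1) 1)) \<and>
     (4 \<le> K \<longrightarrow>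
       \<Union>{G. ising_minimal_gate K L G} =
         (\<Union>j\<in>{2..L-3}. Wj K L j (-1) 1) \<union>
         H_bar K L (-1) 1 \<union> H_tilde K L (-1) 1 \<union>
         Q_bar K L (-1) 1 \<union> Q_tilde K L (-1) 1 \<union>
         P_bar K L (-1) 1 \<union> P_tilde K L (-1) 1)"
proof -
  interpret ising_torus K L by unfold_locales (use assms in auto)
  note gate = ising_minimal_gate_mingate(1)
  have P: "ising_minimal_gate K L (P_bar K L (-1) 1)" "ising_minimal_gate K L (P_tilde K L (-1) 1)"
    unfolding bar_families tilde_families
    using gate[OF mingate_Pset] gate[OF mingate_compl[OF mingate_Pset]] by blast+
  have Q: "ising_minimal_gate K L (Q_bar K L (-1) 1)" "ising_minimal_gate K L (Q_tilde K L (-1) 1)"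
    unfolding bar_families tilde_families
    using gate[OF mingate_two_columns] gate[OF mingate_compl[OF mingate_two_columns]] by blast+
  have H: "ising_minimal_gate K L (Hi_bar K L i (-1) 1)" "ising_minimal_gate K L (Hi_tilde K L i (-1) 1)"
    if "i \<in> {1..K-3}" for i
    unfolding bar_families tilde_families
    using gate[OF mingate_Hset[OF that]] gate[OF mingate_compl[OF mingate_Hset[OF that]]] by blast+
  have W: "ising_minimal_gate K L (Wh K L j h (-1) 1)" if "j \<in> {2..L-3}" "h \<in> {1..K-1}" for j h
    unfolding bar_families by (rule gate[OF mingate_middle[OF that]])
  have "\<Union>{G. ising_minimal_gate K L G} = cfg K L ` core" if "4 \<le> K"
  proof
    show "\<Union>{G. ising_minimal_gate K L G} \<subseteq> cfg K L ` core"
      using ising_minimal_gate_core[OF that] by blast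
    show "cfg K L ` core \<subseteq> \<Union>{G. ising_minimal_gate K L G}"
      unfolding core_families Wj_def H_bar_def H_tilde_def using P Q H W by blast
  qed
  then show ?thesis using P Q H W unfolding core_families by blast
qed

end
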